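(* Suppose $X_1, X_2, \ldots$ are i.i.d. draws from a distribution $\mu$ that satisfies Assumption A (see context) with $\alpha \ge 0$. Fix $\delta \in \left(\frac{1}{4\alpha+3}, \frac{1}{\alpha+1}\right)$, and suppose $c_n = \omega(1)$ is a positive sequence satisfying $\log(c_n) = o(\log n)$. Then there is a constant $C > 0$ so that with probability $1 - O(c_n^{-1})$, the following are true statements concerning the polynomial $p_n(z) := \prod_{j=1}^n (z - X_j)$ and its roots and critical points that lie in the annulus $$\mathcal{A}_n := \left\{ z \in \mathbb{C} : 1 - \frac{1}{n^\delta} \le |z| \le 1 \right\}:$$ (i) There are at least $\frac{n^{1-\delta(\alpha+1)}}{c_n \log n}$ critical points of $p_n$ in $\mathcal{A}_n$. (ii) Within distance $n^{-(5+\delta)/6}$ of each root $X_i \in \mathcal{A}_n$, $i \in [n]$, there is precisely one critical point $W_i^{(n)}$ of $p_n$, and these critical points satisfy $$\max_{i : X_i \in \mathcal{A}_n} \left| W_i^{(n)} - X_i + \frac{1}{n}\, \frac{1}{\frac{1}{n-1}\sum_{j \ne i} \frac{1}{X_i - X_j}} \right| < \frac{1}{n^{(3-\delta)/2}}$$ and $$\max_{i : X_i \in \mathcal{A}_n} \left| W_i^{(n)} - X_i(1 - n^{-1}) \right| < \frac{C}{n c_n}.$$ (iii) There is an injection $\iota$ from the set of critical points of $p_n$ that lie in $\mathcal{A}_n$ to the set of indices $[n]$ of the roots of $p_n$, so that each critical point $W \in \mathcal{A}_n$ corresponds to precisely one root $X_{\iota(W)} \in \mathcal{A}_n$ according to the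 relationship $$W = X_{\iota(W)}\left(1 - n^{-1} + o(n^{-1})\right).$$ More specifically, $$\max_{W \in \mathcal{A}_n,\ p_n'(W)=0} \left| W - X_{\iota(W)}(1 - n^{-1}) \right| < \frac{C}{n c_n},$$ so the asymptotic notation in the preceding display is uniform over all critical points $W \in \mathcal{A}_n$.
   Context: Assumption A (with parameter $\alpha > -1$): $\mu$ is a radially symmetric (rotation-invariant about $0$) probability measure supported on the unit disk centered at the origin in $\mathbb{C}$ such that (a) there is $\varepsilon \in (0,1]$ so that in the annulus $\{z : 1 - \varepsilon \le |z| \le 1\}$, $\mu$ has a density $f_\mu(z)$ with respect to Lebesgue measure on $\mathbb{C}$; (b) there are constants $c_\mu, C_\mu > 0$ so that the radial density $f_R(r) := 2\pi r f_\mu(r e^{\sqrt{-1}\theta})$ (which does not depend on $\theta$) satisfies $c_\mu \le \frac{f_R(r)}{(1-r)^\alpha} \le C_\mu$ for $1-\varepsilon \le r < 1$. Critical points of a polynomial are the roots of its derivative. $[n] = \{1,\ldots,n\}$. Asymptotic notation is as $n \to \infty$; $c_n=\omega(1)$ means $c_n\to\infty$. "With probability $1 - O(a_n)$" means the complementary event has probability $O(a_n)$. *)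

theory Defs
  imports "HOL-Probability.Probability" "HOL-Computational_Algebra.Polynomial"
    "HOL-Library.Landau_Symbols"
begin

text \<open>The density is only determined almost everywhere, so radial symmetry is imposed on a chosen
  version of it; this is what makes \<open>radial_density\<close> independent of the angle.\<close>

definition radial_density :: "(complex \<Rightarrow> real) \<Rightarrow> real \<Rightarrow> real" where
  "radial_density f r = 2 * pi * r * f (complex_of_real r)"

definition assumption_A :: "real \<Rightarrow> complex measure \<Rightarrow> bool" where
  "assumption_A \<alpha> \<mu> \<longleftrightarrow>
     \<alpha> > -1 \<and> prob_space \<mu> \<and> sets \<mu> = sets borel \<and>
     (\<forall>\<theta>. distr \<mu> borel (\<lambda>z. cis \<theta> * z) = \<mu>) \<and>
     (AE z in \<mu>. norm z \<le> 1) \<and>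
     (\<exists>\<epsilon> f. 0 < \<epsilon> \<and> \<epsilon> \<le> 1 \<and>
        f \<in> borel_measurable borel \<and> (\<forall>z. 0 \<le> f z) \<and>
        (\<forall>A \<in> sets borel. A \<subseteq> {z. 1 - \<epsilon> \<le> norm z \<and> norm z \<le> 1} \<longrightarrow>
           emeasure \<mu> A = (\<integral>\<^sup>+z\<in>A. ennreal (f z) \<partial>lborel)) \<and>
        (\<forall>r \<theta>. 1 - \<epsilon> \<le> r \<and> r \<le> 1 \<longrightarrow>
           f (complex_of_real r * cis \<theta>) = f (complex_of_real r)) \<and>
        (\<exists>c C. 0 < c \<and> 0 < C \<and>
           (\<forall>r. 1 - \<epsilon> \<le> r \<and> r < 1 \<longrightarrow>
              c \<le> radial_density f r / (1 - r) powr \<alpha> \<and>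
              radial_density f r / (1 - r) powr \<alpha> \<le> C)))"

definition iid_draws :: "'w measure \<Rightarrow> (nat \<Rightarrow> 'w \<Rightarrow> complex) \<Rightarrow> complex measure \<Rightarrow> bool" where
  "iid_draws M X \<mu> \<longleftrightarrow>
     prob_space M \<and> prob_space.indep_vars M (\<lambda>_. borel) X {1..} \<and>
     (\<forall>j\<ge>1. distr M borel (X j) = \<mu>)"

definition root_poly :: "nat \<Rightarrow> (nat \<Rightarrow> complex) \<Rightarrow> complex poly" where
  "root_poly n x = (\<Prod>j=1..n. [:- x j, 1:])"

definition critical_points :: "complex poly \<Rightarrow> complex set" where
  "critical_points p = {w. poly (pderiv p) w = 0}"

definition edge_annulus :: "real \<Rightarrow> nat \<Rightarrow> complex set" where
  "edge_annulus \<delta> n = {z. 1 - 1 / real n powr \<delta> \<le> norm z \<and> norm z \<le> 1}"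

text \<open>\<open>P n\<close> holds with probability \<open>1 - O(a n)\<close>. The failure set is required to be covered by an
  event of probability \<open>O(a n)\<close>, so that no measurability of \<open>P n\<close> itself is presupposed.\<close>

definition with_prob_1_minus_O ::
  "'w measure \<Rightarrow> (nat \<Rightarrow> 'w \<Rightarrow> bool) \<Rightarrow> (nat \<Rightarrow> real) \<Rightarrow> bool" where
  "with_prob_1_minus_O M P a \<longleftrightarrow>
     (\<exists>B. (\<forall>n. B n \<in> sets M \<and> {\<omega> \<in> space M. \<not> P n \<omega>} \<subseteq> B n) \<and>
          (\<lambda>n. measure M (B n)) \<in> O(a))"

end

theory Submission imports Defs begin

text \<open>
  Near a root \<open>X\<^sub>i\<close> the equation \<open>p' = 0\<close> reads \<open>z = X\<^sub>i - 1 / H\<^sub>i(z)\<close> with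
  \<open>H\<^sub>i(z) = \<Sum>\<^bsub>j \<noteq> i\<^esub> 1 / (z - X\<^sub>j)\<close>. Close to the edge \<open>H\<^sub>i(z)\<close> is almost \<open>n / z\<close>, since rotation
  invariance gives \<open>E[1 / (z - X)] = \<mu>(\<bar>X\<bar> < \<bar>z\<bar>) / z\<close>; the fixed point map is then a contraction
  of a small disc about \<open>X\<^sub>i\<close>, and its fixed point is close to \<open>X\<^sub>i - X\<^sub>i / n\<close>.

  To have the approximation simultaneously for all \<open>z\<close> in the annulus of width \<open>w = n\<^bsup>-\<delta>\<^esup>\<close>, the sum
  is split at distance \<open>2 s\<close>, where \<open>s\<close> is slightly above \<open>n\<^bsup>-(1 + \<delta>)/2\<^esup>\<close>. For the far part, Chebyshev's
  inequality at the points of a net of mesh \<open>s / 2\<close> suffices, because such a net has only about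
  \<open>w / s\<^sup>2 \<ll> n\<close> points and the failure probability at each is about \<open>1 / n\<close>. For the near part, Markov's
  inequality for \<open>\<Sum>\<^bsub>i \<noteq> j\<^esub> \<bar>X\<^sub>i - X\<^sub>j\<bar>\<^bsup>-q\<^esup>\<close> over close pairs, with \<open>q < 2\<close> near \<open>2\<close>, bounds both the gaps
  between roots and \<open>\<Sum>\<^bsub>j\<^esub> \<bar>X\<^sub>i - X\<^sub>j\<bar>\<^bsup>-2\<^esup>\<close>; the near part stays below \<open>n\<close> exactly when
  \<open>\<delta> > 1 / (4 \<alpha> + 3)\<close>.
\<close>

section \<open>Sums over an i.i.d. sample\<close>

text \<open>The obstacle is uniformity in \<open>z\<close>. The square of \<open>1 / (z - X)\<close>
  is not integrable against a planar density, so at a single point only bounds with polynomially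
  small failure probability are available. A union bound then affords fewer than about
  \<open>n\<close> net points, and with \<open>w / s\<^sup>2\<close> of them this is what forces
  \<open>s\<close> above \<open>n powr (- (1 + \<delta>) / 2)\<close>. At that scale a net point
  cannot resolve roots that lie close to one another. Hence the near part is never estimated at a
  net point, but always at a root: either \<open>z\<close> lies in the small disc about that root,
  or the root is the one nearest to \<open>z\<close>, and in both cases distances from
  \<open>z\<close> are at least half of those from the root. The threshold for \<delta> comes out as
  follows. Close pairs have energy about
  \<open>n\<^sup>2 * w powr (2 * \<alpha> + 1) = n powr e\<close> with
  \<open>e = 2 - \<delta> * (2 * \<alpha> + 1)\<close>. The near part is about
  \<open>s * n powr e\<close>, and this is below \<open>n\<close> when
  \<open>e < 3/2 + \<delta>/2\<close>, that is, when
  \<open>1 < \<delta> * (4 * \<alpha> + 3)\<close>. Chance enters only through a good event; given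
  that event, everything about critical points is deterministic.\<close>

lemma power2_le_of_abs_le: "\<bar>a\<bar> \<le> b \<Longrightarrow> a\<^sup>2 \<le> b\<^sup>2" for a b :: real
  by (metis abs_ge_zero power2_abs power_mono)

locale iid_sample =
  fixes M :: "'w measure" and X :: "nat \<Rightarrow> 'w \<Rightarrow> complex" and \<mu> :: "complex measure"
  assumes iid: "iid_draws M X \<mu>"

sublocale iid_sample \<subseteq> prob_space M
  using iid unfolding iid_draws_def by blast

context iid_sample
begin

lemma indep: "indep_vars (\<lambda>_. borel) X {1..}"
  using iid unfolding iid_draws_def by blast

lemma X_measurable [measurable]: "j \<ge> 1 \<Longrightarrow> X j \<in> borel_measurable M"
  using indep unfolding indep_vars_def by auto

lemma distr_X: "j \<ge> 1 \<Longrightarrow> distr M borel (X j) = \<mu>"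
  using iid unfolding iid_draws_def by blast

lemma sets_mu [measurable_cong]: "sets \<mu> = sets borel"
  using distr_X[of 1] by (metis order_refl sets_distr)

lemma prob_space_mu: "prob_space \<mu>"
  using prob_space_distr[OF X_measurable[of 1]] distr_X[of 1] by simp

lemma expectation_X:
  fixes h :: "complex \<Rightarrow> 'b::{banach, second_countable_topology}"
  assumes "j \<ge> 1" "h \<in> borel_measurable borel"
  shows "expectation (\<lambda>\<omega>. h (X j \<omega>)) = integral\<^sup>L \<mu> h"
  using integral_distr[of "X j" M borel h] assms distr_X[of j] by simp

text \<open>Independence kills the cross term \<open>Y i * ?S\<close> because both factors are
  centred. The uniform bound \<open>B\<close> makes every product integrable.\<close>

lemma second_moment_sum:
  fixes Y :: "nat \<Rightarrow> 'w \<Rightarrow> real"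
  assumes "finite I" "indep_vars (\<lambda>_. borel) Y I"
    and "\<And>j. j \<in> I \<Longrightarrow> expectation (Y j) = 0" "\<And>j \<omega>. j \<in> I \<Longrightarrow> \<bar>Y j \<omega>\<bar> \<le> B"
  shows "expectation (\<lambda>\<omega>. (\<Sum>j\<in>I. Y j \<omega>)\<^sup>2) = (\<Sum>j\<in>I. expectation (\<lambda>\<omega>. (Y j \<omega>)\<^sup>2))"
  using assms
proof (induction I)
  case (insert i I)
  have rv: "Y j \<in> borel_measurable M" if "j \<in> insert i I" for j
    using insert.prems(1) that unfolding indep_vars_def by auto
  let ?S = "\<lambda>\<omega>. \<Sum>j\<in>I. Y j \<omega>"
  have rvS: "?S \<in> borel_measurable M" by (intro borel_measurable_sum) (use rv in auto)
  have bS: "\<bar>?S \<omega>\<bar> \<le> card I * B" for \<omega>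
  proof -
    have "\<bar>?S \<omega>\<bar> \<le> (\<Sum>j\<in>I. \<bar>Y j \<omega>\<bar>)" by (rule sum_abs)
    also have "\<dots> \<le> (\<Sum>j\<in>I. B)" by (intro sum_mono) (use insert.prems(3) in auto)
    finally show ?thesis by simp
  qed
  have iY: "integrable M (Y i)"
    by (rule integrable_const_bound[of _ B]) (use rv insert.prems(3) in auto)
  have iS: "integrable M ?S"
    by (rule integrable_const_bound[of _ "card I * B"]) (use rvS bS in auto)
  have iY2: "integrable M (\<lambda>\<omega>. (Y i \<omega>)\<^sup>2)"
    by (rule integrable_const_bound[of _ "B\<^sup>2"])
      (use rv insert.prems(3) in \<open>auto intro!: power2_le_of_abs_le\<close>)
  have iS2: "integrable M (\<lambda>\<omega>. (?S \<omega>)\<^sup>2)"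
    by (rule integrable_const_bound[of _ "(card I * B)\<^sup>2"])
      (use rvS bS in \<open>auto intro!: power2_le_of_abs_le\<close>)
  have ind: "indep_var borel (Y i) borel ?S"
    by (rule indep_vars_sum) (use insert in auto)
  have iP: "integrable M (\<lambda>\<omega>. Y i \<omega> * ?S \<omega>)"
    by (rule indep_var_integrable[OF ind iY iS])
  have P: "expectation (\<lambda>\<omega>. Y i \<omega> * ?S \<omega>) = 0"
    using indep_var_lebesgue_integral[OF ind iY iS] insert.prems(2)[of i] by simp
  have "expectation (\<lambda>\<omega>. (\<Sum>j\<in>insert i I. Y j \<omega>)\<^sup>2)
      = expectation (\<lambda>\<omega>. (Y i \<omega>)\<^sup>2 + (?S \<omega>)\<^sup>2 + 2 * (Y i \<omega> * ?S \<omega>))"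
    using insert.hyps by (simp add: power2_sum algebra_simps)
  also have "\<dots> = expectation (\<lambda>\<omega>. (Y i \<omega>)\<^sup>2) + expectation (\<lambda>\<omega>. (?S \<omega>)\<^sup>2)"
    using iY2 iS2 iP P by simp
  also have "expectation (\<lambda>\<omega>. (?S \<omega>)\<^sup>2) = (\<Sum>j\<in>I. expectation (\<lambda>\<omega>. (Y j \<omega>)\<^sup>2))"
    by (rule insert.IH) (use insert.prems in \<open>auto intro: indep_vars_subset\<close>)
  finally show ?case using insert.hyps by simp
qed simp

text \<open>The variance is at most the raw second moment, so \<open>V\<close> may bound the latter.
  For a truncated kernel \<open>B\<close> is finite but large: it secures integrability and stays
  out of the estimate.\<close>

lemma Chebyshev_sum_real:
  fixes h :: "complex \<Rightarrow> real"
  assumes h [measurable]: "h \<in> borel_measurable borel" and B: "\<And>x. \<bar>h x\<bar> \<le> B"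
    and V: "(\<integral>x. (h x)\<^sup>2 \<partial>\<mu>) \<le> V" and \<tau>: "\<tau> > 0"
  shows "prob {\<omega> \<in> space M. \<tau> \<le> \<bar>(\<Sum>j=1..n. h (X j \<omega>)) - n * integral\<^sup>L \<mu> h\<bar>} \<le> n * V / \<tau>\<^sup>2"
proof -
  interpret mu: prob_space \<mu> by (rule prob_space_mu)
  define m where "m = integral\<^sup>L \<mu> h"
  define Y where "Y = (\<lambda>j \<omega>. h (X j \<omega>) - m)"
  have ih: "integrable \<mu> h" by (rule mu.integrable_const_bound[of _ B]) (use B in auto)
  have ih2: "integrable \<mu> (\<lambda>x. (h x)\<^sup>2)"
    by (rule mu.integrable_const_bound[of _ "B\<^sup>2"])
      (use B in \<open>auto intro!: power2_le_of_abs_le\<close>)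
  have E0: "expectation (Y j) = 0" if "j \<ge> 1" for j
    using expectation_X[OF that, of "\<lambda>x. h x - m"] ih unfolding Y_def
    by (simp add: m_def mu.prob_space)
  have bY: "\<bar>Y j \<omega>\<bar> \<le> B + \<bar>m\<bar>" for j \<omega>
    unfolding Y_def using B[of "X j \<omega>"] by linarith
  have EY2: "expectation (\<lambda>\<omega>. (Y j \<omega>)\<^sup>2) \<le> V" if "j \<ge> 1" for j
  proof -
    have "expectation (\<lambda>\<omega>. (Y j \<omega>)\<^sup>2) = (\<integral>x. (h x - m)\<^sup>2 \<partial>\<mu>)"
      using expectation_X[OF that, of "\<lambda>x. (h x - m)\<^sup>2"] unfolding Y_def by simp
    also have "\<dots> = (\<integral>x. (h x)\<^sup>2 \<partial>\<mu>) - m\<^sup>2"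
      using mu.variance_eq[OF ih ih2] by (simp add: m_def)
    also have "\<dots> \<le> V" using V by (smt (verit) zero_le_power2)
    finally show ?thesis .
  qed
  have rvY: "Y j \<in> borel_measurable M" if "j \<ge> 1" for j
    unfolding Y_def using X_measurable[OF that] by measurable
  have indY: "indep_vars (\<lambda>_. borel) Y {1..n}"
    unfolding Y_def
    by (rule indep_vars_compose2[where M' = "\<lambda>_. borel" and X = X])
      (auto intro!: indep_vars_subset[OF indep])
  let ?S = "\<lambda>\<omega>. \<Sum>j=1..n. Y j \<omega>"
  have rvS: "?S \<in> borel_measurable M" using rvY by auto
  have bS: "\<bar>?S \<omega>\<bar> \<le> n * (B + \<bar>m\<bar>)" for \<omega>
  proof -
    have "\<bar>?S \<omega>\<bar> \<le> (\<Sum>j=1..n. \<bar>Y j \<omega>\<bar>)" by (rule sum_abs)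
    also have "\<dots> \<le> (\<Sum>j=1..n. (B + \<bar>m\<bar>))" by (intro sum_mono bY)
    finally show ?thesis by simp
  qed
  have iS2: "integrable M (\<lambda>\<omega>. (?S \<omega>)\<^sup>2)"
    by (rule integrable_const_bound[of _ "(n * (B + \<bar>m\<bar>))\<^sup>2"])
      (use rvS bS in \<open>auto intro!: power2_le_of_abs_le\<close>)
  have iY: "integrable M (Y j)" if "j \<ge> 1" for j
    by (rule integrable_const_bound[of _ "B + \<bar>m\<bar>"]) (use bY rvY[OF that] in auto)
  have ES: "expectation ?S = 0"
    by (subst Bochner_Integration.integral_sum) (use iY E0 in auto)
  have "expectation (\<lambda>\<omega>. (?S \<omega>)\<^sup>2) = (\<Sum>j=1..n. expectation (\<lambda>\<omega>. (Y j \<omega>)\<^sup>2))"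
    by (rule second_moment_sum[OF _ indY]) (use E0 bY in auto)
  also have "\<dots> \<le> (\<Sum>j=1..n. V)" by (intro sum_mono EY2) auto
  finally have "variance ?S \<le> n * V" using ES by simp
  then have "prob {\<omega> \<in> space M. \<tau> \<le> \<bar>?S \<omega> - expectation ?S\<bar>} \<le> n * V / \<tau>\<^sup>2"
    using Chebyshev_inequality[OF rvS iS2 \<tau>] by (smt (verit) divide_right_mono zero_le_power2)
  moreover have "?S \<omega> = (\<Sum>j=1..n. h (X j \<omega>)) - n * m" for \<omega>
    by (simp add: Y_def sum_subtractf)
  ultimately show ?thesis using ES by (simp add: m_def)
qed

text \<open>A deviation \<tau> forces a deviation \<open>\<tau> / 2\<close> of the real or of the
  imaginary part. Each costs \<open>4 * n * V / \<tau>\<^sup>2\<close>, hence the 8.\<close>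

lemma Chebyshev_sum:
  fixes h :: "complex \<Rightarrow> complex"
  assumes h [measurable]: "h \<in> borel_measurable borel" and B: "\<And>x. norm (h x) \<le> B"
    and V: "(\<integral>x. (norm (h x))\<^sup>2 \<partial>\<mu>) \<le> V" and \<tau>: "\<tau> > 0"
  shows "prob {\<omega> \<in> space M. \<tau> \<le> norm ((\<Sum>j=1..n. h (X j \<omega>)) - of_nat n * integral\<^sup>L \<mu> h)}
     \<le> 8 * real n * V / \<tau>\<^sup>2"
proof -
  interpret mu: prob_space \<mu> by (rule prob_space_mu)
  have ih: "integrable \<mu> h" by (rule mu.integrable_const_bound[of _ B]) (use B in auto)
  have ih2: "integrable \<mu> (\<lambda>x. (norm (h x))\<^sup>2)"
    by (rule mu.integrable_const_bound[of _ "B\<^sup>2"])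
      (use B in \<open>auto intro!: power2_le_of_abs_le\<close>)
  let ?D = "\<lambda>\<omega>. (\<Sum>j=1..n. h (X j \<omega>)) - of_nat n * integral\<^sup>L \<mu> h"
  have VR: "(\<integral>x. (Re (h x))\<^sup>2 \<partial>\<mu>) \<le> V"
    by (rule order_trans[OF integral_mono_AE' V]) (use ih2 in \<open>auto simp: cmod_power2\<close>)
  have VI: "(\<integral>x. (Im (h x))\<^sup>2 \<partial>\<mu>) \<le> V"
    by (rule order_trans[OF integral_mono_AE' V]) (use ih2 in \<open>auto simp: cmod_power2\<close>)
  let ?R = "{\<omega> \<in> space M. \<tau> / 2 \<le> \<bar>(\<Sum>j=1..n. Re (h (X j \<omega>))) - n * (\<integral>x. Re (h x) \<partial>\<mu>)\<bar>}"
  let ?I = "{\<omega> \<in> space M. \<tau> / 2 \<le> \<bar>(\<Sum>j=1..n. Im (h (X j \<omega>))) - n * (\<integral>x. Im (h x) \<partial>\<mu>)\<bar>}"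
  have hX: "(\<lambda>\<omega>. h (X j \<omega>)) \<in> borel_measurable M" if "j \<ge> 1" for j
    using X_measurable[OF that] by measurable
  have mR: "?R \<in> sets M" and mI: "?I \<in> sets M"
    using hX by measurable
  have "{\<omega> \<in> space M. \<tau> \<le> norm (?D \<omega>)} \<subseteq> ?R \<union> ?I"
  proof
    fix \<omega> assume a: "\<omega> \<in> {\<omega> \<in> space M. \<tau> \<le> norm (?D \<omega>)}"
    then have "\<tau> \<le> \<bar>Re (?D \<omega>)\<bar> + \<bar>Im (?D \<omega>)\<bar>" using cmod_le[of "?D \<omega>"] by simp
    then have "\<tau> / 2 \<le> \<bar>Re (?D \<omega>)\<bar> \<or> \<tau> / 2 \<le> \<bar>Im (?D \<omega>)\<bar>" by linarith
    then show "\<omega> \<in> ?R \<union> ?I" using a ih by auto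
  qed
  then have "prob {\<omega> \<in> space M. \<tau> \<le> norm (?D \<omega>)} \<le> prob (?R \<union> ?I)"
    using mR mI by (intro finite_measure_mono) auto
  also have "\<dots> \<le> prob ?R + prob ?I" by (rule measure_Un_le[OF mR mI])
  also have "\<dots> \<le> n * V / (\<tau> / 2)\<^sup>2 + n * V / (\<tau> / 2)\<^sup>2"
    by (intro add_mono Chebyshev_sum_real[of _ B] VR VI)
      (use \<tau> B abs_Re_le_cmod abs_Im_le_cmod in \<open>auto intro: order_trans\<close>)
  also have "\<dots> = 8 * real n * V / \<tau>\<^sup>2" by (simp add: power_divide)
  finally show ?thesis .
qed

text \<open>Different pairs are dependent, but linearity of expectation copes with that;
  independence enters only inside one pair, whose law is the product of \<open>\<mu>\<close> with
  itself. The values are extended reals because the Riesz kernel is infinite on the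
  diagonal.\<close>

lemma pair_Markov:
  fixes \<phi> :: "complex \<times> complex \<Rightarrow> ennreal"
  assumes [measurable]: "\<phi> \<in> borel_measurable (borel \<Otimes>\<^sub>M borel)"
    and K: "(\<integral>\<^sup>+x. \<integral>\<^sup>+y. \<phi> (x, y) \<partial>\<mu> \<partial>\<mu>) \<le> ennreal K" and "L > 0" "K \<ge> 0"
  shows "prob {\<omega> \<in> space M. ennreal L \<le> (\<Sum>i=1..n. \<Sum>j\<in>{1..n}-{i}. \<phi> (X i \<omega>, X j \<omega>))}
    \<le> real n ^ 2 * K / L"
proof -
  interpret mu: prob_space \<mu> by (rule prob_space_mu)
  have rv: "(\<lambda>\<omega>. \<phi> (X i \<omega>, X j \<omega>)) \<in> borel_measurable M" if "i \<ge> 1" "j \<ge> 1" for i j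
    using X_measurable[OF that(1)] X_measurable[OF that(2)] by measurable
  have E: "(\<integral>\<^sup>+\<omega>. \<phi> (X i \<omega>, X j \<omega>) \<partial>M) \<le> ennreal K" if ij: "i \<ge> 1" "j \<ge> 1" "i \<noteq> j" for i j
  proof -
    have "indep_var borel (X i) borel (X j)"
    proof -
      have "indep_vars (\<lambda>_. borel) X {i, j}" by (rule indep_vars_subset[OF indep]) (use ij in auto)
      then have "indep_var borel ((\<lambda>f. f i) \<circ> (\<lambda>\<omega>. restrict (\<lambda>k. X k \<omega>) {i}))
          borel ((\<lambda>f. f j) \<circ> (\<lambda>\<omega>. restrict (\<lambda>k. X k \<omega>) {j}))"
        using ij by (intro indep_var_compose[OF indep_var_restrict[where I = "{i, j}"]]) auto
      then show ?thesis by (simp add: comp_def)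
    qed
    then have D: "\<mu> \<Otimes>\<^sub>M \<mu> = distr M (borel \<Otimes>\<^sub>M borel) (\<lambda>\<omega>. (X i \<omega>, X j \<omega>))"
      using ij by (simp add: indep_var_distribution_eq distr_X)
    have "(\<integral>\<^sup>+\<omega>. \<phi> (X i \<omega>, X j \<omega>) \<partial>M) = (\<integral>\<^sup>+p. \<phi> p \<partial>(\<mu> \<Otimes>\<^sub>M \<mu>))"
      unfolding D using X_measurable[OF ij(1)] X_measurable[OF ij(2)]
      by (subst nn_integral_distr) auto
    also have "\<dots> = (\<integral>\<^sup>+x. \<integral>\<^sup>+y. \<phi> (x, y) \<partial>\<mu> \<partial>\<mu>)"
      by (subst mu.nn_integral_fst[symmetric]) auto
    finally show ?thesis using K by simp
  qed
  let ?U = "\<lambda>\<omega>. \<Sum>i=1..n. \<Sum>j\<in>{1..n}-{i}. \<phi> (X i \<omega>, X j \<omega>)"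
  have rvU [measurable]: "?U \<in> borel_measurable M"
    by (intro borel_measurable_sum rv) auto
  have "(\<integral>\<^sup>+\<omega>. ?U \<omega> \<partial>M) = (\<Sum>i=1..n. \<Sum>j\<in>{1..n}-{i}. (\<integral>\<^sup>+\<omega>. \<phi> (X i \<omega>, X j \<omega>) \<partial>M))"
    by (subst nn_integral_sum, (intro borel_measurable_sum rv; auto),
        intro sum.cong refl nn_integral_sum rv) auto
  also have "\<dots> \<le> (\<Sum>i=1..n. \<Sum>j\<in>{1..n}-{i}. ennreal K)"
    by (intro sum_mono E) auto
  also have "\<dots> \<le> (\<Sum>i=1..n. \<Sum>j\<in>{1..n}. ennreal K)"
    by (intro sum_mono sum_mono2) auto
  also have "\<dots> = ennreal (real n ^ 2 * K)"
    using \<open>K \<ge> 0\<close> by (simp add: power2_eq_square ennreal_of_nat_eq_real_of_nat ennreal_mult mult.assoc)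
  finally have EU: "(\<integral>\<^sup>+\<omega>. ?U \<omega> \<partial>M) \<le> ennreal (real n ^ 2 * K)" .
  have "emeasure M {\<omega> \<in> space M. ennreal L \<le> ?U \<omega>}
     = emeasure M {\<omega> \<in> space M. 1 \<le> ennreal (1 / L) * ?U \<omega>}"
  proof (intro arg_cong2[of _ _ _ _ emeasure] refl Collect_cong conj_cong)
    fix \<omega>
    have e: "ennreal L * ennreal (1 / L) = 1" using \<open>L > 0\<close> by (simp add: ennreal_mult[symmetric])
    show "ennreal L \<le> ?U \<omega> \<longleftrightarrow> 1 \<le> ennreal (1 / L) * ?U \<omega>"
    proof
      assume "ennreal L \<le> ?U \<omega>"
      then have "ennreal (1 / L) * ennreal L \<le> ennreal (1 / L) * ?U \<omega>" by (rule mult_left_mono) simp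
      then show "1 \<le> ennreal (1 / L) * ?U \<omega>" using e by (simp add: mult.commute)
    next
      assume "1 \<le> ennreal (1 / L) * ?U \<omega>"
      then have "ennreal L * 1 \<le> ennreal L * (ennreal (1 / L) * ?U \<omega>)" by (rule mult_left_mono) simp
      then show "ennreal L \<le> ?U \<omega>" using e by (simp add: mult.assoc[symmetric])
    qed
  qed
  also have "\<dots> \<le> ennreal (1 / L) * (\<integral>\<^sup>+\<omega>. ?U \<omega> * indicator (space M) \<omega> \<partial>M)"
    by (rule nn_integral_Markov_inequality) auto
  also have "(\<integral>\<^sup>+\<omega>. ?U \<omega> * indicator (space M) \<omega> \<partial>M) = (\<integral>\<^sup>+\<omega>. ?U \<omega> \<partial>M)"
    by (intro nn_integral_cong) auto
  also have "ennreal (1 / L) * \<dots> \<le> ennreal (1 / L) * ennreal (real n ^ 2 * K)"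
    by (intro mult_left_mono EU) auto
  also have "\<dots> = ennreal (real n ^ 2 * K / L)"
    using \<open>L > 0\<close> \<open>K \<ge> 0\<close> by (simp add: ennreal_mult[symmetric])
  finally show ?thesis using \<open>L > 0\<close> \<open>K \<ge> 0\<close> by (simp add: emeasure_eq_measure)
qed

end

section \<open>Riesz kernels in the plane\<close>

text \<open>The kernel is extended-real valued because \<open>0 powr (- q) = 0\<close> over the reals: here \<open>riesz q z z = \<infinity>\<close>,
  so that a bound on the energy of a configuration excludes coinciding roots.\<close>

definition riesz :: "real \<Rightarrow> complex \<Rightarrow> complex \<Rightarrow> ennreal" where
  "riesz q z x = inverse (ennreal (dist z x powr q))"

lemma riesz_measurable [measurable]: "case_prod (riesz q) \<in> borel_measurable (borel \<Otimes>\<^sub>M borel)"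
  unfolding riesz_def by measurable

lemma riesz_measurable' [measurable]: "riesz q z \<in> borel_measurable borel"
  unfolding riesz_def by measurable

lemma riesz_eq: "z \<noteq> x \<Longrightarrow> riesz q z x = ennreal (dist z x powr (- q))"
  unfolding riesz_def by (simp add: inverse_ennreal powr_minus)

lemma riesz_self: "riesz q z z = \<infinity>"
  unfolding riesz_def by simp

lemma emeasure_cball_complex:
  "r \<ge> 0 \<Longrightarrow> emeasure lborel (cball z r) = ennreal (pi * r\<^sup>2)" for z :: complex
  using emeasure_cball[of r z] unit_ball_vol_2 by simp

text \<open>The sum over \<open>k\<close> of \<open>(2 powr q) ^ Suc k * pi * (1/4) ^ k\<close>: the
  largest kernel value on the k-th dyadic shell times the area of the disc containing that shell.
  The series converges exactly for \<open>q < 2\<close>.\<close>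

definition riesz_bound :: "real \<Rightarrow> real" where
  "riesz_bound q = 2 powr q * pi / (1 - 2 powr (q - 2))"

lemma riesz_bound_pos: "q < 2 \<Longrightarrow> riesz_bound q > 0"
  unfolding riesz_bound_def by (simp add: powr_less_one)

lemma dyadic_bracket:
  fixes d :: real
  assumes "0 < d" "d \<le> 1"
  obtains k :: nat where "(1/2) ^ Suc k < d" "d \<le> (1/2) ^ k"
proof -
  have ex: "\<exists>k. (1/2::real) ^ k < d" using assms by (intro real_arch_pow_inv) auto
  define m where "m = (LEAST k. (1/2::real) ^ k < d)"
  have m: "(1/2) ^ m < d" unfolding m_def using ex by (rule LeastI_ex)
  then have "m \<noteq> 0" using assms by (cases m) auto
  then obtain k where k: "m = Suc k" by (cases m) auto
  then have "\<not> (1/2) ^ k < d" using not_less_Least[of k "\<lambda>k. (1/2::real) ^ k < d"] m_def by auto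
  then show ?thesis using that[of k] m k by auto
qed

text \<open>On the shell \<open>(1/2) ^ Suc k < dist z x \<le> (1/2) ^ k\<close> the kernel is at
  most \<open>(2 powr q) ^ Suc k\<close>. Enlarging each shell to the full disc costs only a
  constant and leaves areas of discs to compute.\<close>

lemma nn_integral_riesz_le:
  assumes q: "0 < q" "q < 2"
  shows "(\<integral>\<^sup>+x\<in>cball z 1. riesz q z x \<partial>lborel) \<le> ennreal (riesz_bound q)"
proof -
  let ?g = "\<lambda>k::nat. (2 powr q) ^ Suc k"
  have le: "riesz q z x * indicator (cball z 1) x
      \<le> (\<Sum>k. ennreal (?g k) * indicator (cball z ((1/2) ^ k)) x)" if "x \<noteq> z" for x
  proof (cases "x \<in> cball z 1")
    case True
    then have d: "0 < dist z x" "dist z x \<le> 1" using that by auto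
    then obtain k where k: "(1/2) ^ Suc k < dist z x" "dist z x \<le> (1/2) ^ k"
      using dyadic_bracket by blast
    have "dist z x powr (- q) \<le> ((1/2) ^ Suc k) powr (- q)"
      using k d q by (intro powr_mono2') auto
    also have "\<dots> = ?g k"
      by (simp add: powr_minus powr_power powr_realpow[symmetric] powr_powr powr_divide power_divide
           powr_add powr_mult power_mult_distrib divide_simps mult.commute)
    finally have "riesz q z x * indicator (cball z 1) x
        \<le> ennreal (?g k) * indicator (cball z ((1/2) ^ k)) x"
      using True that k by (auto simp: riesz_eq intro: ennreal_leI)
    also have "\<dots> \<le> (\<Sum>k. ennreal (?g k) * indicator (cball z ((1/2) ^ k)) x)"
    proof -
      define F where "F = (\<lambda>k. ennreal (?g k) * indicator (cball z ((1/2) ^ k)) x)"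
      have "sum F {k} \<le> suminf F" by (rule sum_le_suminf) auto
      then have "F k \<le> suminf F" by simp
      then show ?thesis unfolding F_def .
    qed
    finally show ?thesis .
  qed auto
  define F where "F k x = ennreal (?g k) * indicator (cball z ((1/2) ^ k)) x" for k x
  have F [measurable]: "F k \<in> borel_measurable lborel" for k
  proof -
    have "cball z ((1/2) ^ k) \<in> sets lborel" by simp
    then show ?thesis unfolding F_def by (intro borel_measurable_times_ennreal borel_measurable_indicator) simp_all
  qed
  have "(\<integral>\<^sup>+x\<in>cball z 1. riesz q z x \<partial>lborel) \<le> (\<integral>\<^sup>+x. (\<Sum>k. F k x) \<partial>lborel)"
  \<comment> \<open>At the centre \<open>x = z\<close> the kernel is infinite and lies in no shell,
    so the comparison holds only off a null set.\<close>
  proof (intro nn_integral_mono_AE, use AE_lborel_singleton[of z] in eventually_elim)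
    fix x assume "x \<noteq> z"
    then show "riesz q z x * indicator (cball z 1) x \<le> (\<Sum>k. F k x)"
      unfolding F_def by (rule le)
  qed
  also have "\<dots> = (\<Sum>k. integral\<^sup>N lborel (F k))"
    by (rule nn_integral_suminf) (rule F)
  also have "\<dots> = (\<Sum>k. ennreal (2 powr q * pi * (2 powr (q - 2)) ^ k))"
  proof (rule arg_cong[of _ _ suminf], rule ext)
    fix k :: nat
    have "((1/2::real) ^ k)\<^sup>2 = ((1/2)\<^sup>2) ^ k"
      by (simp only: power_mult[symmetric] mult.commute)
    then have "?g k * (pi * ((1/2) ^ k)\<^sup>2) = 2 powr q * pi * (2 powr q * (1/2)\<^sup>2) ^ k"
      by (simp only: power_mult_distrib power_Suc mult_ac)
    also have "2 powr q * (1/2)\<^sup>2 = 2 powr (q - 2)"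
      by (simp add: powr_diff power2_eq_square)
    finally have "ennreal (?g k) * ennreal (pi * ((1/2) ^ k)\<^sup>2)
        = ennreal (2 powr q * pi * (2 powr (q - 2)) ^ k)"
      by (subst ennreal_mult[symmetric]) simp_all
    moreover have "integral\<^sup>N lborel (F k) = ennreal (?g k) * emeasure lborel (cball z ((1/2) ^ k))"
      unfolding F_def by (rule nn_integral_cmult_indicator) simp
    ultimately show "integral\<^sup>N lborel (F k) = ennreal (2 powr q * pi * (2 powr (q - 2)) ^ k)"
      by (simp add: emeasure_cball_complex)
  qed
  also have "\<dots> = ennreal (riesz_bound q)"
  proof (rule suminf_ennreal_eq)
    have "(\<lambda>k. (2 powr (q - 2)) ^ k) sums (1 / (1 - 2 powr (q - 2)))"
      by (rule geometric_sums) (use q in \<open>auto simp: powr_less_one\<close>)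
    from sums_mult[OF this, of "2 powr q * pi"]
    show "(\<lambda>k. 2 powr q * pi * (2 powr (q - 2)) ^ k) sums riesz_bound q"
      by (simp add: riesz_bound_def)
  qed auto
  finally show ?thesis .
qed

lemma area_annulus:
  fixes a b :: real
  assumes "0 \<le> a" "a \<le> b"
  shows "emeasure lborel {x::complex. a \<le> norm x \<and> norm x \<le> b} = ennreal (pi * (b\<^sup>2 - a\<^sup>2))"
proof -
  have "{x::complex. a \<le> norm x \<and> norm x \<le> b} = cball 0 b - ball 0 a" by auto
  moreover have "emeasure lborel (cball (0::complex) b - ball 0 a)
      = emeasure lborel (cball (0::complex) b) - emeasure lborel (ball (0::complex) a)"
    using assms emeasure_ball[of a "0::complex"] by (intro emeasure_Diff) auto
  ultimately show ?thesis
    using assms emeasure_ball[of a "0::complex"] unit_ball_vol_2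
    by (simp add: emeasure_cball_complex ennreal_minus algebra_simps)
qed

section \<open>Measures with a density near the unit circle\<close>

text \<open>What the argument takes from Assumption A. \<open>upper\<close> dominates \<mu> on a
  thin annulus by a multiple of Lebesgue measure, stated for integrals so that it applies directly
  to Riesz kernels. The factor \<open>w powr \<alpha>\<close> bounds
  \<open>(1 - r) powr \<alpha>\<close> on the whole annulus because \<alpha> is nonnegative.\<close>

locale edge_density =
  fixes \<mu> :: "complex measure" and \<alpha> \<epsilon> k K :: real
  assumes prob: "prob_space \<mu>" and sets_mu [measurable_cong]: "sets \<mu> = sets borel"
    and rotation: "\<And>\<theta>. distr \<mu> borel (\<lambda>z. cis \<theta> * z) = \<mu>"
    and disk: "AE z in \<mu>. norm z \<le> 1"
    and \<alpha>: "0 \<le> \<alpha>" and \<epsilon>: "0 < \<epsilon>" "\<epsilon> \<le> 1/2" and k: "0 < k" and K: "0 < K"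
    and upper: "\<And>w h. \<lbrakk>0 < w; w \<le> \<epsilon>; h \<in> borel_measurable borel\<rbrakk> \<Longrightarrow>
      (\<integral>\<^sup>+x\<in>{x. 1 - w \<le> norm x}. h x \<partial>\<mu>)
        \<le> ennreal (K * w powr \<alpha>) * (\<integral>\<^sup>+x\<in>{x. 1 - w \<le> norm x \<and> norm x \<le> 1}. h x \<partial>lborel)"
    and lower: "\<And>w. \<lbrakk>0 < w; w \<le> \<epsilon>\<rbrakk> \<Longrightarrow> k * w powr (\<alpha> + 1) \<le> measure \<mu> {x. 1 - w \<le> norm x}"

text \<open>Assumption A gives the density as an identity for sets inside \<open>A\<close>.
  Restricting both sides to \<open>A\<close> turns it into an equality of measures, hence of
  integrals.\<close>

lemma nn_integral_mu_annulus:
  fixes A :: "complex set"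
  assumes \<mu>: "sets \<mu> = sets borel"
    and A [measurable]: "A \<in> sets borel" and f [measurable]: "f \<in> borel_measurable borel"
    and dens: "\<And>E. E \<in> sets borel \<Longrightarrow> E \<subseteq> A \<Longrightarrow> emeasure \<mu> E = (\<integral>\<^sup>+z\<in>E. ennreal (f z) \<partial>lborel)"
    and h [measurable]: "h \<in> borel_measurable borel"
  shows "(\<integral>\<^sup>+x\<in>A. h x \<partial>\<mu>) = (\<integral>\<^sup>+x\<in>A. ennreal (f x) * h x \<partial>lborel)"
proof -
  note [measurable_cong] = \<mu>
  have eq: "density \<mu> (indicator A) = density lborel (\<lambda>x. ennreal (f x) * indicator A x)"
  proof (rule measure_eqI)
    fix E assume "E \<in> sets (density \<mu> (indicator A))"
    then have E [measurable]: "E \<in> sets borel" using \<mu> by simp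
    have "emeasure (density \<mu> (indicator A)) E = emeasure \<mu> (A \<inter> E)"
      using \<mu> by (subst emeasure_density)
        (auto simp: indicator_inter_arith[symmetric] nn_integral_indicator)
    also have "\<dots> = (\<integral>\<^sup>+z\<in>A \<inter> E. ennreal (f z) \<partial>lborel)" by (rule dens) auto
    also have "\<dots> = emeasure (density lborel (\<lambda>x. ennreal (f x) * indicator A x)) E"
      by (subst emeasure_density) (auto simp: indicator_inter_arith mult.assoc)
    finally show "emeasure (density \<mu> (indicator A)) E
      = emeasure (density lborel (\<lambda>x. ennreal (f x) * indicator A x)) E" .
  qed (use \<mu> in simp)
  have "(\<integral>\<^sup>+x\<in>A. h x \<partial>\<mu>) = integral\<^sup>N (density \<mu> (indicator A)) h"
    by (subst nn_integral_density) (auto simp: mult.commute)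
  also have "\<dots> = (\<integral>\<^sup>+x\<in>A. ennreal (f x) * h x \<partial>lborel)"
    unfolding eq by (subst nn_integral_density) (auto simp: mult.commute mult.left_commute)
  finally show ?thesis .
qed

lemma edge_density_of_assumption_A:
  assumes "assumption_A \<alpha> \<mu>" "0 \<le> \<alpha>"
  shows "\<exists>\<epsilon> k K. edge_density \<mu> \<alpha> \<epsilon> k K"
proof -
  from assms(1) have P: "prob_space \<mu>" and S: "sets \<mu> = sets borel"
    and R: "\<And>\<theta>. distr \<mu> borel (\<lambda>z. cis \<theta> * z) = \<mu>" and D: "AE z in \<mu>. norm z \<le> 1"
    unfolding assumption_A_def by auto
  note [measurable_cong] = S
  from assms(1) obtain \<epsilon> f c C where e: "0 < \<epsilon>" "\<epsilon> \<le> 1" and f [measurable]: "f \<in> borel_measurable borel"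
    and f0: "\<And>z. 0 \<le> f z"
    and dens: "\<And>A. A \<in> sets borel \<Longrightarrow> A \<subseteq> {z. 1 - \<epsilon> \<le> norm z \<and> norm z \<le> 1} \<Longrightarrow>
      emeasure \<mu> A = (\<integral>\<^sup>+z\<in>A. ennreal (f z) \<partial>lborel)"
    and rad: "\<And>r \<theta>. 1 - \<epsilon> \<le> r \<Longrightarrow> r \<le> 1 \<Longrightarrow> f (complex_of_real r * cis \<theta>) = f (complex_of_real r)"
    and c: "0 < c" and C: "0 < C"
    and bd: "\<And>r. 1 - \<epsilon> \<le> r \<Longrightarrow> r < 1 \<Longrightarrow> c \<le> radial_density f r / (1 - r) powr \<alpha> \<and>
              radial_density f r / (1 - r) powr \<alpha> \<le> C"
    unfolding assumption_A_def by auto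
  define \<epsilon>' where "\<epsilon>' = min \<epsilon> (1/2)"
  have e': "0 < \<epsilon>'" "\<epsilon>' \<le> 1/2" "\<epsilon>' \<le> \<epsilon>" using e by (auto simp: \<epsilon>'_def)
  have fr: "c * (1 - norm x) powr \<alpha> \<le> 2 * pi * norm x * f x \<and>
      2 * pi * norm x * f x \<le> C * (1 - norm x) powr \<alpha>" if "1 - \<epsilon>' \<le> norm x" "norm x < 1" for x
  proof -
    have "f x = f (complex_of_real (norm x))"
      using rad[of "norm x" "Arg x"] that e' by (metis order.trans diff_left_mono less_imp_le rcis_cmod_Arg rcis_def)
    then show ?thesis
      using bd[of "norm x"] that e' by (auto simp: radial_density_def divide_simps)
  qed
  let ?A = "\<lambda>w. {x::complex. 1 - w \<le> norm x \<and> norm x \<le> 1}"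
  \<comment> \<open>The radial density is bounded only for \<open>r < 1\<close>, so the unit circle
    is discarded as a Lebesgue null set.\<close>
  have sph: "AE x in lborel. norm (x::complex) \<noteq> 1"
  proof (rule AE_I')
    show "sphere (0::complex) 1 \<in> null_sets lborel"
      using negligible_sphere[of "0::complex" 1]
      by (auto simp: null_sets_completion_iff negligible_iff_null_sets)
  qed auto
  have upper: "(\<integral>\<^sup>+x\<in>{x. 1 - w \<le> norm x}. h x \<partial>\<mu>)
        \<le> ennreal (C * w powr \<alpha>) * (\<integral>\<^sup>+x\<in>?A w. h x \<partial>lborel)"
    if w: "0 < w" "w \<le> \<epsilon>'" and h [measurable]: "h \<in> borel_measurable borel" for w h
  proof -
    have "(\<integral>\<^sup>+x\<in>{x. 1 - w \<le> norm x}. h x \<partial>\<mu>) = (\<integral>\<^sup>+x\<in>?A w. h x \<partial>\<mu>)"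
      by (intro nn_integral_cong_AE) (use D in \<open>auto elim!: eventually_mono simp: indicator_def\<close>)
    also have "\<dots> = (\<integral>\<^sup>+x\<in>?A w. ennreal (f x) * h x \<partial>lborel)"
      by (rule nn_integral_mu_annulus[OF S _ f dens h]) (use w e' in auto)
    also have "\<dots> \<le> (\<integral>\<^sup>+x. ennreal (C * w powr \<alpha>) * (h x * indicator (?A w) x) \<partial>lborel)"
    proof (intro nn_integral_mono_AE, use sph in eventually_elim)
      fix x :: complex assume x: "norm x \<noteq> 1"
      have "f x \<le> C * w powr \<alpha>" if "x \<in> ?A w"
      proof -
        have n: "1/2 \<le> norm x" "norm x < 1" "1 - \<epsilon>' \<le> norm x" using that w e' x by auto
        \<comment> \<open>Since \<open>norm x \<ge> 1/2\<close>, the factor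
          \<open>2 * pi * norm x\<close> is at least 1, so a bound on the radial density bounds
          \<open>f\<close> itself. This is why \<epsilon> was cut down to at most 1/2.\<close>
        have "2 * 3 * (1/2) \<le> 2 * pi * norm x"
          using n pi_gt3 by (intro mult_mono) auto
        then have "f x * 1 \<le> f x * (2 * pi * norm x)"
          using f0[of x] by (intro mult_left_mono) auto
        also have "\<dots> \<le> C * (1 - norm x) powr \<alpha>" using fr[of x] n by (simp add: mult.commute mult.left_commute)
        also have "\<dots> \<le> C * w powr \<alpha>"
          using C that n assms(2) by (intro mult_left_mono powr_mono2) auto
        finally show ?thesis by simp
      qed
      then show "ennreal (f x) * h x * indicator (?A w) x
          \<le> ennreal (C * w powr \<alpha>) * (h x * indicator (?A w) x)"
        by (auto simp: indicator_def intro!: mult_right_mono ennreal_leI)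
    qed
    also have "\<dots> = ennreal (C * w powr \<alpha>) * (\<integral>\<^sup>+x\<in>?A w. h x \<partial>lborel)"
      by (rule nn_integral_cmult) auto
    finally show ?thesis .
  qed
  \<comment> \<open>Only the inner half \<open>1 - w \<le> norm x \<le> 1 - w / 2\<close> is
    counted. There the density is at least \<open>c * (w / 2) powr \<alpha> / (2 * pi)\<close> and
    the area is at least \<open>pi * w / 2\<close>; the product is
    \<open>k * w powr (\<alpha> + 1)\<close>.\<close>
  define k where "k = c * (1/2) powr \<alpha> / 4"
  have k: "0 < k" using c by (simp add: k_def)
  have lower: "k * w powr (\<alpha> + 1) \<le> measure \<mu> {x. 1 - w \<le> norm x}" if w: "0 < w" "w \<le> \<epsilon>'" for w
  proof -
    interpret prob_space \<mu> by (rule P)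
    let ?B = "{x::complex. 1 - w \<le> norm x \<and> norm x \<le> 1 - w / 2}"
    let ?m = "c * (w / 2) powr \<alpha> / (2 * pi)"
    have area: "w / 2 \<le> (1 - w / 2)\<^sup>2 - (1 - w)\<^sup>2"
    proof -
      have "(1 - w / 2)\<^sup>2 - (1 - w)\<^sup>2 = (w / 2) * (2 - 3 / 2 * w)"
        by (simp add: power2_eq_square field_simps)
      moreover have "(w / 2) * 1 \<le> (w / 2) * (2 - 3 / 2 * w)"
        using w e' by (intro mult_left_mono) auto
      ultimately show ?thesis by simp
    qed
    have "ennreal (k * w powr (\<alpha> + 1)) = ennreal (?m * (pi * (w / 2)))"
      using w by (simp add: k_def powr_add powr_divide field_simps)
    also have "\<dots> \<le> ennreal ?m * ennreal (pi * ((1 - w / 2)\<^sup>2 - (1 - w)\<^sup>2))"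
    proof -
      have "0 \<le> pi * (w / 2)" and "0 \<le> ?m" using w c by simp_all
      from area have "pi * (w / 2) \<le> pi * ((1 - w / 2)\<^sup>2 - (1 - w)\<^sup>2)"
        by (rule mult_left_mono) simp
      then show ?thesis
        unfolding ennreal_mult[OF \<open>0 \<le> ?m\<close> \<open>0 \<le> pi * (w / 2)\<close>]
        by (intro mult_left_mono ennreal_leI) auto
    qed
    also have "\<dots> = ennreal ?m * emeasure lborel ?B"
      by (subst area_annulus) (use w e' in auto)
    also have "\<dots> = (\<integral>\<^sup>+x\<in>?B. ennreal ?m \<partial>lborel)"
      by (subst nn_integral_cmult_indicator) auto
    also have "\<dots> \<le> (\<integral>\<^sup>+x\<in>?B. ennreal (f x) \<partial>lborel)"
    proof (intro nn_integral_mono)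
      fix x :: complex
      have "?m \<le> f x" if "x \<in> ?B"
      proof -
        have n: "norm x < 1" "1 - \<epsilon>' \<le> norm x" using that w e' by auto
        have "c * (w / 2) powr \<alpha> \<le> c * (1 - norm x) powr \<alpha>"
          using c that w assms(2) by (intro mult_left_mono powr_mono2) auto
        also have "\<dots> \<le> 2 * pi * norm x * f x" using fr[of x] n by auto
        also have "\<dots> \<le> 2 * pi * 1 * f x" using n f0[of x] by (intro mult_mono) auto
        finally show ?thesis by (simp add: field_simps)
      qed
      then show "ennreal ?m * indicator ?B x \<le> ennreal (f x) * indicator ?B x"
        by (auto simp: indicator_def intro: ennreal_leI)
    qed
    also have "\<dots> = emeasure \<mu> ?B"
      by (rule dens[symmetric]) (use w e' in auto)
    also have "\<dots> \<le> emeasure \<mu> {x. 1 - w \<le> norm x}"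
      by (intro emeasure_mono) auto
    finally show ?thesis by (simp add: emeasure_eq_measure)
  qed
  have "edge_density \<mu> \<alpha> \<epsilon>' k C"
    by (rule edge_density.intro[OF P S R D assms(2) e'(1,2) k C upper lower])
  then show ?thesis by blast
qed

section \<open>Truncated kernels and their moments\<close>

definition pair_kernel :: "real \<Rightarrow> real \<Rightarrow> complex \<times> complex \<Rightarrow> ennreal" where
  "pair_kernel q w = (\<lambda>(x, y). if 1 - 2 * w \<le> norm x \<and> dist x y \<le> w then riesz q x y else 0)"

lemma pair_kernel_measurable [measurable]:
  "pair_kernel q w \<in> borel_measurable (borel \<Otimes>\<^sub>M borel)"
  unfolding pair_kernel_def by measurable

text \<open>The Cauchy kernel cut off near its pole. The cut-off makes it bounded, so that its
  second and fourth moments exist and Chebyshev's inequality applies.\<close>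

definition far_kernel :: "complex \<Rightarrow> real \<Rightarrow> complex \<Rightarrow> complex" where
  "far_kernel g r x = (if r \<le> dist g x then 1 / (g - x) else 0)"

lemma far_kernel_measurable [measurable]: "far_kernel g r \<in> borel_measurable borel"
  unfolding far_kernel_def by measurable

lemma norm_far_kernel: "norm (far_kernel g r x) = (if r \<le> dist g x then 1 / dist g x else 0)"
  by (simp add: far_kernel_def norm_divide dist_norm)

lemma norm_far_kernel_le: "0 < r \<Longrightarrow> norm (far_kernel g r x) \<le> 1 / r"
  by (auto simp: norm_far_kernel intro!: divide_left_mono mult_pos_pos)

text \<open>Off the disc of radius \<open>r\<close>, lowering the exponent from \<open>m\<close> to
  \<open>q\<close> costs a factor \<open>r powr (q - m)\<close>. This brings the exponents 2 and 4
  below the limit of planar integrability.\<close>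

lemma far_power_le_riesz:
  assumes "0 < r" "r \<le> dist g x" "q \<le> m"
  shows "ennreal (dist g x powr (- m)) \<le> ennreal (r powr (q - m)) * riesz q g x"
proof -
  have d: "0 < dist g x" using assms by linarith
  have "dist g x powr (- m) = dist g x powr (q - m) * dist g x powr (- q)"
    by (simp add: powr_add[symmetric])
  also have "\<dots> \<le> r powr (q - m) * dist g x powr (- q)"
    using assms d by (intro mult_right_mono powr_mono2') auto
  finally show ?thesis using d by (subst riesz_eq) (auto simp: ennreal_mult[symmetric] intro!: ennreal_leI)
qed

context edge_density
begin

interpretation mu: prob_space \<mu> by (rule prob)

lemma area_annulus_le:
  assumes "0 < w" "w \<le> 1"
  shows "emeasure lborel {x::complex. 1 - w \<le> norm x \<and> norm x \<le> 1} \<le> ennreal (2 * pi * w)"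
proof -
  have "1\<^sup>2 - (1 - w)\<^sup>2 \<le> 2 * w" by (simp add: power2_eq_square algebra_simps)
  then have "pi * (1\<^sup>2 - (1 - w)\<^sup>2) \<le> pi * (2 * w)" by (rule mult_left_mono) simp
  then show ?thesis using assms by (subst area_annulus) (auto intro!: ennreal_leI)
qed

lemma measure_annulus_le:
  assumes "0 < w" "w \<le> \<epsilon>"
  shows "measure \<mu> {x. 1 - w \<le> norm x} \<le> 2 * pi * K * w powr (\<alpha> + 1)"
proof -
  let ?A = "{x::complex. 1 - w \<le> norm x \<and> norm x \<le> 1}"
  have "emeasure \<mu> {x. 1 - w \<le> norm x} = (\<integral>\<^sup>+x\<in>{x. 1 - w \<le> norm x}. 1 \<partial>\<mu>)"
    by (simp add: nn_integral_indicator)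
  also have "\<dots> \<le> ennreal (K * w powr \<alpha>) * (\<integral>\<^sup>+x\<in>?A. 1 \<partial>lborel)"
    by (rule upper[OF assms]) simp
  also have "(\<integral>\<^sup>+x\<in>?A. 1 \<partial>lborel) = emeasure lborel ?A" by simp
  also have "ennreal (K * w powr \<alpha>) * \<dots> \<le> ennreal (K * w powr \<alpha>) * ennreal (2 * pi * w)"
    using assms \<epsilon> by (intro mult_left_mono area_annulus_le) auto
  also have "\<dots> = ennreal (2 * pi * K * w powr (\<alpha> + 1))"
    using assms K by (simp add: ennreal_mult[symmetric] powr_add mult_ac)
  finally show ?thesis using assms K by (simp add: mu.emeasure_eq_measure)
qed

lemma riesz_local_le:
  assumes w: "0 < w" "w \<le> \<epsilon>" and q: "0 < q" "q < 2"
  shows "(\<integral>\<^sup>+x\<in>{x. 1 - w \<le> norm x}. riesz q z x * indicator (cball z 1) x \<partial>\<mu>)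
    \<le> ennreal (K * w powr \<alpha> * riesz_bound q)"
proof -
  have [measurable]: "cball z 1 \<in> sets borel" by simp
  have "(\<integral>\<^sup>+x\<in>{x. 1 - w \<le> norm x}. riesz q z x * indicator (cball z 1) x \<partial>\<mu>)
    \<le> ennreal (K * w powr \<alpha>) *
        (\<integral>\<^sup>+x\<in>{x. 1 - w \<le> norm x \<and> norm x \<le> 1}. riesz q z x * indicator (cball z 1) x \<partial>lborel)"
    by (rule upper[OF w]) measurable
  also have "\<dots> \<le> ennreal (K * w powr \<alpha>) * (\<integral>\<^sup>+x\<in>cball z 1. riesz q z x \<partial>lborel)"
    by (intro mult_left_mono nn_integral_mono) (auto simp: indicator_def)
  also have "\<dots> \<le> ennreal (K * w powr \<alpha>) * ennreal (riesz_bound q)"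
    by (intro mult_left_mono nn_integral_riesz_le q) auto
  finally show ?thesis
    using K riesz_bound_pos[OF q(2)] by (simp add: ennreal_mult)
qed

text \<open>Three regions: points of the annulus of width \<epsilon> within distance 1 of
  \<open>z\<close>, points at distance more than 1, and points of norm below
  \<open>1 - \<epsilon>\<close>. In the last region \<mu> may even have atoms, but a
  \<open>z\<close> with norm at least \<open>1 - \<epsilon> / 2\<close> is at distance at least
  \<open>\<epsilon> / 2\<close> from it.\<close>

definition potential_bound :: "real \<Rightarrow> real" where
  "potential_bound q = K * riesz_bound q + 1 + (2 / \<epsilon>) powr q"

lemma potential_bound_pos: "q < 2 \<Longrightarrow> 0 < potential_bound q"
  unfolding potential_bound_def using K riesz_bound_pos[of q] by (intro add_pos_nonneg) auto

lemma riesz_potential_le: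
  assumes z: "1 - \<epsilon> / 2 \<le> norm z" and q: "0 < q" "q < 2"
  shows "(\<integral>\<^sup>+x. riesz q z x \<partial>\<mu>) \<le> ennreal (potential_bound q)"
proof -
  have [measurable]: "cball z 1 \<in> sets borel" by simp
  have "(\<integral>\<^sup>+x. riesz q z x \<partial>\<mu>)
    \<le> (\<integral>\<^sup>+x. riesz q z x * indicator (cball z 1) x * indicator {x. 1 - \<epsilon> \<le> norm x} x
          + ennreal (1 + (2 / \<epsilon>) powr q) \<partial>\<mu>)"
  proof (intro nn_integral_mono)
    fix x
    show "riesz q z x \<le> riesz q z x * indicator (cball z 1) x * indicator {x. 1 - \<epsilon> \<le> norm x} x
          + ennreal (1 + (2 / \<epsilon>) powr q)"
    proof (cases "x \<in> cball z 1 \<and> 1 - \<epsilon> \<le> norm x")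
      case False
      have "riesz q z x \<le> ennreal (1 + (2 / \<epsilon>) powr q)"
      proof (cases "x \<in> cball z 1")
        case True
        with False have "norm x < 1 - \<epsilon>" by auto
        then have d: "\<epsilon> / 2 \<le> dist z x" using z norm_triangle_ineq2[of z x] by (simp add: dist_norm)
        then have "dist z x powr (- q) \<le> (\<epsilon> / 2) powr (- q)"
          using \<epsilon> q by (intro powr_mono2') auto
        also have "\<dots> = (2 / \<epsilon>) powr q" using \<epsilon> by (simp add: powr_minus powr_divide divide_simps)
        finally have "dist z x powr (- q) \<le> 1 + (2 / \<epsilon>) powr q" by simp
        moreover have "z \<noteq> x" using d \<epsilon> by auto
        ultimately show ?thesis unfolding riesz_eq[OF \<open>z \<noteq> x\<close>] by (intro ennreal_leI)
      next
        case False
        then have "1 \<le> dist z x" by auto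
        then have "dist z x powr (- q) \<le> 1 powr (- q)" using q by (intro powr_mono2') auto
        then have "dist z x powr (- q) \<le> 1 + (2 / \<epsilon>) powr q"
          by (intro order_trans[OF _ le_add_same_cancel1[THEN iffD2]]) auto
        moreover have "z \<noteq> x" using False by auto
        ultimately show ?thesis unfolding riesz_eq[OF \<open>z \<noteq> x\<close>] by (intro ennreal_leI)
      qed
      then show ?thesis by (rule order_trans) simp
    qed auto
  qed
  also have "\<dots> = (\<integral>\<^sup>+x\<in>{x. 1 - \<epsilon> \<le> norm x}. riesz q z x * indicator (cball z 1) x \<partial>\<mu>)
      + ennreal (1 + (2 / \<epsilon>) powr q)"
    by (subst nn_integral_add) (auto simp: mu.emeasure_space_1)
  also have "\<dots> \<le> ennreal (K * \<epsilon> powr \<alpha> * riesz_bound q) + ennreal (1 + (2 / \<epsilon>) powr q)"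
    by (intro add_mono riesz_local_le q) (use \<epsilon> in auto)
  also have "\<dots> = ennreal (K * \<epsilon> powr \<alpha> * riesz_bound q + (1 + (2 / \<epsilon>) powr q))"
    using K riesz_bound_pos[OF q(2)] by (intro ennreal_plus[symmetric]) (auto intro: add_nonneg_nonneg)
  also have "\<dots> \<le> ennreal (potential_bound q)"
  proof (rule ennreal_leI)
    have "\<epsilon> powr \<alpha> \<le> 1" using \<epsilon> \<alpha> by (intro powr_le1) auto
    then have "K * \<epsilon> powr \<alpha> * riesz_bound q \<le> K * 1 * riesz_bound q"
      using K riesz_bound_pos[OF q(2)] by (intro mult_right_mono mult_left_mono) auto
    then show "K * \<epsilon> powr \<alpha> * riesz_bound q + (1 + (2 / \<epsilon>) powr q) \<le> potential_bound q"
      by (simp add: potential_bound_def)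
  qed
  finally show ?thesis .
qed

definition pair_bound :: "real \<Rightarrow> real" where
  "pair_bound q = K * 3 powr \<alpha> * riesz_bound q * (2 * pi * K * 2 powr (\<alpha> + 1))"

lemma pair_bound_pos: "q < 2 \<Longrightarrow> 0 < pair_bound q"
  unfolding pair_bound_def using K riesz_bound_pos[of q] by (auto intro!: mult_pos_pos)

text \<open>The density at \<open>y\<close> gives \<open>w powr \<alpha>\<close> and the mass of the
  annulus containing \<open>x\<close> gives \<open>w powr (\<alpha> + 1)\<close>. A partner
  \<open>y\<close> within \<open>w\<close> of \<open>x\<close> lies in the annulus of width
  \<open>3 * w\<close>. The width \<open>2 * w\<close> for \<open>x\<close> leaves room for roots
  that are close to a point of the annulus of width \<open>w\<close> but not yet known to lie in
  it.\<close>

lemma pair_integral_le: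
  assumes w: "0 < w" "3 * w \<le> \<epsilon>" and q: "0 < q" "q < 2"
  shows "(\<integral>\<^sup>+x. \<integral>\<^sup>+y. pair_kernel q w (x, y) \<partial>\<mu> \<partial>\<mu>) \<le> ennreal (pair_bound q * w powr (2 * \<alpha> + 1))"
proof -
  let ?c = "K * (3 * w) powr \<alpha> * riesz_bound q"
  have c0: "0 \<le> ?c" using K riesz_bound_pos[OF q(2)] by simp
  have "(\<integral>\<^sup>+y. pair_kernel q w (x, y) \<partial>\<mu>) \<le> ennreal ?c * indicator {x. 1 - 2 * w \<le> norm x} x" for x
  proof (cases "1 - 2 * w \<le> norm x")
    case True
    have "(\<integral>\<^sup>+y. pair_kernel q w (x, y) \<partial>\<mu>)
       \<le> (\<integral>\<^sup>+y\<in>{y. 1 - 3 * w \<le> norm y}. riesz q x y * indicator (cball x 1) y \<partial>\<mu>)"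
    proof (intro nn_integral_mono)
      fix y
      show "pair_kernel q w (x, y)
        \<le> riesz q x y * indicator (cball x 1) y * indicator {y. 1 - 3 * w \<le> norm y} y"
        using True norm_triangle_ineq2[of x y] w \<epsilon>
        by (auto simp: pair_kernel_def dist_norm indicator_def)
    qed
    also have "\<dots> \<le> ennreal ?c" by (rule riesz_local_le) (use w q in auto)
    finally show ?thesis using True by simp
  qed (simp add: pair_kernel_def)
  then have "(\<integral>\<^sup>+x. \<integral>\<^sup>+y. pair_kernel q w (x, y) \<partial>\<mu> \<partial>\<mu>)
      \<le> (\<integral>\<^sup>+x. ennreal ?c * indicator {x. 1 - 2 * w \<le> norm x} x \<partial>\<mu>)"
    by (intro nn_integral_mono)
  also have "\<dots> = ennreal ?c * emeasure \<mu> {x. 1 - 2 * w \<le> norm x}"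
    by (rule nn_integral_cmult_indicator) measurable
  also have "\<dots> \<le> ennreal ?c * ennreal (2 * pi * K * (2 * w) powr (\<alpha> + 1))"
    using measure_annulus_le[of "2 * w"] w
    by (intro mult_left_mono) (auto simp: mu.emeasure_eq_measure intro!: ennreal_leI)
  also have "\<dots> = ennreal (?c * (2 * pi * K * (2 * w) powr (\<alpha> + 1)))"
    using c0 K by (intro ennreal_mult[symmetric]) auto
  also have "?c * (2 * pi * K * (2 * w) powr (\<alpha> + 1)) = pair_bound q * (w powr \<alpha> * w powr (\<alpha> + 1))"
    using w by (simp add: pair_bound_def powr_mult)
  also have "w powr \<alpha> * w powr (\<alpha> + 1) = w powr (2 * \<alpha> + 1)"
    by (simp add: powr_add[symmetric])
  finally show ?thesis .
qed

text \<open>Applied with \<open>m = 2\<close> for the fluctuation of the sum of kernels and with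
  \<open>m = 4\<close> for that of the sum of their squares.\<close>

lemma far_moment_le:
  fixes q r :: real and m :: nat
  assumes g: "1 - \<epsilon> / 2 \<le> norm g" and q: "0 < q" "q < 2" and r: "0 < r" and m: "2 \<le> m"
  shows "(\<integral>x. norm (far_kernel g r x) ^ m \<partial>\<mu>) \<le> r powr (q - m) * potential_bound q"
proof (rule integral_real_bounded)
  have "(\<integral>\<^sup>+x. ennreal (norm (far_kernel g r x) ^ m) \<partial>\<mu>)
      \<le> (\<integral>\<^sup>+x. ennreal (r powr (q - m)) * riesz q g x \<partial>\<mu>)"
  proof (intro nn_integral_mono)
    fix x
    show "ennreal (norm (far_kernel g r x) ^ m) \<le> ennreal (r powr (q - m)) * riesz q g x"
    proof (cases "r \<le> dist g x")
      case True
      then have "norm (far_kernel g r x) ^ m = dist g x powr (- real m)"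
        using r m by (auto simp: norm_far_kernel power_divide powr_minus powr_realpow divide_simps)
      then show ?thesis using far_power_le_riesz[OF r True, of q m] q m by simp
    qed (use m in \<open>simp add: norm_far_kernel power_0_left\<close>)
  qed
  also have "\<dots> = ennreal (r powr (q - m)) * (\<integral>\<^sup>+x. riesz q g x \<partial>\<mu>)"
    by (rule nn_integral_cmult) measurable
  also have "\<dots> \<le> ennreal (r powr (q - m)) * ennreal (potential_bound q)"
    by (intro mult_left_mono riesz_potential_le g q) auto
  finally show "(\<integral>\<^sup>+x. ennreal (norm (far_kernel g r x) ^ m) \<partial>\<mu>) \<le> ennreal (r powr (q - m) * potential_bound q)"
    using potential_bound_pos[OF q(2)] by (simp add: ennreal_mult)
qed (use potential_bound_pos[OF q(2)] in simp)

end

section \<open>The mean of the truncated Cauchy kernel\<close>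

lemma geometric_remainder:
  fixes g x :: complex
  assumes "g \<noteq> 0" "x \<noteq> g"
  shows "1 / (g - x) = (\<Sum>k<m. x ^ k / g ^ Suc k) + (x / g) ^ m / (g - x)"
proof -
  have gx: "g - x \<noteq> 0" "x / g \<noteq> 1" using assms by auto
  have "(\<Sum>k<m. x ^ k / g ^ Suc k) = (\<Sum>k<m. (x / g) ^ k) / g"
    by (simp add: sum_divide_distrib power_divide mult.commute)
  also have "\<dots> = (1 - (x / g) ^ m) / (1 - x / g) / g"
    using gx by (simp add: sum_gp_strict)
  also have "\<dots> = (1 - (x / g) ^ m) / (g - x)"
    using assms by (simp add: field_simps)
  finally show ?thesis by (simp add: diff_divide_distrib)
qed

context edge_density
begin

interpretation mu: prob_space \<mu> by (rule prob)

text \<open>Rotation by \<open>cis (pi / m)\<close> preserves \<mu> and the cut-off but changes the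
  sign of \<open>x ^ m\<close>, so the integral equals its own negative.\<close>

lemma moment_eq_0:
  fixes m :: nat
  assumes "m \<ge> 1"
  shows "(\<integral>x. (if norm x \<le> R then x ^ m else 0) \<partial>\<mu>) = 0"
proof -
  let ?f = "\<lambda>x::complex. if norm x \<le> R then x ^ m else 0"
  let ?c = "cis (pi / m)"
  have c: "?c ^ m = -1" using assms by (simp add: Complex.DeMoivre)
  have "integral\<^sup>L \<mu> ?f = integral\<^sup>L (distr \<mu> borel (\<lambda>z. ?c * z)) ?f" by (simp add: rotation)
  also have "\<dots> = (\<integral>x. ?f (?c * x) \<partial>\<mu>)" by (rule integral_distr) measurable
  also have "\<dots> = (\<integral>x. (-1) * ?f x \<partial>\<mu>)"
    using c by (intro Bochner_Integration.integral_cong) (auto simp: norm_mult power_mult_distrib)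
  also have "\<dots> = - integral\<^sup>L \<mu> ?f" by (subst integral_mult_right_zero) simp
  finally show ?thesis by (simp add: eq_neg_iff_add_eq_0)
qed

text \<open>Expand \<open>1 / (g - x)\<close> in powers of \<open>x / g\<close>; only the constant term survives the integration.\<close>

lemma mean_inner:
  fixes g :: complex
  assumes R: "0 \<le> R" "R < norm g"
  shows "(\<integral>x. (if norm x \<le> R then 1 / (g - x) else 0) \<partial>\<mu>) = measure \<mu> (cball 0 R) / g"
proof -
  have g: "g \<noteq> 0" using R by auto
  define I where "I = (\<integral>x. (if norm x \<le> R then 1 / (g - x) else 0) \<partial>\<mu>)"
  \<comment> \<open>A finite expansion with remainder for each \<open>m\<close>; the limit in
    \<open>m\<close> takes the place of an interchange of integral and infinite series.\<close>
  have bound: "norm (I - measure \<mu> (cball 0 R) / g) \<le> (R / norm g) ^ m / (norm g - R)" if "m \<ge> 1" for m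
  proof -
    let ?p = "\<lambda>k x. if norm x \<le> R then x ^ k else 0"
    let ?r = "\<lambda>x. if norm x \<le> R then (x / g) ^ m / (g - x) else 0"
    have ip: "integrable \<mu> (?p k)" for k
      by (rule mu.integrable_const_bound[of _ "R ^ k"]) (use R in \<open>auto simp: norm_power intro!: power_mono\<close>)
    have p0: "integral\<^sup>L \<mu> (?p 0) = complex_of_real (measure \<mu> (cball 0 R))"
    proof -
      have "integral\<^sup>L \<mu> (?p 0) = (\<integral>x. complex_of_real (indicator (cball 0 R) x) \<partial>\<mu>)"
        by (intro Bochner_Integration.integral_cong) (auto simp: indicator_def)
      also have "\<dots> = complex_of_real (\<integral>x. indicator (cball 0 R) x \<partial>\<mu>)"
        by (rule integral_complex_of_real)
      finally show ?thesis by simp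
    qed
    have rb: "norm (?r x) \<le> (R / norm g) ^ m / (norm g - R)" for x
    proof (cases "norm x \<le> R")
      case True
      have "norm g - R \<le> norm (g - x)" using norm_triangle_ineq2[of g x] True by linarith
      then show ?thesis using True R
        by (auto simp: norm_divide norm_power intro!: frac_le power_mono divide_right_mono)
    qed (use R in auto)
    have ir: "integrable \<mu> ?r"
      by (rule mu.integrable_const_bound[OF AE_I2, OF rb]) measurable
    have "I = (\<integral>x. (\<Sum>k<m. ?p k x / g ^ Suc k) + ?r x \<partial>\<mu>)"
      unfolding I_def
    proof (intro Bochner_Integration.integral_cong refl)
      fix x
      show "(if norm x \<le> R then 1 / (g - x) else 0) = (\<Sum>k<m. ?p k x / g ^ Suc k) + ?r x"
      proof (cases "norm x \<le> R")
        case True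
        then have "x \<noteq> g" using R by auto
        from geometric_remainder[OF g this, of m] True show ?thesis by simp
      qed simp
    qed
    also have "\<dots> = (\<Sum>k<m. integral\<^sup>L \<mu> (?p k) / g ^ Suc k) + integral\<^sup>L \<mu> ?r"
      using ip ir by (subst Bochner_Integration.integral_add)
        (auto intro!: Bochner_Integration.integrable_sum simp: Bochner_Integration.integral_sum)
    also have "(\<Sum>k<m. integral\<^sup>L \<mu> (?p k) / g ^ Suc k) = complex_of_real (measure \<mu> (cball 0 R)) / g"
    proof -
      have single: "sum F {0} = F 0" for F :: "nat \<Rightarrow> complex" by simp
      have "(\<Sum>k<m. integral\<^sup>L \<mu> (?p k) / g ^ Suc k) = (\<Sum>k\<in>{0}. integral\<^sup>L \<mu> (?p k) / g ^ Suc k)"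
        by (rule sum.mono_neutral_right) (use that moment_eq_0 in auto)
      also have "\<dots> = integral\<^sup>L \<mu> (?p 0) / g ^ Suc 0" by (rule single)
      finally show ?thesis using p0 by simp
    qed
    finally have "I - measure \<mu> (cball 0 R) / g = integral\<^sup>L \<mu> ?r" by simp
    also have "norm \<dots> \<le> (\<integral>x. norm (?r x) \<partial>\<mu>)" by (rule integral_norm_bound)
    also have "\<dots> \<le> (\<integral>x. (R / norm g) ^ m / (norm g - R) \<partial>\<mu>)"
      by (intro integral_mono) (use ir rb in auto)
    finally show ?thesis by (simp add: mu.prob_space)
  qed
  have "(\<lambda>m. (R / norm g) ^ m / (norm g - R)) \<longlonglongrightarrow> 0 / (norm g - R)"
  proof (intro tendsto_divide tendsto_const LIMSEQ_power_zero)
    have "0 < norm g" using R by linarith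
    then show "norm (R / norm g) < 1" using R by simp
  qed (use R in auto)
  then have "(\<lambda>m. (R / norm g) ^ m / (norm g - R)) \<longlonglongrightarrow> 0" by simp
  then have "norm (I - measure \<mu> (cball 0 R) / g) \<le> 0"
    by (rule tendsto_lowerbound[OF _ eventually_sequentiallyI[of 1]]) (use bound in auto)
  then show ?thesis by (simp add: I_def)
qed

text \<open>The first term comes from points of the outer annulus within \<open>w powr (1/2)\<close>
  of \<open>g\<close>. Of the 24, 8 belongs to the other points of that annulus and 16 to the mass
  \<open>8 * pi * K * w\<close> missing from the inner disc, divided by
  \<open>norm g \<ge> 1/2\<close>.\<close>

definition mean_bound :: real where
  "mean_bound = K * riesz_bound (3/2) + 24 * pi * K"

lemma mean_far_kernel:
  assumes w: "0 < w" "4 * w \<le> \<epsilon>" and g: "1 - 2 * w \<le> norm g" and r: "0 < r" "r \<le> 2 * w"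
  shows "norm (integral\<^sup>L \<mu> (far_kernel g r) - 1 / g) \<le> mean_bound * w powr (1/4)"
proof -
  \<comment> \<open>Every point of norm at most \<open>R\<close> is at distance at least
    \<open>2 * w \<ge> r\<close> from \<open>g\<close>. The truncation is therefore inactive there
    and the exact mean over the inner disc applies.\<close>
  define R where "R = 1 - 4 * w"
  have R: "0 \<le> R" "R < norm g" using w g \<epsilon> by (auto simp: R_def)
  let ?A = "\<lambda>x. if norm x \<le> R then 1 / (g - x) else 0"
  let ?B = "\<lambda>x. if norm x \<le> R then 0 else far_kernel g r x"
  have split: "far_kernel g r x = ?A x + ?B x" for x
  proof (cases "norm x \<le> R")
    case True
    have "norm g - norm x \<le> dist g x" using norm_triangle_ineq2[of g x] by (simp add: dist_norm)
    then have "r \<le> dist g x" using True g r by (simp add: R_def)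
    then show ?thesis using True by (simp add: far_kernel_def)
  qed simp
  have iB: "integrable \<mu> ?B"
    by (rule mu.integrable_const_bound[of _ "1 / r"]) (use norm_far_kernel_le[OF r(1), of g] r in auto)
  have iF: "integrable \<mu> (far_kernel g r)"
    by (rule mu.integrable_const_bound[of _ "1 / r"]) (use norm_far_kernel_le[OF r(1), of g] in auto)
  have iA: "integrable \<mu> ?A"
    using Bochner_Integration.integrable_diff[OF iF iB] by (simp add: split[abs_def])
  have w1: "w \<le> 1" "4 * w \<le> 1" using w \<epsilon> by auto
  have p1: "(4 * w) powr \<alpha> \<le> 1" using w1 w \<alpha> by (intro powr_le1) auto
  have ann: "measure \<mu> {x. 1 - 4 * w \<le> norm x} \<le> 8 * pi * K * w"
  proof -
    have "measure \<mu> {x. 1 - 4 * w \<le> norm x} \<le> 2 * pi * K * (4 * w) powr (\<alpha> + 1)"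
      by (rule measure_annulus_le) (use w in auto)
    also have "\<dots> = 2 * pi * K * ((4 * w) powr \<alpha> * (4 * w))" using w by (simp add: powr_add)
    also have "\<dots> \<le> 2 * pi * K * (1 * (4 * w))" using w K p1 by (intro mult_left_mono mult_right_mono) auto
    finally show ?thesis by (simp add: mult_ac)
  qed
  have wle: "w \<le> w powr (1/4)" "w powr (1/2) \<le> w powr (1/4)"
    using w w1 powr_mono'[of "1/4" 1 w] powr_mono'[of "1/4" "1/2" w] by auto
  have "(\<integral>x. norm (?B x) \<partial>\<mu>) \<le> w powr (1/4) * (K * riesz_bound (3/2)) + w powr (- 1/2) * (8 * pi * K * w)"
  proof (rule integral_real_bounded)
    have [measurable]: "cball g 1 \<in> sets borel" by simp
    let ?N = "{x::complex. 1 - 4 * w \<le> norm x}"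
    have "(\<integral>\<^sup>+x. ennreal (norm (?B x)) \<partial>\<mu>)
      \<le> (\<integral>\<^sup>+x. ennreal (w powr (1/4)) * (riesz (3/2) g x * indicator (cball g 1) x * indicator ?N x)
            + ennreal (w powr (- 1/2)) * indicator ?N x \<partial>\<mu>)"
    proof (intro nn_integral_mono)
      fix x
      show "ennreal (norm (?B x)) \<le> ennreal (w powr (1/4)) * (riesz (3/2) g x * indicator (cball g 1) x * indicator ?N x)
            + ennreal (w powr (- 1/2)) * indicator ?N x"
      proof (cases "\<not> norm x \<le> R \<and> r \<le> dist g x")
        case True
        then have N: "x \<in> ?N" and gx: "g \<noteq> x" and d: "0 < dist g x" and nB: "norm (?B x) = 1 / dist g x"
          using r by (auto simp: R_def norm_far_kernel)
        show ?thesis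
        \<comment> \<open>Below distance \<open>w powr (1/2)\<close>, half a power of the distance
          is traded for \<open>w powr (1/4)\<close>, which leaves the integrable exponent 3/2. Above
          it, the kernel is at most \<open>w powr (- 1/2)\<close> against a mass of order
          \<open>w\<close>.\<close>
        proof (cases "dist g x \<le> w powr (1/2)")
          case True
          have "w powr (1/2) \<le> 1" using w w1 by (intro powr_le1) auto
          then have b: "x \<in> cball g 1" using True by auto
          have "dist g x powr (1/2) * dist g x powr (- (3/2)) = dist g x powr (- 1)"
            by (simp only: powr_add[symmetric]) simp
          then have "1 / dist g x = dist g x powr (1/2) * dist g x powr (- (3/2))"
            using d by (simp add: powr_minus divide_simps)
          also have "\<dots> \<le> (w powr (1/2)) powr (1/2) * dist g x powr (- (3/2))"
            using True d by (intro mult_right_mono powr_mono2) auto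
          also have "(w powr (1/2)) powr (1/2) = w powr (1/4)" by (simp add: powr_powr)
          finally have "ennreal (1 / dist g x) \<le> ennreal (w powr (1/4)) * riesz (3/2) g x"
            unfolding riesz_eq[OF gx] by (subst ennreal_mult[symmetric]) (auto intro: ennreal_leI)
          then show ?thesis using N b nB by (simp add: add_increasing2)
        next
          case False
          then have "1 / dist g x \<le> 1 / w powr (1/2)" using w d by (intro divide_left_mono mult_pos_pos) auto
          also have "\<dots> = w powr (- 1/2)" using w by (simp add: powr_minus divide_simps)
          finally have "ennreal (1 / dist g x) \<le> ennreal (w powr (- 1/2))" by (rule ennreal_leI)
          then show ?thesis using N nB by (simp add: add_increasing)
        qed
      qed (auto simp: norm_far_kernel)
    qed
    also have "\<dots> = ennreal (w powr (1/4)) * (\<integral>\<^sup>+x\<in>?N. riesz (3/2) g x * indicator (cball g 1) x \<partial>\<mu>)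
        + ennreal (w powr (- 1/2)) * emeasure \<mu> ?N"
    proof -
      have "(\<integral>\<^sup>+x. ennreal (w powr (- 1/2)) * indicator ?N x \<partial>\<mu>) = ennreal (w powr (- 1/2)) * emeasure \<mu> ?N"
        by (rule nn_integral_cmult_indicator) measurable
      moreover have "(\<integral>\<^sup>+x. ennreal (w powr (1/4)) * (riesz (3/2) g x * indicator (cball g 1) x * indicator ?N x) \<partial>\<mu>)
         = ennreal (w powr (1/4)) * (\<integral>\<^sup>+x\<in>?N. riesz (3/2) g x * indicator (cball g 1) x \<partial>\<mu>)"
        by (rule nn_integral_cmult) measurable
      moreover have "(\<lambda>x. ennreal (w powr (1/4)) * (riesz (3/2) g x * indicator (cball g 1) x * indicator ?N x)) \<in> borel_measurable \<mu>"
        and "(\<lambda>x. ennreal (w powr (- 1/2)) * indicator ?N x) \<in> borel_measurable \<mu>"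
        by measurable
      ultimately show ?thesis by (simp only: nn_integral_add)
    qed
    also have "\<dots> \<le> ennreal (w powr (1/4)) * ennreal (K * (4 * w) powr \<alpha> * riesz_bound (3/2))
        + ennreal (w powr (- 1/2)) * ennreal (8 * pi * K * w)"
      using ann w by (intro add_mono mult_left_mono riesz_local_le)
        (auto simp: mu.emeasure_eq_measure intro!: ennreal_leI)
    also have "\<dots> \<le> ennreal (w powr (1/4)) * ennreal (K * riesz_bound (3/2))
        + ennreal (w powr (- 1/2)) * ennreal (8 * pi * K * w)"
    proof -
      have "K * (4 * w) powr \<alpha> * riesz_bound (3/2) \<le> K * 1 * riesz_bound (3/2)"
        using p1 K riesz_bound_pos[of "3/2"] by (intro mult_left_mono mult_right_mono) auto
      then show ?thesis by (intro add_mono mult_left_mono ennreal_leI order_refl) auto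
    qed
    also have "\<dots> = ennreal (w powr (1/4) * (K * riesz_bound (3/2)) + w powr (- 1/2) * (8 * pi * K * w))"
    proof -
      have "0 \<le> K * riesz_bound (3/2)" "0 \<le> 8 * pi * K * w" using K w riesz_bound_pos[of "3/2"] by auto
      then show ?thesis
        by (simp only: ennreal_mult[OF powr_ge_zero, symmetric] ennreal_plus[symmetric] mult_nonneg_nonneg powr_ge_zero)
    qed
    finally show "(\<integral>\<^sup>+x. ennreal (norm (?B x)) \<partial>\<mu>)
      \<le> ennreal (w powr (1/4) * (K * riesz_bound (3/2)) + w powr (- 1/2) * (8 * pi * K * w))" .
  qed (use K w riesz_bound_pos[of "3/2"] in auto)
  also have "w powr (- 1/2) * (8 * pi * K * w) = 8 * pi * K * (w powr (- 1/2) * w powr 1)"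
    using w by simp
  also have "w powr (- 1/2) * w powr 1 = w powr (1/2)" by (simp only: powr_add[symmetric]) simp
  also have "8 * pi * K * w powr (1/2) \<le> 8 * pi * K * w powr (1/4)"
    using wle K by (intro mult_left_mono) auto
  finally have B: "norm (integral\<^sup>L \<mu> ?B) \<le> w powr (1/4) * (K * riesz_bound (3/2)) + 8 * pi * K * w powr (1/4)"
    using integral_norm_bound[of \<mu> ?B] by linarith
  have "measure \<mu> (cball 0 R) = 1 - measure \<mu> (space \<mu> - cball 0 R)"
    by (subst mu.prob_compl) auto
  moreover have "measure \<mu> (space \<mu> - cball 0 R) \<le> measure \<mu> {x. 1 - 4 * w \<le> norm x}"
    by (intro mu.finite_measure_mono) (auto simp: R_def)
  ultimately have m: "1 - measure \<mu> (cball 0 R) \<le> 8 * pi * K * w" using ann by linarith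
  have "norm (measure \<mu> (cball 0 R) / g - 1 / g) = (1 - measure \<mu> (cball 0 R)) / norm g"
  proof -
    have "measure \<mu> (cball 0 R) / g - 1 / g = complex_of_real (measure \<mu> (cball 0 R) - 1) / g"
      by (simp add: diff_divide_distrib)
    then have "norm (measure \<mu> (cball 0 R) / g - 1 / g) = \<bar>measure \<mu> (cball 0 R) - 1\<bar> / norm g"
      by (simp only: norm_divide norm_of_real)
    then show ?thesis using mu.prob_le_1[of "cball 0 R"] by simp
  qed
  also have "\<dots> \<le> 8 * pi * K * w / (1/2)"
    using m g w \<epsilon> K by (intro frac_le) auto
  also have "\<dots> \<le> 16 * pi * K * w powr (1/4)" using wle(1) K by simp
  finally have A: "norm (integral\<^sup>L \<mu> ?A - 1 / g) \<le> 16 * pi * K * w powr (1/4)"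
    using mean_inner[OF R] by simp
  have "integral\<^sup>L \<mu> (far_kernel g r) = integral\<^sup>L \<mu> ?A + integral\<^sup>L \<mu> ?B"
    using iA iB by (simp add: split[abs_def])
  then have "norm (integral\<^sup>L \<mu> (far_kernel g r) - 1 / g) \<le> norm (integral\<^sup>L \<mu> ?A - 1 / g) + norm (integral\<^sup>L \<mu> ?B)"
    using norm_triangle_ineq[of "integral\<^sup>L \<mu> ?A - 1 / g" "integral\<^sup>L \<mu> ?B"] by (simp add: algebra_simps)
  also have "\<dots> \<le> mean_bound * w powr (1/4)"
    using A B by (simp add: mean_bound_def algebra_simps)
  finally show ?thesis .
qed

end

section \<open>Deterministic root configurations\<close>

lemma fixed_point_iff:
  fixes h y z :: complex
  assumes "h \<noteq> 0"
  shows "1 + (z - y) * h = 0 \<longleftrightarrow> y - 1 / h = z"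
proof -
  have "1 + (z - y) * h = 0 \<longleftrightarrow> 1 = (y - z) * h"
    unfolding left_diff_distrib by (metis add_diff_eq diff_add_cancel diff_eq_eq eq_iff_diff_eq_0)
  also have "\<dots> \<longleftrightarrow> 1 / h = y - z" using nonzero_divide_eq_eq[OF assms] by metis
  also have "\<dots> \<longleftrightarrow> y - 1 / h = z" by (metis diff_diff_eq2 add_diff_cancel_left' diff_add_cancel)
  finally show ?thesis .
qed

text \<open>The good event as a deterministic statement: \<open>w\<close> is the width of the
  annulus, \<open>s\<close> the scale of net and truncation, \<open>t\<close> the radius of the
  discs in (ii), \<open>E\<close> an error that is small compared with \<open>n\<close>, and
  \<open>V\<close> the bound on the near energy. \<open>2 / n \<le> t\<close> lets the fixed point
  map preserve a disc, and \<open>160 * E \<le> s * n\<^sup>2\<close> makes it contract by 1/2.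
  \<open>err\<close> keeps the error below a quarter of \<open>1 / n\<close>, so that the inward
  shift by \<open>x i / n\<close> dominates it.\<close>

locale root_configuration =
  fixes n :: nat and x :: "nat \<Rightarrow> complex" and w s t E V :: real
  assumes disk: "\<And>i. i \<in> {1..n} \<Longrightarrow> norm (x i) \<le> 1"
    and net: "\<And>z. 1 - 2 * w \<le> norm z \<Longrightarrow> norm z \<le> 1 \<Longrightarrow> \<exists>g. dist g z \<le> s / 2 \<and>
      norm ((\<Sum>j=1..n. far_kernel g (2 * s) (x j)) - of_nat n / g) \<le> E \<and>
      (\<Sum>j=1..n. norm (far_kernel g (2 * s) (x j)) ^ 2) \<le> E / s"
    and separated: "\<And>i j. \<lbrakk>i \<in> {1..n}; j \<in> {1..n}; i \<noteq> j; 1 - 2 * w \<le> norm (x i); dist (x i) (x j) \<le> w\<rbrakk>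
      \<Longrightarrow> 2 * t < dist (x i) (x j)"
    and near_energy: "\<And>i. i \<in> {1..n} \<Longrightarrow> 1 - 2 * w \<le> norm (x i) \<Longrightarrow>
      (\<Sum>j\<in>{j \<in> {1..n} - {i}. dist (x i) (x j) \<le> w}. 1 / dist (x i) (x j) ^ 2) \<le> V"
    and w: "0 < w" "w \<le> 1/8" and s: "0 < s" "4 * s \<le> w" and t: "0 < t" "2 * t \<le> s"
    and n: "2 / n \<le> t" "2 \<le> n" and E: "0 < E" "100 * E \<le> n" "160 * E \<le> s * n\<^sup>2"
    and V: "s * V \<le> E"
    and err: "2 * s + 25 * E / n \<le> 1/4"
begin

definition H :: "nat \<Rightarrow> complex \<Rightarrow> complex" where
  "H i z = (\<Sum>j\<in>{1..n} - {i}. 1 / (z - x j))"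

abbreviation p :: "complex poly" where "p \<equiv> root_poly n x"

text \<open>Moving the evaluation point from \<open>g\<close> to \<open>z\<close> changes a far term
  by at most a multiple of its squared modulus. This is why the net condition also controls the sum
  of squares.\<close>

lemma far_difference:
  assumes "dist g z \<le> s" and far: "2 * s \<le> dist g y"
  shows "norm (1 / (z - y) - far_kernel g (2 * s) y) \<le> 2 * s * norm (far_kernel g (2 * s) y) ^ 2"
    and "s \<le> dist z y" "dist g y \<le> 2 * dist z y"
proof -
  have d: "dist g y \<le> s + dist z y" using assms(1) dist_triangle[of g y z] by linarith
  then show "dist g y \<le> 2 * dist z y" and sz: "s \<le> dist z y" using far by auto
  then have pos: "0 < dist z y" "0 < dist g y" "z \<noteq> y" "g \<noteq> y" using s far by auto
  have "1 / (z - y) - 1 / (g - y) = (g - z) / ((z - y) * (g - y))"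
    using pos by (simp add: field_simps)
  then have "norm (1 / (z - y) - far_kernel g (2 * s) y) = dist g z / (dist z y * dist g y)"
    using far by (simp add: far_kernel_def norm_divide norm_mult dist_norm)
  also have "\<dots> \<le> s / ((dist g y / 2) * dist g y)"
    using pos assms \<open>dist g y \<le> 2 * dist z y\<close> s by (intro frac_le mult_right_mono) auto
  also have "\<dots> = 2 * s * norm (far_kernel g (2 * s) y) ^ 2"
    using far by (simp add: norm_far_kernel power2_eq_square)
  finally show "norm (1 / (z - y) - far_kernel g (2 * s) y) \<le> 2 * s * norm (far_kernel g (2 * s) y) ^ 2" .
qed

lemma far_sum_estimate:
  assumes gz: "dist g z \<le> s"
    and g1: "norm ((\<Sum>j=1..n. far_kernel g (2 * s) (x j)) - of_nat n / g) \<le> E"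
    and g2: "(\<Sum>j=1..n. norm (far_kernel g (2 * s) (x j)) ^ 2) \<le> E / s"
  shows "norm ((\<Sum>j\<in>{j \<in> {1..n}. 2 * s \<le> dist g (x j)}. 1 / (z - x j)) - of_nat n / g) \<le> 3 * E"
proof -
  let ?F = "{j \<in> {1..n}. 2 * s \<le> dist g (x j)}"
  have "(\<Sum>j=1..n. far_kernel g (2 * s) (x j)) = (\<Sum>j\<in>?F. far_kernel g (2 * s) (x j))"
    by (rule sum.mono_neutral_right) (auto simp: far_kernel_def)
  then have "norm ((\<Sum>j\<in>?F. 1 / (z - x j)) - (\<Sum>j=1..n. far_kernel g (2 * s) (x j)))
      \<le> (\<Sum>j\<in>?F. norm (1 / (z - x j) - far_kernel g (2 * s) (x j)))"
    by (simp add: sum_subtractf[symmetric] norm_sum)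
  also have "\<dots> \<le> (\<Sum>j\<in>?F. 2 * s * norm (far_kernel g (2 * s) (x j)) ^ 2)"
    by (intro sum_mono far_difference gz) auto
  also have "\<dots> \<le> (\<Sum>j=1..n. 2 * s * norm (far_kernel g (2 * s) (x j)) ^ 2)"
    using s by (intro sum_mono2) auto
  also have "\<dots> \<le> 2 * s * (E / s)"
    using s by (subst sum_distrib_left[symmetric], intro mult_left_mono g2) auto
  also have "\<dots> = 2 * E" using s by simp
  finally show ?thesis
    using g1 norm_triangle_ineq[of "(\<Sum>j\<in>?F. 1 / (z - x j)) - (\<Sum>j=1..n. far_kernel g (2 * s) (x j))"
      "(\<Sum>j=1..n. far_kernel g (2 * s) (x j)) - of_nat n / g"] by simp
qed

text \<open>\<open>half\<close> moves the near terms from \<open>z\<close> to the root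
  \<open>x i\<close>, where \<open>near_energy\<close> applies: a distance \<open>d < 4 * s\<close>
  satisfies \<open>2 / d \<le> 8 * s / d\<^sup>2\<close>. The total is \<open>3 * E\<close> from the
  far part and \<open>8 * E\<close> from the near part. \<open>half\<close> holds when
  \<open>z\<close> is in the disc of radius \<open>t\<close> about \<open>x i\<close>, and also when
  \<open>x i\<close> is the root nearest to \<open>z\<close>.\<close>

lemma H_estimate:
  assumes i: "i \<in> {1..n}" "1 - 2 * w \<le> norm (x i)" "dist g (x i) < 2 * s" and gz: "dist g z \<le> s"
    and g1: "norm ((\<Sum>j=1..n. far_kernel g (2 * s) (x j)) - of_nat n / g) \<le> E"
    and g2: "(\<Sum>j=1..n. norm (far_kernel g (2 * s) (x j)) ^ 2) \<le> E / s"
    and half: "\<And>j. \<lbrakk>j \<in> {1..n} - {i}; dist g (x j) < 2 * s\<rbrakk> \<Longrightarrow> dist (x i) (x j) \<le> 2 * dist z (x j)"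
  shows "norm (H i z - of_nat n / g) \<le> 11 * E"
proof -
  let ?F = "{j \<in> {1..n}. 2 * s \<le> dist g (x j)}" and ?N = "{j \<in> {1..n} - {i}. dist g (x j) < 2 * s}"
  have FN: "{1..n} - {i} = ?F \<union> ?N" using i by auto
  have Hsplit: "H i z = (\<Sum>j\<in>?F. 1 / (z - x j)) + (\<Sum>j\<in>?N. 1 / (z - x j))"
  proof -
    have "H i z = (\<Sum>j\<in>?F \<union> ?N. 1 / (z - x j))"
      unfolding H_def by (rule sum.cong[OF FN refl])
    also have "\<dots> = (\<Sum>j\<in>?F. 1 / (z - x j)) + (\<Sum>j\<in>?N. 1 / (z - x j))"
      by (rule sum.union_disjoint) auto
    finally show ?thesis .
  qed
  have near: "dist (x i) (x j) < 4 * s" if "j \<in> ?N" for j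
    using that i dist_triangle2[of "x i" "x j" g] by (simp add: dist_commute)
  have "norm (\<Sum>j\<in>?N. 1 / (z - x j)) \<le> (\<Sum>j\<in>?N. norm (1 / (z - x j)))" by (rule norm_sum)
  also have "\<dots> \<le> (\<Sum>j\<in>?N. 8 * s * (1 / dist (x i) (x j) ^ 2))"
  proof (intro sum_mono)
    fix j assume j: "j \<in> ?N"
    have sep: "0 < dist (x i) (x j)"
      using separated[of i j] i j near[OF j] s t by auto
    have "norm (1 / (z - x j)) = 1 / dist z (x j)" by (simp add: norm_divide dist_norm)
    also have "\<dots> \<le> 1 / (dist (x i) (x j) / 2)"
      using half[of j] j sep by (intro divide_left_mono mult_pos_pos) auto
    also have "\<dots> = 2 * dist (x i) (x j) / dist (x i) (x j) ^ 2"
      using sep by (simp add: power2_eq_square)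
    also have "\<dots> \<le> 2 * (4 * s) / dist (x i) (x j) ^ 2"
      using near[OF j] by (intro divide_right_mono mult_left_mono) auto
    finally show "norm (1 / (z - x j)) \<le> 8 * s * (1 / dist (x i) (x j) ^ 2)" by simp
  qed
  also have "\<dots> \<le> 8 * s * (\<Sum>j\<in>{j \<in> {1..n} - {i}. dist (x i) (x j) \<le> w}. 1 / dist (x i) (x j) ^ 2)"
    using s near by (subst sum_distrib_left[symmetric], intro mult_left_mono sum_mono2) force+
  also have "\<dots> \<le> 8 * s * V" using s by (intro mult_left_mono near_energy i) auto
  also have "\<dots> \<le> 8 * E" using V by simp
  finally have N: "norm (\<Sum>j\<in>?N. 1 / (z - x j)) \<le> 8 * E" .
  have "norm (H i z - of_nat n / g) \<le> norm ((\<Sum>j\<in>?F. 1 / (z - x j)) - of_nat n / g) + norm (\<Sum>j\<in>?N. 1 / (z - x j))"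
    unfolding Hsplit using norm_triangle_ineq[of "(\<Sum>j\<in>?F. 1 / (z - x j)) - of_nat n / g" "\<Sum>j\<in>?N. 1 / (z - x j)"]
    by (simp add: algebra_simps)
  then show ?thesis using N far_sum_estimate[OF gz g1 g2] by linarith
qed

text \<open>With \<open>norm g \<le> 17/16\<close> and \<open>norm h \<ge> n / 2\<close>, the error
  of \<open>1 / h\<close> against \<open>g / n\<close> is
  \<open>11 * (17/16) * 2 * E / n\<^sup>2\<close>, rounded up to 25. Replacing \<open>g\<close> by
  \<open>u\<close> costs \<open>2 * s / n\<close>.\<close>

lemma inverse_estimate:
  fixes g u h :: complex
  assumes h: "norm (h - of_nat n / g) \<le> 11 * E" and gu: "dist g u \<le> 2 * s" and u: "1/2 \<le> norm u" "norm u \<le> 1"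
  shows "n / 2 \<le> norm h" "norm (u / of_nat n - 1 / h) \<le> (2 * s + 25 * E / n) / n"
proof -
  have n0: "0 < real n" using n by simp
  have s1: "2 * s \<le> 1/16" using s w by linarith
  have gl: "1/4 \<le> norm g" using norm_triangle_ineq2[of u g] gu u s1 by (simp add: dist_norm norm_minus_commute)
  have gu': "norm g \<le> 17/16" using norm_triangle_ineq2[of g u] gu u s1 by (simp add: dist_norm)
  have g0: "g \<noteq> 0" using gl by auto
  have "n / (17/16) \<le> n / norm g" using gl gu' n0 by (intro divide_left_mono) auto
  moreover have "norm (of_nat n / g :: complex) = n / norm g" by (simp add: norm_divide)
  ultimately have "n / (17/16) - 11 * E \<le> norm h"
    using h norm_triangle_ineq2[of "of_nat n / g" h] unfolding norm_minus_commute[of "of_nat n / g" h]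
    by linarith
  then show hn: "n / 2 \<le> norm h" using E by simp
  then have h0: "h \<noteq> 0" using n0 by auto
  have "g / of_nat n - 1 / h = (h - of_nat n / g) * g / (of_nat n * h)"
    using g0 h0 n0 by (simp add: field_simps)
  then have "norm (g / of_nat n - 1 / h) = norm (h - of_nat n / g) * norm g / (n * norm h)"
    by (simp add: norm_divide norm_mult)
  also have "\<dots> \<le> (11 * E) * (17/16) / (n * (n / 2))"
    using h gu' hn n0 E by (intro frac_le mult_mono mult_left_mono) auto
  also have "\<dots> \<le> 25 * E / n / n" using E n0 by (simp add: field_simps)
  finally have 1: "norm (g / of_nat n - 1 / h) \<le> 25 * E / n / n" .
  have "norm (u / of_nat n - g / of_nat n) \<le> 2 * s / n"
    using gu n0 by (simp add: diff_divide_distrib[symmetric] norm_divide dist_norm norm_minus_commute divide_right_mono)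
  then show "norm (u / of_nat n - 1 / h) \<le> (2 * s + 25 * E / n) / n"
    using 1 norm_triangle_ineq[of "u / of_nat n - g / of_nat n" "g / of_nat n - 1 / h"]
    by (simp add: add_divide_distrib)
qed

section \<open>Critical points in the discs about the roots\<close>

lemma pderiv_root_poly:
  "poly (pderiv (root_poly m y)) z = (\<Sum>k=1..m. \<Prod>j\<in>{1..m} - {k}. (z - y j))"
  unfolding root_poly_def by (simp add: pderiv_prod poly_sum poly_prod pderiv_pCons)

text \<open>Factoring the product over \<open>j \<noteq> i\<close> out of the derivative leaves
  \<open>1 + (z - x i) * H i z\<close>. Unlike the logarithmic derivative, this form makes sense at
  \<open>z = x i\<close> too.\<close>

lemma poly_pderiv_root:
  assumes i: "i \<in> {1..n}" and z: "\<And>j. j \<in> {1..n} - {i} \<Longrightarrow> z \<noteq> x j"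
  shows "z \<in> critical_points p \<longleftrightarrow> 1 + (z - x i) * H i z = 0"
proof -
  let ?P = "\<Prod>j\<in>{1..n} - {i}. (z - x j)"
  have P0: "?P \<noteq> 0" using z by auto
  have "(\<Prod>j\<in>{1..n} - {k}. (z - x j)) = ?P * ((z - x i) * (1 / (z - x k)))" if k: "k \<in> {1..n} - {i}" for k
  proof -
    have "(\<Prod>j\<in>{1..n} - {k}. (z - x j)) = (z - x i) * (\<Prod>j\<in>{1..n} - {k} - {i}. (z - x j))"
      by (rule prod.remove) (use i k in auto)
    moreover have "?P = (z - x k) * (\<Prod>j\<in>{1..n} - {i} - {k}. (z - x j))"
      by (rule prod.remove) (use k in auto)
    moreover have "{1..n} - {k} - {i} = {1..n} - {i} - {k}" by auto
    ultimately show ?thesis using z[OF k] by simp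
  qed
  then have "poly (pderiv p) z = ?P + (\<Sum>k\<in>{1..n} - {i}. ?P * ((z - x i) * (1 / (z - x k))))"
    unfolding pderiv_root_poly using i by (subst sum.remove[of _ i]) auto
  also have "\<dots> = ?P * (1 + (z - x i) * H i z)"
    unfolding H_def by (simp only: sum_distrib_left[symmetric]) (simp add: distrib_left)
  finally show ?thesis using P0 by (simp add: critical_points_def)
qed

lemma gap:
  assumes i: "i \<in> {1..n}" "1 - 2 * w \<le> norm (x i)" and j: "j \<in> {1..n} - {i}"
  shows "2 * t < dist (x i) (x j)"
  using separated[of i j] i j t s w by (cases "dist (x i) (x j) \<le> w") auto

lemma gap_half:
  assumes i: "i \<in> {1..n}" "1 - 2 * w \<le> norm (x i)" and z: "dist (x i) z \<le> t" and j: "j \<in> {1..n} - {i}"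
  shows "dist (x i) (x j) \<le> 2 * dist z (x j)" "z \<noteq> x j"
  using gap[OF i j] z dist_triangle[of "x i" "x j" z] t by auto

text \<open>Each other root is either far from a net point \<open>g\<close> near \<open>x i\<close>,
  where distances from \<open>x i\<close> and from \<open>g\<close> are comparable and the net
  condition gives \<open>4 * E / s\<close>, or within \<open>w\<close> of \<open>x i\<close>, where
  \<open>near_energy\<close> gives \<open>E / s\<close>.\<close>

lemma energy_le:
  assumes i: "i \<in> {1..n}" "1 - 2 * w \<le> norm (x i)"
  shows "(\<Sum>j\<in>{1..n} - {i}. 1 / dist (x i) (x j) ^ 2) \<le> 5 * E / s"
proof -
  obtain g where g: "dist g (x i) \<le> s / 2"
    and g2: "(\<Sum>j=1..n. norm (far_kernel g (2 * s) (x j)) ^ 2) \<le> E / s"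
    using net[OF i(2) disk[OF i(1)]] by blast
  let ?F = "{j \<in> {1..n}. 2 * s \<le> dist g (x j)}" and ?N = "{j \<in> {1..n} - {i}. dist (x i) (x j) \<le> w}"
  have "(\<Sum>j\<in>{1..n} - {i}. 1 / dist (x i) (x j) ^ 2) \<le> (\<Sum>j\<in>?F \<union> ?N. 1 / dist (x i) (x j) ^ 2)"
  proof (intro sum_mono2)
    show "{1..n} - {i} \<subseteq> ?F \<union> ?N"
    proof
      fix j assume j: "j \<in> {1..n} - {i}"
      show "j \<in> ?F \<union> ?N"
        using j g s dist_triangle2[of "x i" "x j" g] by (cases "2 * s \<le> dist g (x j)") (auto simp: dist_commute)
    qed
  qed auto
  also have "\<dots> \<le> (\<Sum>j\<in>?F. 1 / dist (x i) (x j) ^ 2) + (\<Sum>j\<in>?N. 1 / dist (x i) (x j) ^ 2)"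
    by (subst sum_Un) (auto intro: sum_nonneg)
  also have "(\<Sum>j\<in>?F. 1 / dist (x i) (x j) ^ 2) \<le> (\<Sum>j\<in>?F. 4 * norm (far_kernel g (2 * s) (x j)) ^ 2)"
  proof (intro sum_mono)
    fix j assume j: "j \<in> ?F"
    have f: "dist g (x j) \<le> 2 * dist (x i) (x j)" "0 < dist g (x j)"
      using far_difference(3)[of g "x i" "x j"] g j s by auto
    have "1 / dist (x i) (x j) ^ 2 \<le> 1 / (dist g (x j) / 2) ^ 2"
      using f by (intro divide_left_mono power_mono mult_pos_pos zero_less_power) auto
    then show "1 / dist (x i) (x j) ^ 2 \<le> 4 * norm (far_kernel g (2 * s) (x j)) ^ 2"
      using j by (simp add: norm_far_kernel power_divide)
  qed
  also have "\<dots> \<le> (\<Sum>j=1..n. 4 * norm (far_kernel g (2 * s) (x j)) ^ 2)" by (intro sum_mono2) auto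
  also have "\<dots> \<le> 4 * (E / s)" using g2 by (simp add: sum_distrib_left[symmetric])
  also have "(\<Sum>j\<in>?N. 1 / dist (x i) (x j) ^ 2) \<le> E / s"
    using near_energy[OF i] V s by (simp add: pos_le_divide_eq mult.commute order_trans[OF mult_left_mono[OF _ less_imp_le[OF s(1)]]])
  finally show ?thesis by simp
qed

text \<open>Both denominators are at least half the distance from \<open>x i\<close>, which turns
  the bound \<open>5 * E / s\<close> on the energy into the constant
  \<open>20 * E / s\<close>.\<close>

lemma H_Lipschitz:
  assumes i: "i \<in> {1..n}" "1 - 2 * w \<le> norm (x i)" and z: "dist (x i) z \<le> t" "dist (x i) z' \<le> t"
  shows "norm (H i z - H i z') \<le> 20 * E / s * dist z z'"
proof -
  have "norm (H i z - H i z') \<le> (\<Sum>j\<in>{1..n} - {i}. norm (1 / (z - x j) - 1 / (z' - x j)))"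
    unfolding H_def by (simp add: sum_subtractf[symmetric] norm_sum)
  also have "\<dots> \<le> (\<Sum>j\<in>{1..n} - {i}. 4 * dist z z' * (1 / dist (x i) (x j) ^ 2))"
  proof (intro sum_mono)
    fix j assume j: "j \<in> {1..n} - {i}"
    have d: "0 < dist (x i) (x j)" using gap[OF i j] t by linarith
    note a = gap_half[OF i z(1) j] and b = gap_half[OF i z(2) j]
    have "1 / (z - x j) - 1 / (z' - x j) = (z' - z) / ((z - x j) * (z' - x j))"
      using a b by (simp add: field_simps)
    then have "norm (1 / (z - x j) - 1 / (z' - x j)) = dist z z' / (dist z (x j) * dist z' (x j))"
      by (simp add: norm_divide norm_mult dist_norm norm_minus_commute)
    also have "\<dots> \<le> dist z z' / ((dist (x i) (x j) / 2) * (dist (x i) (x j) / 2))"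
      using a b d by (intro divide_left_mono mult_mono mult_pos_pos) auto
    finally show "norm (1 / (z - x j) - 1 / (z' - x j)) \<le> 4 * dist z z' * (1 / dist (x i) (x j) ^ 2)"
      by (simp add: power2_eq_square mult.commute)
  qed
  also have "\<dots> = 4 * dist z z' * (\<Sum>j\<in>{1..n} - {i}. 1 / dist (x i) (x j) ^ 2)"
    by (rule sum_distrib_left[symmetric])
  also have "\<dots> \<le> 4 * dist z z' * (5 * E / s)"
    by (intro mult_left_mono energy_le i) auto
  finally show ?thesis by (simp add: mult_ac)
qed

lemma H_disc:
  assumes i: "i \<in> {1..n}" "1 - 2 * w \<le> norm (x i)" and z: "dist (x i) z \<le> t"
  shows "n / 2 \<le> norm (H i z)" "norm (x i / of_nat n - 1 / H i z) \<le> (2 * s + 25 * E / n) / n"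
proof -
  obtain g where g: "dist g (x i) \<le> s / 2"
    and g1: "norm ((\<Sum>j=1..n. far_kernel g (2 * s) (x j)) - of_nat n / g) \<le> E"
    and g2: "(\<Sum>j=1..n. norm (far_kernel g (2 * s) (x j)) ^ 2) \<le> E / s"
    using net[OF i(2) disk[OF i(1)]] by blast
  have gz: "dist g z \<le> s" using g z t dist_triangle[of g z "x i"] by linarith
  have est: "norm (H i z - of_nat n / g) \<le> 11 * E"
    by (rule H_estimate[OF i _ gz g1 g2]) (use g s gap_half[OF i z] in auto)
  have "dist g (x i) \<le> 2 * s" "1/2 \<le> norm (x i)" using g s i w by auto
  from inverse_estimate[OF est this disk[OF i(1)]]
  show "n / 2 \<le> norm (H i z)" "norm (x i / of_nat n - 1 / H i z) \<le> (2 * s + 25 * E / n) / n"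
    by auto
qed

lemma critical_iff_fixed_point:
  assumes i: "i \<in> {1..n}" "1 - 2 * w \<le> norm (x i)" and z: "dist (x i) z \<le> t"
  shows "z \<in> critical_points p \<longleftrightarrow> x i - 1 / H i z = z"
proof -
  have "0 < real n" using n by simp
  then have "H i z \<noteq> 0" using H_disc(1)[OF i z] by auto
  then have "1 + (z - x i) * H i z = 0 \<longleftrightarrow> x i - 1 / H i z = z" by (rule fixed_point_iff)
  moreover have "z \<in> critical_points p \<longleftrightarrow> 1 + (z - x i) * H i z = 0"
    by (rule poly_pderiv_root[OF i(1) gap_half(2)[OF i z]])
  ultimately show ?thesis by simp
qed

lemma unique_critical_point:
  assumes i: "i \<in> {1..n}" "1 - 2 * w \<le> norm (x i)"
  shows "\<exists>!z. z \<in> cball (x i) t \<and> z \<in> critical_points p"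
proof -
  have n0: "0 < real n" using n by simp
  let ?F = "\<lambda>z. x i - 1 / H i z"
  have "\<exists>!z\<in>cball (x i) t. ?F z = z"
  proof (rule Banach_fix)
    show "?F ` cball (x i) t \<subseteq> cball (x i) t"
    proof clarify
      fix z assume "z \<in> cball (x i) t"
      then have "n / 2 \<le> norm (H i z)" by (intro H_disc i) simp
      then have "1 / norm (H i z) \<le> 1 / (n / 2)" using n0 by (intro divide_left_mono mult_pos_pos) auto
      then show "?F z \<in> cball (x i) t" using n by (simp add: dist_norm norm_divide)
    qed
    fix z z' assume z: "z \<in> cball (x i) t" "z' \<in> cball (x i) t"
    then have "dist (x i) z \<le> t" "dist (x i) z' \<le> t" by auto
    then have h: "n / 2 \<le> norm (H i z)" "n / 2 \<le> norm (H i z')" by (blast intro: H_disc(1)[OF i])+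
    then have h0: "H i z \<noteq> 0" "H i z' \<noteq> 0" using n0 by auto
    have "?F z - ?F z' = (H i z - H i z') / (H i z * H i z')" using h0 by (simp add: field_simps)
    then have "dist (?F z) (?F z') = norm (H i z - H i z') / (norm (H i z) * norm (H i z'))"
      by (simp only: dist_norm norm_divide norm_mult)
    also have "\<dots> \<le> (20 * E / s * dist z z') / ((n / 2) * (n / 2))"
      using h n0 z E(1) s(1) by (intro frac_le mult_mono H_Lipschitz i) auto
    also have "\<dots> = 80 * E / (s * n\<^sup>2) * dist z z'" using n0 by (simp add: field_simps power2_eq_square)
    also have "\<dots> \<le> 1/2 * dist z z'"
    proof (rule mult_right_mono)
      have "0 < s * n\<^sup>2" using s n0 by simp
      then show "80 * E / (s * n\<^sup>2) \<le> 1/2" using E by (simp add: divide_le_eq)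
    qed simp
    finally show "dist (?F z) (?F z') \<le> 1/2 * dist z z'" .
  qed (use t in \<open>auto simp: complete_eq_closed\<close>)
  moreover have "(z \<in> cball (x i) t \<and> z \<in> critical_points p) = (z \<in> cball (x i) t \<and> ?F z = z)" for z
    using critical_iff_fixed_point[OF i, of z] by auto
  ultimately show ?thesis by simp
qed

text \<open>For the third estimate, \<open>z - x i = - 1 / H i z\<close>, while the correction is
  \<open>1 / H i (x i) - 1 / (n * H i (x i))\<close>. The difference of reciprocals is controlled by
  the Lipschitz bound over a distance of at most \<open>2 / n\<close>; the last term gives
  \<open>2 / n\<^sup>2\<close>.\<close>

lemma critical_point_near_root:
  assumes i: "i \<in> {1..n}" "1 - 2 * w \<le> norm (x i)" and z: "dist (x i) z \<le> t" "z \<in> critical_points p"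
  shows "norm (z - x i * (1 - 1 / of_nat n)) \<le> (2 * s + 25 * E / n) / n" "norm (z - x i) \<le> 2 / n"
    "norm (z - x i + 1 / of_nat n * (1 / (1 / (of_nat n - 1) * H i (x i)))) \<le> 160 * E / (s * n ^ 3) + 2 / n\<^sup>2"
proof -
  have n0: "0 < real n" using n by simp
  have zH: "z - x i = - (1 / H i z)" using critical_iff_fixed_point[OF i z(1)] z(2) by (simp add: algebra_simps)
  have hz: "n / 2 \<le> norm (H i z)" by (rule H_disc(1)[OF i z(1)])
  have hx: "n / 2 \<le> norm (H i (x i))" by (rule H_disc(1)[OF i]) (use t in simp)
  have h0: "H i z \<noteq> 0" "H i (x i) \<noteq> 0" using hz hx n0 by auto
  have "z - x i * (1 - 1 / of_nat n) = x i / of_nat n - 1 / H i z" using zH by (simp add: algebra_simps)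
  then show "norm (z - x i * (1 - 1 / of_nat n)) \<le> (2 * s + 25 * E / n) / n"
    using H_disc(2)[OF i z(1)] by simp
  have "1 / norm (H i z) \<le> 1 / (n / 2)" using hz n0 by (intro divide_left_mono mult_pos_pos) auto
  then show zx: "norm (z - x i) \<le> 2 / n" unfolding zH by (simp add: norm_divide)
  \<comment> \<open>Here \<open>n \<ge> 2\<close> matters: for \<open>n = 1\<close> the division by
    \<open>n - 1\<close> would take its default value 0.\<close>
  have "of_nat n - 1 \<noteq> (0::complex)" 
    using n by (metis of_nat_1 of_nat_eq_iff one_less_numeral_iff order_less_le_trans order_less_irrefl right_minus_eq semiring_norm(76))
  then have "z - x i + 1 / of_nat n * (1 / (1 / (of_nat n - 1) * H i (x i)))
     = (H i z - H i (x i)) / (H i z * H i (x i)) - 1 / (of_nat n * H i (x i))"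
    unfolding zH using h0 n0 by (simp add: field_simps)
  also have "norm \<dots> \<le> norm (H i z - H i (x i)) / (norm (H i z) * norm (H i (x i))) + 1 / (n * norm (H i (x i)))"
    by (rule order_trans[OF norm_triangle_ineq4]) (simp add: norm_divide norm_mult)
  also have "\<dots> \<le> (20 * E / s * (2 / n)) / ((n / 2) * (n / 2)) + 1 / (n * (n / 2))"
  proof (intro add_mono frac_le mult_mono)
    have "norm (H i z - H i (x i)) \<le> 20 * E / s * dist z (x i)"
      by (rule H_Lipschitz[OF i z(1)]) (use t in simp)
    also have "\<dots> \<le> 20 * E / s * (2 / n)"
      using zx E s by (intro mult_left_mono) (auto simp: dist_norm)
    finally show "norm (H i z - H i (x i)) \<le> 20 * E / s * (2 / n)" .
  qed (use hz hx n0 E s in auto)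
  also have "\<dots> = 160 * E / (s * n ^ 3) + 2 / n\<^sup>2"
    using n0 s by (simp add: field_simps power2_eq_square power3_eq_cube)
  finally show "norm (z - x i + 1 / of_nat n * (1 / (1 / (of_nat n - 1) * H i (x i)))) \<le> 160 * E / (s * n ^ 3) + 2 / n\<^sup>2" .
qed

text \<open>If no root were within \<open>2 * s\<close> of a net point \<open>g\<close> near
  \<open>W\<close>, the logarithmic derivative at \<open>W\<close> would be close to
  \<open>n / g\<close> and could not vanish. Otherwise the nearest root serves.\<close>

lemma critical_point_has_root:
  assumes W: "W \<in> critical_points p" "1 - w \<le> norm W" "norm W \<le> 1"
  obtains i where "i \<in> {1..n}" "1 - w \<le> norm (x i)" "norm (x i) \<le> 1" "dist (x i) W \<le> t"
proof -
  have n0: "0 < real n" using n by simp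
  obtain g where g: "dist g W \<le> s / 2"
    and g1: "norm ((\<Sum>j=1..n. far_kernel g (2 * s) (x j)) - of_nat n / g) \<le> E"
    and g2: "(\<Sum>j=1..n. norm (far_kernel g (2 * s) (x j)) ^ 2) \<le> E / s"
  proof -
    have "1 - 2 * w \<le> norm W" using W(2) w by linarith
    from net[OF this W(3)] that show thesis by blast
  qed
  have gW: "dist g W \<le> s" using g s(1) by linarith
  have gW2: "dist g W \<le> 2 * s" using g s(1) by linarith
  have W': "1/2 \<le> norm W" using W(2) w by linarith
  let ?N = "{j \<in> {1..n}. dist g (x j) < 2 * s}"
  show ?thesis
  proof (cases "?N = {}")
    case True
    have far: "2 * s \<le> dist g (x j)" if "j \<in> {1..n}" for j
    proof (rule ccontr)
      assume "\<not> 2 * s \<le> dist g (x j)"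
      then have "j \<in> ?N" using that by (simp only: mem_Collect_eq not_le)
      then show False using True by blast
    qed
    then have F: "{j \<in> {1..n}. 2 * s \<le> dist g (x j)} = {1..n}" by blast
    have ne: "W \<noteq> x j" if "j \<in> {1..n}" for j
      using far_difference(2)[OF gW far[OF that]] s(1) by auto
    have "norm ((\<Sum>j=1..n. 1 / (W - x j)) - of_nat n / g) \<le> 11 * E"
      using far_sum_estimate[OF gW g1 g2] E unfolding F by linarith
    then have "n / 2 \<le> norm (\<Sum>j=1..n. 1 / (W - x j))"
      by (rule inverse_estimate(1)[OF _ gW2 W' W(3)])
    then have S0: "(\<Sum>j=1..n. 1 / (W - x j)) \<noteq> 0" using n0 by auto
    have 1: "1 \<in> {1..n}" using n by simp
    have "(\<Sum>j=1..n. 1 / (W - x j)) = 1 / (W - x 1) + H 1 W"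
      unfolding H_def by (rule sum.remove[OF _ 1]) simp
    then have "1 + (W - x 1) * H 1 W = (W - x 1) * (\<Sum>j=1..n. 1 / (W - x j))"
      using ne[OF 1] by (simp add: algebra_simps)
    then have "1 + (W - x 1) * H 1 W \<noteq> 0" using S0 ne[OF 1] by simp
    moreover have "1 + (W - x 1) * H 1 W = 0" using poly_pderiv_root[OF 1] ne W(1) by simp
    ultimately show ?thesis by simp
  next
    case False
    \<comment> \<open>Minimality gives \<open>dist (x i) (x j) \<le> dist (x i) W + dist W (x j)
      \<le> 2 * dist W (x j)\<close>, which is the hypothesis \<open>half\<close> although
      \<open>W\<close> is not yet known to be in the disc about \<open>x i\<close>.\<close>
    define i where "i = arg_min_on (\<lambda>j. dist W (x j)) ?N"
    have fin: "finite ?N" by simp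
    have iN: "i \<in> ?N" unfolding i_def by (rule arg_min_if_finite(1)[OF fin False])
    have imin: "dist W (x i) \<le> dist W (x j)" if "j \<in> ?N" for j
      unfolding i_def by (rule arg_min_least[OF fin False that])
    have i: "i \<in> {1..n}" and gi: "dist g (x i) < 2 * s" using iN by auto
    have "dist W (x i) \<le> s + 2 * s" using gi gW dist_triangle3[of W "x i" g] by linarith
    then have ni: "1 - 2 * w \<le> norm (x i)"
      using W(2) s norm_triangle_ineq2[of W "x i"] by (simp add: dist_norm)
    have half: "dist (x i) (x j) \<le> 2 * dist W (x j)" if "j \<in> {1..n} - {i}" "dist g (x j) < 2 * s" for j
      using imin[of j] that dist_triangle3[of "x i" "x j" W] by auto
    have est: "norm (H i W - of_nat n / g) \<le> 11 * E"
      by (rule H_estimate[OF i ni gi gW g1 g2 half])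
    have hW: "n / 2 \<le> norm (H i W)"
      by (rule inverse_estimate(1)[OF est gW2 W' W(3)])
    have ne: "W \<noteq> x j" if j: "j \<in> {1..n} - {i}" for j
    proof (cases "dist g (x j) < 2 * s")
      case True
      then show ?thesis using half[OF j True] gap[OF i ni j] t by auto
    next
      case False
      then show ?thesis using far_difference(2)[OF gW, of "x j"] s by auto
    qed
    have "1 + (W - x i) * H i W = 0" using poly_pderiv_root[OF i ne] W(1) by simp
    then have "norm ((W - x i) * H i W) = 1" by (metis add_eq_0_iff norm_minus_cancel norm_one)
    then have "dist (x i) W * norm (H i W) = 1" by (simp add: norm_mult dist_norm norm_minus_commute)
    moreover have "H i W \<noteq> 0" using hW n0 by auto
    ultimately have "dist (x i) W = 1 / norm (H i W)" by (simp add: field_simps)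
    also have "\<dots> \<le> 1 / (n / 2)" using hW n0 by (intro divide_left_mono mult_pos_pos) auto
    finally have dt: "dist (x i) W \<le> t" using n by simp
    \<comment> \<open>So far \<open>x i\<close> is only known to lie in the annulus of width
      \<open>2 * w\<close>. Since \<open>W\<close> is within \<open>1 / (4 * n)\<close> of
      \<open>x i * (1 - 1 / n)\<close> and \<open>norm W \<ge> 1/4\<close>, the root is at least as
      far from the origin as \<open>W\<close>, hence in the annulus of width
      \<open>w\<close>.\<close>
    have "norm (W - x i * (1 - 1 / of_nat n)) \<le> (2 * s + 25 * E / n) / n"
      by (rule critical_point_near_root(1)[OF i ni dt W(1)])
    also have "\<dots> \<le> (1/4) / n" using err by (intro divide_right_mono) auto
    finally have e: "norm (W - x i * (1 - 1 / of_nat n)) \<le> (1/4) / n" .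
    have "norm (1 - 1 / of_nat n :: complex) = 1 - 1 / n"
    proof -
      have "(1 - 1 / of_nat n :: complex) = complex_of_real (1 - 1 / n)" by simp
      also have "norm \<dots> = \<bar>1 - 1 / n\<bar>" by (rule norm_of_real)
      finally show ?thesis using n by simp
    qed
    then have "norm W - (1/4) / n \<le> norm (x i) * (1 - 1 / n)"
      using e norm_triangle_ineq2[of W "x i * (1 - 1 / of_nat n)"] by (simp add: norm_mult)
    moreover have "(1/4) / n \<le> norm W / n" using W(2) w by (intro divide_right_mono) auto
    ultimately have "norm W * (1 - 1 / n) \<le> norm (x i) * (1 - 1 / n)" by (simp add: algebra_simps)
    moreover have "0 < 1 - 1 / real n" using n by simp
    ultimately have "norm W \<le> norm (x i)" by (simp add: mult_le_cancel_right)
    then show ?thesis using that[OF i _ disk[OF i] dt] W(2) by linarith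
  qed
qed

lemma finite_critical_points: "finite (critical_points p)"
proof -
  have "degree p = n"
    unfolding root_poly_def by (subst degree_prod_eq_sum_degree) auto
  then have "pderiv p \<noteq> 0" using n by (simp add: pderiv_eq_0_iff)
  then show ?thesis unfolding critical_points_def by (rule poly_roots_finite)
qed

text \<open>Gaps above \<open>2 * t\<close> keep the critical points of different roots distinct.
  Each lies within \<open>2 / n \<le> w / 2\<close> of its root, which explains the margin
  \<open>w / 2\<close> at the inner edge. At the outer edge the shift by \<open>- x i / n\<close>
  exceeds the error, so the critical point stays in the unit disc.\<close>

lemma card_critical_points_ge:
  "card {i \<in> {1..n}. 1 - w / 2 \<le> norm (x i)} \<le> card (critical_points p \<inter> {z. 1 - w \<le> norm z \<and> norm z \<le> 1})"
proof -
  let ?I = "{i \<in> {1..n}. 1 - w / 2 \<le> norm (x i)}"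
  define c where "c i = (THE z. z \<in> cball (x i) t \<and> z \<in> critical_points p)" for i
  have c: "dist (x i) (c i) \<le> t" "c i \<in> critical_points p" if "i \<in> ?I" for i
    using theI'[OF unique_critical_point[of i]] that w unfolding c_def by auto
  have "inj_on c ?I"
  proof (rule inj_onI, rule ccontr)
    fix i j assume ij: "i \<in> ?I" "j \<in> ?I" "c i = c j" "i \<noteq> j"
    then have "dist (x i) (x j) \<le> 2 * t"
      using c(1)[OF ij(1)] c(1)[OF ij(2)] dist_triangle2[of "x i" "x j" "c i"] by simp
    then show False using gap[of i j] ij w by auto
  qed
  moreover have "c ` ?I \<subseteq> critical_points p \<inter> {z. 1 - w \<le> norm z \<and> norm z \<le> 1}"
  proof clarify
    fix i assume i: "i \<in> {1..n}" "1 - w / 2 \<le> norm (x i)"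
    then have iI: "i \<in> ?I" and iw: "1 - 2 * w \<le> norm (x i)" using w by auto
    note near = critical_point_near_root[OF i(1) iw c[OF iI]]
    have "1 - w \<le> norm (c i)"
      using near(2) norm_triangle_ineq2[of "x i" "c i"] i n t s by (simp add: norm_minus_commute)
    moreover have "norm (c i) \<le> 1"
    proof -
      have "(1 - 1 / of_nat n :: complex) = complex_of_real (1 - 1 / n)" by simp
      then have "norm (1 - 1 / of_nat n :: complex) = \<bar>1 - 1 / n\<bar>" by (metis norm_of_real)
      also have "\<dots> = 1 - 1 / n" using n by simp
      finally have "norm (x i * (1 - 1 / of_nat n)) = norm (x i) * (1 - 1 / n)" by (simp add: norm_mult)
      also have "\<dots> \<le> 1 * (1 - 1 / n)" using disk[OF i(1)] n by (intro mult_right_mono) auto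
      finally have "norm (x i * (1 - 1 / of_nat n)) \<le> 1 - 1 / n" by simp
      moreover have "norm (c i - x i * (1 - 1 / of_nat n)) \<le> (1/4) / n"
        using near(1) err by (rule order_trans[OF _ divide_right_mono]) auto
      ultimately have "norm (c i) \<le> 1 - 1 / n + (1/4) / n"
        using norm_triangle_ineq2[of "c i" "x i * (1 - 1 / of_nat n)"] by linarith
      also have "\<dots> \<le> 1" by (simp add: field_simps)
      finally show ?thesis .
    qed
    ultimately show "c i \<in> critical_points p \<inter> {z. 1 - w \<le> norm z \<and> norm z \<le> 1}"
      using c(2)[OF iI] by simp
  qed
  ultimately show ?thesis using finite_critical_points by (intro card_inj_on_le) auto
qed

end

section \<open>Nets and probabilistic estimates\<close>

lemma norm_diff_cis_le: "norm (cis a - cis b) \<le> \<bar>a - b\<bar>"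
proof -
  have "norm (cis a - cis b) = norm (cis b) * norm (cis (a - b) - 1)"
    by (simp add: norm_mult[symmetric] right_diff_distrib cis_mult del: norm_cis)
  also have "\<dots> = norm (exp (\<i> * of_real (a - b)) - 1)" by (simp add: cis_conv_exp)
  also have "\<dots> \<le> \<bar>a - b\<bar>" using iexp_approx1[of "a - b" 0] by simp
  finally show ?thesis .
qed

text \<open>The points \<open>(1 - i s/4) cis (j s/4)\<close>.\<close>

lemma polar_net:
  fixes w s :: real
  assumes s: "0 < s" "s \<le> w" "w \<le> 1/2"
  obtains G :: "complex set" where "finite G" "card G \<le> 300 * w / s\<^sup>2" "\<And>g. g \<in> G \<Longrightarrow> 1 - 2 * w \<le> norm g"
    "\<And>z. 1 - 2 * w \<le> norm z \<Longrightarrow> norm z \<le> 1 \<Longrightarrow> \<exists>g\<in>G. dist g z \<le> s / 2"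
proof -
  \<comment> \<open>Rounding down the radius and the angle costs at most \<open>h\<close> each,
    together \<open>s / 2\<close>. The counts \<open>8 * w / s + 1\<close> and
    \<open>8 * pi / s + 1\<close> are at most \<open>9 * w / s\<close> and \<open>33 / s\<close>,
    with product below \<open>300 * w / s\<^sup>2\<close>.\<close>
  define h where "h = s / 4"
  have h: "0 < h" using s by (simp add: h_def)
  define a where "a = nat \<lfloor>2 * w / h\<rfloor>"
  define b where "b = nat \<lfloor>2 * pi / h\<rfloor>"
  define f where "f = (\<lambda>(i::nat, j::nat). complex_of_real (1 - real i * h) * cis (real j * h))"
  define G where "G = f ` ({..a} \<times> {..b})"
  have a: "real a \<le> 2 * w / h" unfolding a_def using s h by simp
  have b: "real b \<le> 2 * pi / h" unfolding b_def using h by simp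
  show ?thesis
  proof (rule that[of G])
    show "finite G" by (simp add: G_def)
    have "card G \<le> (a + 1) * (b + 1)"
      unfolding G_def by (rule order_trans[OF card_image_le]) (auto simp: card_cartesian_product)
    then have "real (card G) \<le> real ((a + 1) * (b + 1))" by (rule of_nat_mono)
    also have "\<dots> = (real a + 1) * (real b + 1)" by (simp add: algebra_simps)
    also have "\<dots> \<le> (9 * w / s) * (33 / s)"
    proof (rule mult_mono)
      have "2 * w / h = 8 * w / s" by (simp add: h_def)
      moreover have "1 \<le> w / s" using s by simp
      ultimately show "real a + 1 \<le> 9 * w / s" using a by (simp add: add_divide_distrib[symmetric])
      have "2 * pi / h = 8 * pi / s" by (simp add: h_def)
      also have "\<dots> \<le> 32 / s" using pi_less_4 s by (intro divide_right_mono) auto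
      finally have "real b \<le> 32 / s" using b by linarith
      moreover have "1 \<le> 1 / s" using s by simp
      ultimately show "real b + 1 \<le> 33 / s" by (simp add: add_divide_distrib[symmetric])
    qed (use s in auto)
    also have "\<dots> \<le> 300 * w / s\<^sup>2" using s by (simp add: power2_eq_square divide_right_mono)
    finally show "card G \<le> 300 * w / s\<^sup>2" .
  next
    fix g assume "g \<in> G"
    then obtain i j where ij: "i \<le> a" and g: "g = complex_of_real (1 - real i * h) * cis (real j * h)"
      by (auto simp: G_def f_def)
    have "real i * h \<le> real a * h" using ij h by (intro mult_right_mono) auto
    moreover have "real a * h \<le> 2 * w" using a h by (simp add: pos_le_divide_eq)
    ultimately have "real i * h \<le> 2 * w" by linarith
    moreover have "norm g = \<bar>1 - real i * h\<bar>" unfolding g by (simp only: norm_mult norm_of_real norm_cis mult_1_right)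
    ultimately show "1 - 2 * w \<le> norm g" by linarith
  next
    fix z :: complex assume z: "1 - 2 * w \<le> norm z" "norm z \<le> 1"
    define \<phi> where "\<phi> = Arg2pi z"
    have \<phi>: "0 \<le> \<phi>" "\<phi> < 2 * pi" and zp: "z = of_real (norm z) * exp (\<i> * of_real \<phi>)"
      using Arg2pi[of z] by (auto simp: \<phi>_def is_Arg_def)
    have zc: "z = of_real (norm z) * cis \<phi>" using zp by (simp add: cis_conv_exp)
    define i where "i = nat \<lfloor>(1 - norm z) / h\<rfloor>"
    define j where "j = nat \<lfloor>\<phi> / h\<rfloor>"
    have i1: "real i \<le> (1 - norm z) / h" "(1 - norm z) / h < real i + 1"
      unfolding i_def using z h by (simp_all add: of_nat_nat)
    have j1: "real j \<le> \<phi> / h" "\<phi> / h < real j + 1"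
      unfolding j_def using \<phi> h by (simp_all add: of_nat_nat)
    have i2: "real i * h \<le> 1 - norm z" "1 - norm z \<le> real i * h + h"
      using i1 h by (simp_all add: field_simps)
    have j2: "real j * h \<le> \<phi>" "\<phi> \<le> real j * h + h"
      using j1 h by (simp_all add: field_simps)
    have ia: "i \<le> a" unfolding i_def a_def using z h by (intro nat_mono floor_mono divide_right_mono) auto
    have jb: "j \<le> b" unfolding j_def b_def using \<phi> h by (intro nat_mono floor_mono divide_right_mono) auto
    let ?g = "complex_of_real (1 - real i * h) * cis (real j * h)"
    have "?g \<in> G" using ia jb by (auto simp: G_def f_def intro!: image_eqI[of _ _ "(i, j)"])
    moreover have "dist ?g z \<le> s / 2"
    proof -
      have "?g - z = complex_of_real (1 - real i * h - norm z) * cis (real j * h) + of_real (norm z) * (cis (real j * h) - cis \<phi>)"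
        by (subst (1) zc) (simp add: algebra_simps)
      then have "dist ?g z \<le> norm (complex_of_real (1 - real i * h - norm z) * cis (real j * h))
          + norm (of_real (norm z) * (cis (real j * h) - cis \<phi>))"
        unfolding dist_norm by (metis norm_triangle_ineq)
      also have "\<dots> = \<bar>1 - real i * h - norm z\<bar> + norm z * norm (cis (real j * h) - cis \<phi>)"
        by (simp only: norm_mult norm_of_real norm_cis mult_1_right abs_norm_cancel)
      also have "\<dots> \<le> h + 1 * \<bar>real j * h - \<phi>\<bar>"
        using i2 z by (intro add_mono mult_mono norm_diff_cis_le) auto
      also have "\<dots> \<le> h + h" using j2 by auto
      finally show ?thesis by (simp add: h_def)
    qed
    ultimately show "\<exists>g\<in>G. dist g z \<le> s / 2" by blast
  qed
qed

text \<open>A single term below \<open>L\<close> already forces a gap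
  \<open>L powr (- 1 / q)\<close>, and the infinite value on the diagonal excludes coincident roots.
  Writing \<open>d powr (- 2)\<close> as \<open>d powr (q - 2) * d powr (- q)\<close> and using the
  gap in the first factor gives \<open>L powr ((2 - q) / q) * L\<close>.\<close>

lemma pair_kernel_consequences:
  fixes x :: "nat \<Rightarrow> complex" and q w L :: real
  assumes q: "0 < q" "q < 2" and L: "0 < L"
    and U: "(\<Sum>i=1..n. \<Sum>j\<in>{1..n}-{i}. pair_kernel q w (x i, x j)) < ennreal L"
    and i: "i \<in> {1..n}" "1 - 2 * w \<le> norm (x i)"
  shows "j \<in> {1..n} - {i} \<Longrightarrow> dist (x i) (x j) \<le> w \<Longrightarrow> L powr (- 1 / q) < dist (x i) (x j)"
    and "(\<Sum>j\<in>{j \<in> {1..n} - {i}. dist (x i) (x j) \<le> w}. 1 / dist (x i) (x j) ^ 2) \<le> L powr (2 / q)"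
proof -
  let ?N = "{j \<in> {1..n} - {i}. dist (x i) (x j) \<le> w}"
  have "(\<Sum>j\<in>?N. riesz q (x i) (x j)) = (\<Sum>j\<in>?N. pair_kernel q w (x i, x j))"
    using i by (intro sum.cong) (auto simp: pair_kernel_def)
  also have "\<dots> \<le> (\<Sum>j\<in>{1..n}-{i}. pair_kernel q w (x i, x j))"
    by (intro sum_mono2) auto
  also have "\<dots> \<le> (\<Sum>i=1..n. \<Sum>j\<in>{1..n}-{i}. pair_kernel q w (x i, x j))"
    using i by (intro member_le_sum) auto
  finally have S: "(\<Sum>j\<in>?N. riesz q (x i) (x j)) < ennreal L" using U by (rule order_le_less_trans)
  have ne: "x i \<noteq> x j" and r: "riesz q (x i) (x j) < ennreal L" if "j \<in> ?N" for j
  proof -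
    have "riesz q (x i) (x j) \<le> (\<Sum>j\<in>?N. riesz q (x i) (x j))"
      using that by (intro member_le_sum) auto
    then show *: "riesz q (x i) (x j) < ennreal L" using S by (rule order_le_less_trans)
    then show "x i \<noteq> x j" using riesz_self[of q "x i"] by (metis infinity_ennreal_def top.extremum_strict)
  qed
  have gap: "L powr (- 1 / q) < dist (x i) (x j)" if "j \<in> ?N" for j
  proof -
    have d: "0 < dist (x i) (x j)" using ne[OF that] by simp
    have "dist (x i) (x j) powr (- q) < L"
      using r[OF that] riesz_eq[OF ne[OF that], of q] by (simp add: ennreal_less_iff)
    then have "L powr (- 1 / q) < (dist (x i) (x j) powr (- q)) powr (- 1 / q)"
      using q L d by (intro powr_less_mono2_neg) (auto simp: divide_less_0_iff)
    also have "\<dots> = dist (x i) (x j)" using q d by (simp add: powr_powr)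
    finally show ?thesis .
  qed
  then show "j \<in> {1..n} - {i} \<Longrightarrow> dist (x i) (x j) \<le> w \<Longrightarrow> L powr (- 1 / q) < dist (x i) (x j)" by blast
  have "(\<Sum>j\<in>?N. riesz q (x i) (x j)) = (\<Sum>j\<in>?N. ennreal (dist (x i) (x j) powr (- q)))"
    by (intro sum.cong refl riesz_eq ne)
  also have "\<dots> = ennreal (\<Sum>j\<in>?N. dist (x i) (x j) powr (- q))" by (rule sum_ennreal) simp
  finally have S': "(\<Sum>j\<in>?N. dist (x i) (x j) powr (- q)) \<le> L"
    using S by (simp add: ennreal_less_iff sum_nonneg)
  have "(\<Sum>j\<in>?N. 1 / dist (x i) (x j) ^ 2) \<le> (\<Sum>j\<in>?N. L powr ((2 - q) / q) * dist (x i) (x j) powr (- q))"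
  proof (intro sum_mono)
    fix j assume j: "j \<in> ?N"
    have d: "0 < dist (x i) (x j)" using ne[OF j] by simp
    have "dist (x i) (x j) powr (q - 2) * dist (x i) (x j) powr (- q) = dist (x i) (x j) powr (- 2)"
      by (simp only: powr_add[symmetric]) simp
    then have "1 / dist (x i) (x j) ^ 2 = dist (x i) (x j) powr (q - 2) * dist (x i) (x j) powr (- q)"
      using d by (simp add: powr_minus_divide powr_numeral)
    also have "\<dots> \<le> (L powr (- 1 / q)) powr (q - 2) * dist (x i) (x j) powr (- q)"
      using gap[OF j] q L by (intro mult_right_mono powr_mono2') auto
    also have "(L powr (- 1 / q)) powr (q - 2) = L powr ((2 - q) / q)"
      by (simp add: powr_powr divide_simps algebra_simps)
    finally show "1 / dist (x i) (x j) ^ 2 \<le> L powr ((2 - q) / q) * dist (x i) (x j) powr (- q)" .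
  qed
  also have "\<dots> \<le> L powr ((2 - q) / q) * L"
    by (subst sum_distrib_left[symmetric], intro mult_left_mono S') simp
  also have "\<dots> = L powr ((2 - q) / q + 1)" using L by (simp add: powr_add)
  also have "(2 - q) / q + 1 = 2 / q" using q by (simp add: field_simps)
  finally show "(\<Sum>j\<in>?N. 1 / dist (x i) (x j) ^ 2) \<le> L powr (2 / q)" .
qed

section \<open>Probability of failure of the good event\<close>

context
  fixes M :: "'w measure" and X \<mu> \<alpha> \<epsilon> k K
  assumes sample: "iid_sample M X \<mu>" and edge: "edge_density \<mu> \<alpha> \<epsilon> k K"
begin

interpretation S: iid_sample M X \<mu> by (rule sample)
interpretation D: edge_density \<mu> \<alpha> \<epsilon> k K by (rule edge)
interpretation mu: prob_space \<mu> by (rule D.prob)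

lemma X_borel: "j \<in> {1..n} \<Longrightarrow> X j \<in> borel_measurable M"
  by (rule S.X_measurable) simp

text \<open>Half of each tolerance is left for the mean, as \<open>mean\<close> and
  \<open>energy\<close> say, and half for the fluctuation. The kernel sum at level
  \<open>E / 2\<close> contributes 32 of the 33. The sum of squares contributes 1: the extra
  \<open>(2 * s) powr (- 2)\<close> in the fourth moment cancels against the level
  \<open>E / (2 * s)\<close>.\<close>

lemma far_sum_failure:
  fixes n :: nat
  assumes w: "0 < w" "4 * w \<le> \<epsilon>" and g: "1 - 2 * w \<le> norm g" and s: "0 < s" "s \<le> w"
    and q: "0 < q" "q < 2" and E: "0 < E"
    and mean: "n * (D.mean_bound * w powr (1/4)) \<le> E / 2"
    and energy: "n * ((2 * s) powr (q - 2) * D.potential_bound q) \<le> E / (2 * s)"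
  shows "\<exists>B\<in>sets M. measure M B \<le> 33 * real n * (2 * s) powr (q - 2) * D.potential_bound q / E\<^sup>2 \<and>
    (\<forall>\<omega>\<in>space M - B. norm ((\<Sum>j=1..n. far_kernel g (2 * s) (X j \<omega>)) - of_nat n / g) \<le> E \<and>
        (\<Sum>j=1..n. norm (far_kernel g (2 * s) (X j \<omega>)) ^ 2) \<le> E / s)"
proof -
  let ?F = "far_kernel g (2 * s)"
  let ?P = "D.potential_bound q"
  define V where "V = (2 * s) powr (q - 2) * ?P"
  define V' where "V' = (2 * s) powr (q - 4) * ?P"
  have P0: "0 < ?P" by (rule D.potential_bound_pos[OF q(2)])
  have g': "1 - \<epsilon> / 2 \<le> norm g" using g w by simp
  have m2: "(\<integral>x. norm (?F x) ^ 2 \<partial>\<mu>) \<le> V"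
    unfolding V_def using D.far_moment_le[OF g' q, of "2 * s" 2] s by simp
  have m4: "(\<integral>x. (norm (?F x) ^ 2)\<^sup>2 \<partial>\<mu>) \<le> V'"
    unfolding V'_def using D.far_moment_le[OF g' q, of "2 * s" 4] s by (simp add: power_mult[symmetric])
  have Fb: "norm (?F x) \<le> 1 / (2 * s)" for x using s by (intro norm_far_kernel_le) simp
  have mF: "norm (integral\<^sup>L \<mu> ?F - 1 / g) \<le> D.mean_bound * w powr (1/4)"
    by (rule D.mean_far_kernel[OF w g]) (use s in auto)
  define B1 where "B1 = {\<omega> \<in> space M. E / 2 \<le> norm ((\<Sum>j=1..n. ?F (X j \<omega>)) - of_nat n * integral\<^sup>L \<mu> ?F)}"
  define B2 where "B2 = {\<omega> \<in> space M. E / (2 * s) \<le>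
     \<bar>(\<Sum>j=1..n. norm (?F (X j \<omega>)) ^ 2) - n * (\<integral>x. norm (?F x) ^ 2 \<partial>\<mu>)\<bar>}"
  have mX: "(\<lambda>\<omega>. ?F (X j \<omega>)) \<in> borel_measurable M" if "j \<in> {1..n}" for j
    using X_borel[OF that] by measurable
  have B: "B1 \<in> sets M" "B2 \<in> sets M"
    unfolding B1_def B2_def using mX by measurable
  have p1: "measure M B1 \<le> 8 * real n * V / (E / 2)\<^sup>2"
    unfolding B1_def by (rule S.Chebyshev_sum[OF _ Fb m2]) (use E in auto)
  have p2: "measure M B2 \<le> n * V' / (E / (2 * s))\<^sup>2"
    unfolding B2_def
  proof (rule S.Chebyshev_sum_real[OF _ _ m4])
    show "\<bar>norm (?F x) ^ 2\<bar> \<le> (1 / (2 * s)) ^ 2" for x using power_mono[OF Fb norm_ge_zero, of x 2] by simp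
  qed (use E s in auto)
  have "V' / (E / (2 * s))\<^sup>2 = V / E\<^sup>2"
  proof -
    have "(2 * s) powr (q - 4) * (2 * s) ^ 2 = (2 * s) powr (q - 4) * (2 * s) powr 2"
      using s by (simp add: powr_numeral)
    also have "\<dots> = (2 * s) powr (q - 2)" by (simp add: powr_add[symmetric])
    finally show ?thesis
      unfolding V_def V'_def by (simp add: power_divide divide_simps mult_ac)
  qed
  then have p2': "measure M B2 \<le> n * (V / E\<^sup>2)" using p2 by (metis times_divide_eq_right)
  have "measure M (B1 \<union> B2) \<le> measure M B1 + measure M B2" by (rule measure_Un_le[OF B])
  also have "\<dots> \<le> 8 * real n * V / (E / 2)\<^sup>2 + n * (V / E\<^sup>2)" by (rule add_mono[OF p1 p2'])
  also have "\<dots> = 33 * (n * V / E\<^sup>2)" by (simp add: power_divide)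
  finally have pB: "measure M (B1 \<union> B2) \<le> 33 * real n * (2 * s) powr (q - 2) * ?P / E\<^sup>2"
    by (simp add: V_def mult_ac)
  have good: "norm ((\<Sum>j=1..n. ?F (X j \<omega>)) - of_nat n / g) \<le> E \<and> (\<Sum>j=1..n. norm (?F (X j \<omega>)) ^ 2) \<le> E / s"
    if \<omega>: "\<omega> \<in> space M - (B1 \<union> B2)" for \<omega>
  proof
    let ?S = "\<Sum>j=1..n. ?F (X j \<omega>)" and ?I = "of_nat n * integral\<^sup>L \<mu> ?F"
    have "norm (?S - ?I) < E / 2" using \<omega> by (auto simp: B1_def not_le)
    moreover have "norm (?I - of_nat n / g) \<le> E / 2"
    proof -
      have "?I - of_nat n / g = of_nat n * (integral\<^sup>L \<mu> ?F - 1 / g)" by (simp add: algebra_simps)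
      then have "norm (?I - of_nat n / g) = n * norm (integral\<^sup>L \<mu> ?F - 1 / g)" by (simp add: norm_mult)
      also have "\<dots> \<le> n * (D.mean_bound * w powr (1/4))" by (intro mult_left_mono mF) simp
      finally show ?thesis using mean by linarith
    qed
    ultimately show "norm (?S - of_nat n / g) \<le> E"
      using norm_triangle_ineq[of "?S - ?I" "?I - of_nat n / g"] by simp
    have "\<bar>(\<Sum>j=1..n. norm (?F (X j \<omega>)) ^ 2) - n * (\<integral>x. norm (?F x) ^ 2 \<partial>\<mu>)\<bar> < E / (2 * s)"
      using \<omega> by (auto simp: B2_def not_le)
    moreover have "n * (\<integral>x. norm (?F x) ^ 2 \<partial>\<mu>) \<le> n * V" by (intro mult_left_mono m2) simp
    moreover have "n * V \<le> E / (2 * s)" using energy by (simp add: V_def)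
    moreover have "E / (2 * s) + E / (2 * s) = E / s" using s by (simp add: field_simps)
    ultimately show "(\<Sum>j=1..n. norm (?F (X j \<omega>)) ^ 2) \<le> E / s" by linarith
  qed
  show ?thesis using B pB good by (intro bexI[of _ "B1 \<union> B2"]) auto
qed

text \<open>An indicator is its own square, so its mean \<open>m\<close> also bounds the second
  moment; a deviation by half the mean then has probability at most
  \<open>4 / (n * m)\<close>.\<close>

lemma edge_count_failure:
  fixes n :: nat
  assumes w: "0 < w" "w \<le> \<epsilon>" and n: "0 < n"
  shows "\<exists>B\<in>sets M. measure M B \<le> 4 / (n * (k * (w / 2) powr (\<alpha> + 1))) \<and>
    (\<forall>\<omega>\<in>space M - B. n * (k * (w / 2) powr (\<alpha> + 1)) / 2 \<le> card {i \<in> {1..n}. 1 - w / 2 \<le> norm (X i \<omega>)})"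
proof -
  let ?A = "{x::complex. 1 - w / 2 \<le> norm x}"
  let ?h = "indicator ?A :: complex \<Rightarrow> real"
  define m where "m = measure \<mu> ?A"
  have lo: "k * (w / 2) powr (\<alpha> + 1) \<le> m"
    unfolding m_def by (rule D.lower) (use w in auto)
  have lo0: "0 < k * (w / 2) powr (\<alpha> + 1)" using w D.k by simp
  have m0: "0 < m" using lo lo0 by linarith
  have Ih: "integral\<^sup>L \<mu> ?h = m" by (simp add: m_def)
  have Ih2: "(\<integral>x. (?h x)\<^sup>2 \<partial>\<mu>) \<le> m"
    by (simp add: m_def power2_eq_square indicator_inter_arith[symmetric])
  define B where "B = {\<omega> \<in> space M. n * m / 2 \<le> \<bar>(\<Sum>j=1..n. ?h (X j \<omega>)) - n * integral\<^sup>L \<mu> ?h\<bar>}"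
  have mX: "(\<lambda>\<omega>. ?h (X j \<omega>)) \<in> borel_measurable M" if "j \<in> {1..n}" for j
    using X_borel[OF that] by measurable
  have B: "B \<in> sets M" unfolding B_def using mX by measurable
  have "measure M B \<le> n * m / (n * m / 2)\<^sup>2"
    unfolding B_def by (rule S.Chebyshev_sum_real[of _ 1, OF _ _ Ih2]) (use n m0 in \<open>auto simp: indicator_def\<close>)
  also have "\<dots> = 4 / (n * m)" using n m0 by (simp add: power2_eq_square field_simps)
  also have "\<dots> \<le> 4 / (n * (k * (w / 2) powr (\<alpha> + 1)))"
    using n lo lo0 m0 w D.k by (intro divide_left_mono mult_left_mono mult_pos_pos) auto
  finally have pB: "measure M B \<le> 4 / (n * (k * (w / 2) powr (\<alpha> + 1)))" .
  have "n * (k * (w / 2) powr (\<alpha> + 1)) / 2 \<le> card {i \<in> {1..n}. 1 - w / 2 \<le> norm (X i \<omega>)}"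
    if "\<omega> \<in> space M - B" for \<omega>
  proof -
    have "\<bar>(\<Sum>j=1..n. ?h (X j \<omega>)) - n * m\<bar> < n * m / 2" using that Ih by (auto simp: B_def not_le)
    then have "n * m / 2 \<le> (\<Sum>j=1..n. ?h (X j \<omega>))" by linarith
    also have "(\<Sum>j=1..n. ?h (X j \<omega>)) = (\<Sum>j\<in>{1..n}. if 1 - w / 2 \<le> norm (X j \<omega>) then 1 else 0)"
      by (intro sum.cong) auto
    also have "\<dots> = card {i \<in> {1..n}. 1 - w / 2 \<le> norm (X i \<omega>)}"
      by (subst sum.inter_filter[symmetric]) auto
    finally have "n * m / 2 \<le> card {i \<in> {1..n}. 1 - w / 2 \<le> norm (X i \<omega>)}" .
    moreover have "n * (k * (w / 2) powr (\<alpha> + 1)) \<le> n * m" using lo by (intro mult_left_mono) auto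
    ultimately show ?thesis by linarith
  qed
  then show ?thesis using B pB by blast
qed

lemma disk_failure: "\<exists>B\<in>sets M. measure M B = 0 \<and> (\<forall>\<omega>\<in>space M - B. \<forall>i\<in>{1..n::nat}. norm (X i \<omega>) \<le> 1)"
proof -
  have "AE \<omega> in M. norm (X i \<omega>) \<le> 1" if "i \<in> {1..n}" for i
  proof -
    have "distr M borel (X i) = \<mu>" by (rule S.distr_X) (use that in simp)
    then have "AE z in distr M borel (X i). norm z \<le> 1" by (simp only: D.disk)
    then show ?thesis using X_borel[OF that] by (subst (asm) AE_distr_iff) auto
  qed
  then have "AE \<omega> in M. \<forall>i\<in>{1..n}. norm (X i \<omega>) \<le> 1" by (intro AE_finite_allI) auto
  then obtain N where "N \<in> null_sets M" "{\<omega> \<in> space M. \<not> (\<forall>i\<in>{1..n}. norm (X i \<omega>) \<le> 1)} \<subseteq> N"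
    by (auto simp: eventually_ae_filter)
  then show ?thesis by (intro bexI[of _ N]) (auto simp: null_sets_def measure_def)
qed

lemma pair_failure:
  fixes n :: nat
  assumes w: "0 < w" "3 * w \<le> \<epsilon>" and q: "0 < q" "q < 2" and L: "0 < L"
  shows "\<exists>B\<in>sets M. measure M B \<le> n\<^sup>2 * (D.pair_bound q * w powr (2 * \<alpha> + 1)) / L \<and>
    (\<forall>\<omega>\<in>space M - B. (\<Sum>i=1..n. \<Sum>j\<in>{1..n}-{i}. pair_kernel q w (X i \<omega>, X j \<omega>)) < ennreal L)"
proof -
  let ?U = "\<lambda>\<omega>. \<Sum>i=1..n. \<Sum>j\<in>{1..n}-{i}. pair_kernel q w (X i \<omega>, X j \<omega>)"
  define B where "B = {\<omega> \<in> space M. ennreal L \<le> ?U \<omega>}"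
  have mX: "(\<lambda>\<omega>. pair_kernel q w (X i \<omega>, X j \<omega>)) \<in> borel_measurable M" if "i \<in> {1..n}" "j \<in> {1..n}" for i j
    using X_borel[OF that(1)] X_borel[OF that(2)] by measurable
  have "?U \<in> borel_measurable M" by (intro borel_measurable_sum mX) auto
  then have B: "B \<in> sets M" unfolding B_def by measurable
  have "measure M B \<le> real n ^ 2 * (D.pair_bound q * w powr (2 * \<alpha> + 1)) / L"
    unfolding B_def
    by (rule S.pair_Markov[OF pair_kernel_measurable D.pair_integral_le[OF w q] L])
      (use D.pair_bound_pos[OF q(2)] in simp)
  then show ?thesis using B by (intro bexI[of _ B]) (auto simp: B_def not_le)
qed

text \<open>The three summands are the failures over the whole net, of the pair energy, and of the
  root count; leaving the unit disc has probability 0. The numerical premises yield the side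
  conditions of the locale.\<close>

lemma root_configuration_failure:
  fixes n :: nat and w s t q E L :: real
  assumes w: "0 < w" "w \<le> 1/8" "4 * w \<le> \<epsilon>" and s: "0 < s" "4 * s \<le> w" and t: "0 < t" "2 * t \<le> s"
    and q: "0 < q" "q < 2" and E: "0 < E" and L: "0 < L"
    and mean: "n * (D.mean_bound * w powr (1/4)) \<le> E / 2"
    and energy: "n * ((2 * s) powr (q - 2) * D.potential_bound q) \<le> E / (2 * s)"
    and n: "2 / n \<le> t" "2 \<le> n" and En: "100 * E \<le> n" "160 * E \<le> s * n\<^sup>2"
    and V: "s * L powr (2 / q) \<le> E" and gap: "2 * t \<le> L powr (- 1 / q)"
    and err: "2 * s + 25 * E / n \<le> 1/4"
  shows "\<exists>B\<in>sets M. measure M B \<le>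
      300 * w / s\<^sup>2 * (33 * real n * (2 * s) powr (q - 2) * D.potential_bound q / E\<^sup>2)
      + n\<^sup>2 * (D.pair_bound q * w powr (2 * \<alpha> + 1)) / L + 4 / (n * (k * (w / 2) powr (\<alpha> + 1))) \<and>
    (\<forall>\<omega>\<in>space M - B. root_configuration n (\<lambda>j. X j \<omega>) w s t E (L powr (2 / q)) \<and>
      n * (k * (w / 2) powr (\<alpha> + 1)) / 2 \<le> card {i \<in> {1..n}. 1 - w / 2 \<le> norm (X i \<omega>)})"
proof -
  have sw: "s \<le> w" "w \<le> 1/2" using s w by auto
  obtain G :: "complex set" where G: "finite G" "card G \<le> 300 * w / s\<^sup>2" "\<And>g. g \<in> G \<Longrightarrow> 1 - 2 * w \<le> norm g"
    "\<And>z. 1 - 2 * w \<le> norm z \<Longrightarrow> norm z \<le> 1 \<Longrightarrow> \<exists>g\<in>G. dist g z \<le> s / 2"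
    by (rule polar_net[OF s(1) sw]) (rule that)
  let ?c = "33 * real n * (2 * s) powr (q - 2) * D.potential_bound q / E\<^sup>2"
  have c0: "0 \<le> ?c" using D.potential_bound_pos[OF q(2)] by simp
  define good where "good g \<omega> \<longleftrightarrow> norm ((\<Sum>j=1..n. far_kernel g (2 * s) (X j \<omega>)) - of_nat n / g) \<le> E \<and>
        (\<Sum>j=1..n. norm (far_kernel g (2 * s) (X j \<omega>)) ^ 2) \<le> E / s" for g \<omega>
  have "\<exists>B\<in>sets M. measure M B \<le> ?c \<and> (\<forall>\<omega>\<in>space M - B. good g \<omega>)" if "g \<in> G" for g
    unfolding good_def by (rule far_sum_failure[OF w(1,3) G(3)[OF that] s(1) sw(1) q E mean energy])
  then obtain F where F: "\<And>g. g \<in> G \<Longrightarrow> F g \<in> sets M" "\<And>g. g \<in> G \<Longrightarrow> measure M (F g) \<le> ?c"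
    and F': "\<And>g \<omega>. g \<in> G \<Longrightarrow> \<omega> \<in> space M - F g \<Longrightarrow> good g \<omega>"
    by metis
  define B1 where "B1 = (\<Union>g\<in>G. F g)"
  have B1: "B1 \<in> sets M" unfolding B1_def using F(1) G(1) by (intro sets.finite_UN) auto
  have "measure M B1 \<le> (\<Sum>g\<in>G. measure M (F g))"
    unfolding B1_def using F(1) G(1) by (intro measure_UNION_le) auto
  also have "\<dots> \<le> (\<Sum>g\<in>G. ?c)" by (intro sum_mono F(2))
  also have "\<dots> = card G * ?c" by simp
  also have "\<dots> \<le> 300 * w / s\<^sup>2 * ?c" by (rule mult_right_mono[OF G(2) c0])
  finally have p1: "measure M B1 \<le> 300 * w / s\<^sup>2 * ?c" .
  have w3: "3 * w \<le> \<epsilon>" "w \<le> \<epsilon>" using w by auto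
  have n0: "0 < n" using n by simp
  obtain B2 where B2: "B2 \<in> sets M" "measure M B2 \<le> n\<^sup>2 * (D.pair_bound q * w powr (2 * \<alpha> + 1)) / L"
    and B2': "\<And>\<omega>. \<omega> \<in> space M - B2 \<Longrightarrow> (\<Sum>i=1..n. \<Sum>j\<in>{1..n}-{i}. pair_kernel q w (X i \<omega>, X j \<omega>)) < ennreal L"
    using pair_failure[OF w(1) w3(1) q L, of n] by blast
  obtain B3 where B3: "B3 \<in> sets M" "measure M B3 \<le> 4 / (n * (k * (w / 2) powr (\<alpha> + 1)))"
    and B3': "\<And>\<omega>. \<omega> \<in> space M - B3 \<Longrightarrow>
      n * (k * (w / 2) powr (\<alpha> + 1)) / 2 \<le> card {i \<in> {1..n}. 1 - w / 2 \<le> norm (X i \<omega>)}"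
    using edge_count_failure[OF w(1) w3(2) n0] by blast
  obtain B4 where B4: "B4 \<in> sets M" "measure M B4 = 0"
    and B4': "\<And>\<omega> i. \<omega> \<in> space M - B4 \<Longrightarrow> i \<in> {1..n} \<Longrightarrow> norm (X i \<omega>) \<le> 1"
    using disk_failure[of n] by blast
  let ?B = "(B1 \<union> B2) \<union> (B3 \<union> B4)"
  have "measure M ?B \<le> measure M B1 + measure M B2 + (measure M B3 + measure M B4)"
    using B1 B2(1) B3(1) B4(1)
    by (intro order_trans[OF measure_Un_le] add_mono measure_Un_le) auto
  then have pB: "measure M ?B \<le> 300 * w / s\<^sup>2 * ?c
      + n\<^sup>2 * (D.pair_bound q * w powr (2 * \<alpha> + 1)) / L + 4 / (n * (k * (w / 2) powr (\<alpha> + 1)))"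
    using p1 B2(2) B3(2) B4(2) by linarith
  have conf: "root_configuration n (\<lambda>j. X j \<omega>) w s t E (L powr (2 / q))" if \<omega>: "\<omega> \<in> space M - ?B" for \<omega>
  proof
    have \<omega>s: "\<omega> \<in> space M - B2" "\<omega> \<in> space M - B4" using \<omega> by auto
    show "norm (X i \<omega>) \<le> 1" if "i \<in> {1..n}" for i by (rule B4'[OF \<omega>s(2) that])
    show "\<exists>g. dist g z \<le> s / 2 \<and>
      norm ((\<Sum>j=1..n. far_kernel g (2 * s) (X j \<omega>)) - of_nat n / g) \<le> E \<and>
      (\<Sum>j=1..n. norm (far_kernel g (2 * s) (X j \<omega>)) ^ 2) \<le> E / s"
      if z: "1 - 2 * w \<le> norm z" "norm z \<le> 1" for z
    proof -
      obtain g where g: "g \<in> G" "dist g z \<le> s / 2" using G(4)[OF z] by blast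
      have "\<omega> \<in> space M - F g" using \<omega> g(1) by (auto simp: B1_def)
      from F'[OF g(1) this] g(2) show ?thesis unfolding good_def by blast
    qed
    fix i assume i: "i \<in> {1..n}" "1 - 2 * w \<le> norm (X i \<omega>)"
    note c = pair_kernel_consequences[OF q L B2'[OF \<omega>s(1)] i]
    show "(\<Sum>j\<in>{j \<in> {1..n} - {i}. dist (X i \<omega>) (X j \<omega>) \<le> w}. 1 / dist (X i \<omega>) (X j \<omega>) ^ 2) \<le> L powr (2 / q)"
      by (rule c(2))
    fix j assume "j \<in> {1..n}" "i \<noteq> j" "dist (X i \<omega>) (X j \<omega>) \<le> w"
    then show "2 * t < dist (X i \<omega>) (X j \<omega>)" using c(1)[of j] gap by auto
  qed (use w s t n E En V err in auto)
  have B: "?B \<in> sets M" using B1 B2(1) B3(1) B4(1) by auto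
  have cnt: "n * (k * (w / 2) powr (\<alpha> + 1)) / 2 \<le> card {i \<in> {1..n}. 1 - w / 2 \<le> norm (X i \<omega>)}"
    if "\<omega> \<in> space M - ?B" for \<omega>
    using that by (intro B3') auto
  show ?thesis using conf cnt pB by (intro bexI[OF _ B]) blast
qed

end

section \<open>The pairing\<close>

lemma eventually_powr_le:
  fixes a b C :: real
  assumes "a < b"
  shows "\<forall>\<^sub>F n in sequentially. C * real n powr a \<le> real n powr b"
proof -
  have "((\<lambda>n. real n powr (a - b)) \<longlongrightarrow> 0) sequentially"
    by (rule tendsto_neg_powr[OF _ filterlim_real_sequentially]) (use assms in simp)
  then have "\<forall>\<^sub>F n in sequentially. real n powr (a - b) < 1 / (\<bar>C\<bar> + 1)"
    by (rule order_tendstoD) (simp add: add_nonneg_pos)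
  then show ?thesis using eventually_gt_at_top[of 0]
  proof eventually_elim
    case (elim n)
    have "C * real n powr a \<le> (\<bar>C\<bar> + 1) * real n powr a" by (intro mult_right_mono) auto
    also have "\<dots> = (\<bar>C\<bar> + 1) * real n powr (a - b) * real n powr b" by (simp add: powr_add[symmetric])
    also have "\<dots> \<le> 1 * real n powr b"
      using elim by (intro mult_right_mono) (simp_all add: pos_less_divide_eq mult.commute)
    finally show ?case by simp
  qed
qed

lemma eventually_le_powr_of_ln_smallo:
  fixes c :: "nat \<Rightarrow> real"
  assumes "(\<lambda>n. ln (c n)) \<in> o(\<lambda>n. ln (real n))" "\<And>n. n \<ge> 1 \<Longrightarrow> c n > 0" "0 < a"
  shows "\<forall>\<^sub>F n in sequentially. c n \<le> real n powr a"
proof -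
  have "\<forall>\<^sub>F n in sequentially. norm (ln (c n)) \<le> a * norm (ln (real n))"
    using landau_o.smallD[OF assms(1,3)] .
  then show ?thesis using eventually_ge_at_top[of 1]
  proof eventually_elim
    case (elim n)
    then have "ln (c n) \<le> a * ln n" by simp
    then have "exp (ln (c n)) \<le> exp (a * ln n)" by simp
    then show ?case using assms(2)[of n] elim by (simp add: powr_def)
  qed
qed

text \<open>The three claims for one configuration, with \<open>a\<close> for the required count and
  \<open>d\<close> for \<open>C / (n * c n)\<close>. The error relative to the root appears as
  \<open>2 * d\<close>, because it arises on division by a root of norm at least 1/2.\<close>

definition edge_pairing :: "real \<Rightarrow> nat \<Rightarrow> real \<Rightarrow> real \<Rightarrow> (nat \<Rightarrow> complex) \<Rightarrow> bool" where
  "edge_pairing \<delta> n a d x \<longleftrightarrow>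
    (let p = root_poly n x; A = edge_annulus \<delta> n in
      a \<le> real (card (critical_points p \<inter> A)) \<and>
      (\<forall>i\<in>{1..n}. x i \<in> A \<longrightarrow>
        (\<exists>W. {w \<in> critical_points p. dist w (x i) \<le> real n powr (- (5 + \<delta>) / 6)} = {W} \<and>
          norm (W - x i + 1 / of_nat n *
              (1 / (1 / (of_nat n - 1) * (\<Sum>j\<in>{1..n} - {i}. 1 / (x i - x j)))))
            < 1 / real n powr ((3 - \<delta>) / 2) \<and>
          norm (W - x i * (1 - 1 / of_nat n)) < d)) \<and>
      (\<exists>\<iota>. inj_on \<iota> (critical_points p \<inter> A) \<and>
        (\<forall>W\<in>critical_points p \<inter> A.
          \<iota> W \<in> {1..n} \<and> x (\<iota> W) \<in> A \<and>
          (\<exists>e. norm e \<le> 2 * d \<and> W = x (\<iota> W) * (1 - 1 / of_nat n + e)) \<and>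
          norm (W - x (\<iota> W) * (1 - 1 / of_nat n)) < d)))"

context root_configuration
begin

lemma edge_pairing_of_configuration:
  fixes \<delta> a d :: real
  assumes wt: "w = 1 / real n powr \<delta>" "t = real n powr (- (5 + \<delta>) / 6)"
    and b1: "160 * E / (s * n ^ 3) + 2 / n\<^sup>2 < 1 / real n powr ((3 - \<delta>) / 2)"
    and b2: "(2 * s + 25 * E / n) / n < d"
    and a: "a \<le> card {i \<in> {1..n}. 1 - w / 2 \<le> norm (x i)}"
  shows "edge_pairing \<delta> n a d x"
proof -
  let ?A = "edge_annulus \<delta> n"
  have A: "?A = {z. 1 - w \<le> norm z \<and> norm z \<le> 1}" by (simp add: edge_annulus_def wt)
  have in2: "1 - 2 * w \<le> norm (x i)" if "x i \<in> ?A" for i using that w by (simp add: A)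
  have "a \<le> real (card (critical_points p \<inter> ?A))"
    using a card_critical_points_ge unfolding A by linarith
  moreover have "\<exists>W. {z \<in> critical_points p. dist z (x i) \<le> real n powr (- (5 + \<delta>) / 6)} = {W} \<and>
        norm (W - x i + 1 / of_nat n *
            (1 / (1 / (of_nat n - 1) * (\<Sum>j\<in>{1..n} - {i}. 1 / (x i - x j)))))
          < 1 / real n powr ((3 - \<delta>) / 2) \<and>
        norm (W - x i * (1 - 1 / of_nat n)) < d"
    if i: "i \<in> {1..n}" "x i \<in> ?A" for i
  proof -
    note ii = i(1) in2[OF i(2)]
    obtain W where W: "W \<in> cball (x i) t" "W \<in> critical_points p"
      and uniq: "\<And>z. z \<in> cball (x i) t \<Longrightarrow> z \<in> critical_points p \<Longrightarrow> z = W"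
      using unique_critical_point[OF ii] by blast
    have "{z \<in> critical_points p. dist z (x i) \<le> real n powr (- (5 + \<delta>) / 6)} = {W}"
      unfolding wt(2)[symmetric]
    proof -
      have "dist z (x i) \<le> t \<longleftrightarrow> z \<in> cball (x i) t" for z by (simp add: dist_commute)
      then show "{z \<in> critical_points p. dist z (x i) \<le> t} = {W}" using W uniq by blast
    qed
    moreover have "dist (x i) W \<le> t" using W by simp
    note near = critical_point_near_root[OF ii this W(2)]
    ultimately show ?thesis
      using near(1,3) b1 b2 unfolding H_def by (intro exI[of _ W]) (blast intro: le_less_trans)
  qed
  moreover have "\<exists>\<iota>. inj_on \<iota> (critical_points p \<inter> ?A) \<and>
      (\<forall>W\<in>critical_points p \<inter> ?A.
        \<iota> W \<in> {1..n} \<and> x (\<iota> W) \<in> ?A \<and>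
        (\<exists>e. norm e \<le> 2 * d \<and> W = x (\<iota> W) * (1 - 1 / of_nat n + e)) \<and>
        norm (W - x (\<iota> W) * (1 - 1 / of_nat n)) < d)"
  proof -
    have "\<exists>i. i \<in> {1..n} \<and> x i \<in> ?A \<and> dist (x i) W \<le> t" if "W \<in> critical_points p \<inter> ?A" for W
      using that critical_point_has_root[of W] unfolding A by blast
    then obtain \<iota> where \<iota>: "\<And>W. W \<in> critical_points p \<inter> ?A \<Longrightarrow> \<iota> W \<in> {1..n}"
      "\<And>W. W \<in> critical_points p \<inter> ?A \<Longrightarrow> x (\<iota> W) \<in> ?A"
      "\<And>W. W \<in> critical_points p \<inter> ?A \<Longrightarrow> dist (x (\<iota> W)) W \<le> t"
      by metis
    \<comment> \<open>Two critical points assigned to the same root would share a disc that contains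
      only one.\<close>
    have "inj_on \<iota> (critical_points p \<inter> ?A)"
    proof (rule inj_onI)
      fix W W' assume W: "W \<in> critical_points p \<inter> ?A" "W' \<in> critical_points p \<inter> ?A" "\<iota> W = \<iota> W'"
      have "W \<in> cball (x (\<iota> W)) t" "W' \<in> cball (x (\<iota> W)) t"
        using \<iota>(3)[OF W(1)] \<iota>(3)[OF W(2)] W(3) by auto
      then show "W = W'" using unique_critical_point[OF \<iota>(1)[OF W(1)] in2[OF \<iota>(2)[OF W(1)]]] W(1,2) by blast
    qed
    moreover have "\<iota> W \<in> {1..n} \<and> x (\<iota> W) \<in> ?A \<and>
        (\<exists>e. norm e \<le> 2 * d \<and> W = x (\<iota> W) * (1 - 1 / of_nat n + e)) \<and>
        norm (W - x (\<iota> W) * (1 - 1 / of_nat n)) < d"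
      if W: "W \<in> critical_points p \<inter> ?A" for W
    proof -
      let ?x = "x (\<iota> W)"
      have dW: "norm (W - ?x * (1 - 1 / of_nat n)) < d"
        using critical_point_near_root(1)[OF \<iota>(1)[OF W] in2[OF \<iota>(2)[OF W]] \<iota>(3)[OF W]] W b2 by auto
      have xh: "1/2 \<le> norm ?x" using \<iota>(2)[OF W] w by (simp add: A)
      then have x0: "?x \<noteq> 0" by auto
      define e where "e = (W - ?x * (1 - 1 / of_nat n)) / ?x"
      have "norm e \<le> (d) / (1/2)"
        unfolding e_def norm_divide using dW xh by (intro frac_le order_trans[OF norm_ge_zero less_imp_le[OF dW]]) auto
      then have "norm e \<le> 2 * d" by simp
      moreover have "W = ?x * (1 - 1 / of_nat n + e)"
        using x0 by (simp add: e_def distrib_left)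
      ultimately show ?thesis using dW \<iota>(1,2)[OF W] by blast
    qed
    ultimately show ?thesis by blast
  qed
  ultimately show ?thesis unfolding edge_pairing_def Let_def by blast
qed

end

section \<open>Choice of scales and conclusion\<close>

theorem theorem2p5:
  fixes M :: "'w measure" and X :: "nat \<Rightarrow> 'w \<Rightarrow> complex" and \<mu> :: "complex measure"
    and \<alpha> \<delta> :: real and c :: "nat \<Rightarrow> real"
  assumes "assumption_A \<alpha> \<mu>" and "\<alpha> \<ge> 0"
    and "iid_draws M X \<mu>"
    and "1 / (4 * \<alpha> + 3) < \<delta>" and "\<delta> < 1 / (\<alpha> + 1)"
    and "\<And>n. n \<ge> 1 \<Longrightarrow> c n > 0"
    and "filterlim c at_top sequentially"
    and "(\<lambda>n. ln (c n)) \<in> o(\<lambda>n. ln (real n))"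
  shows "\<exists>C>0. \<exists>\<eta>. \<eta> \<in> o(\<lambda>n. 1 / real n) \<and>
    with_prob_1_minus_O M
      (\<lambda>n \<omega>.
        let p = root_poly n (\<lambda>j. X j \<omega>);
            A = edge_annulus \<delta> n
        in
        \<comment> \<open>(i)\<close>
        real n powr (1 - \<delta> * (\<alpha> + 1)) / (c n * ln (real n)) \<le> real (card (critical_points p \<inter> A))
        \<and>
        \<comment> \<open>(ii)\<close>
        (\<forall>i\<in>{1..n}. X i \<omega> \<in> A \<longrightarrow>
          (\<exists>W. {w \<in> critical_points p. dist w (X i \<omega>) \<le> real n powr (- (5 + \<delta>) / 6)} = {W} \<and>
            norm (W - X i \<omega> + 1 / of_nat n *
                (1 / (1 / (of_nat n - 1) * (\<Sum>j\<in>{1..n} - {i}. 1 / (X i \<omega> - X j \<omega>)))))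
              < 1 / real n powr ((3 - \<delta>) / 2) \<and>
            norm (W - X i \<omega> * (1 - 1 / of_nat n)) < C / (real n * c n)))
        \<and>
        \<comment> \<open>(iii)\<close>
        (\<exists>\<iota>. inj_on \<iota> (critical_points p \<inter> A) \<and>
          (\<forall>W\<in>critical_points p \<inter> A.
            \<iota> W \<in> {1..n} \<and> X (\<iota> W) \<omega> \<in> A \<and>
            (\<exists>e. norm e \<le> \<eta> n \<and> W = X (\<iota> W) \<omega> * (1 - 1 / of_nat n + e)) \<and>
            norm (W - X (\<iota> W) \<omega> * (1 - 1 / of_nat n)) < C / (real n * c n))))
      (\<lambda>n. 1 / c n)"
proof -
  obtain \<epsilon> k K where edge: "edge_density \<mu> \<alpha> \<epsilon> k K"
    using edge_density_of_assumption_A[OF assms(1,2)] by blast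
  interpret D: edge_density \<mu> \<alpha> \<epsilon> k K by (rule edge)
  interpret S: iid_sample M X \<mu> by unfold_locales (rule assms(3))
  have \<alpha>: "0 \<le> \<alpha>" by (rule assms(2))
  have \<delta>0: "0 < \<delta>" using assms(4) \<alpha> by (smt (verit) divide_pos_pos)
  have \<delta>1: "\<delta> * (\<alpha> + 1) < 1" using assms(5) \<alpha> by (simp add: pos_less_divide_eq)
  have \<delta>a: "\<delta> \<le> \<delta> * (\<alpha> + 1)" using \<delta>0 \<alpha> by (simp add: algebra_simps)
  have \<delta>2: "1 < \<delta> * (4 * \<alpha> + 3)" using assms(4) \<alpha> by (simp add: pos_divide_less_eq)
  have \<delta>lt: "\<delta> < 1" using \<delta>1 \<delta>a by linarith
  \<comment> \<open>The expected energy of close pairs is of order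
    \<open>n\<^sup>2 * w powr (2 * \<alpha> + 1) = n powr e\<close>, and
    \<open>3/2 + \<delta>/2\<close> is the largest exponent that the near part tolerates.\<close>
  define e where "e = 2 - \<delta> * (2 * \<alpha> + 1)"
  define \<Delta> where "\<Delta> = 3/2 + \<delta>/2 - e"
  have \<Delta>: "0 < \<Delta>" using \<delta>2 by (simp add: \<Delta>_def e_def algebra_simps)
  have e: "0 < e" "e \<le> 2"
  proof -
    have "\<delta> * (2 * \<alpha> + 1) \<le> 2 * (\<delta> * (\<alpha> + 1))" using \<delta>0 by (simp add: algebra_simps)
    then show "0 < e" using \<delta>1 by (simp add: e_def)
    show "e \<le> 2" using \<delta>0 \<alpha> by (simp add: e_def)
  qed
  \<comment> \<open>\<open>\<kappa>\<close> is the room left in all exponents; \<open>\<Delta> > 0\<close> is the hypothesis \<open>\<delta> > 1 / (4 \<alpha> + 3)\<close>.\<close>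
  define \<kappa> where "\<kappa> = Min {1/16, \<Delta> / 7, \<delta> / 8, (1 - \<delta>) / 8, 1 - \<delta> * (\<alpha> + 1)}"
  \<comment> \<open>\<open>\<Delta> / 7\<close> serves the bound on \<open>v\<close>,
    \<open>\<delta> / 8\<close> the mean error \<open>n * w powr (1/4)\<close>,
    \<open>(1 - \<delta>) / 8\<close> the relation \<open>4 * s \<le> w\<close>, and the last entry
    the probability of too few roots.\<close>
  have \<kappa>le: "\<kappa> \<le> 1/16" "\<kappa> \<le> \<Delta> / 7" "\<kappa> \<le> \<delta> / 8" "\<kappa> \<le> (1 - \<delta>) / 8" "\<kappa> \<le> 1 - \<delta> * (\<alpha> + 1)"
    unfolding \<kappa>_def by (intro Min_le; simp)+
  have \<kappa>0: "0 < \<kappa>"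
    unfolding \<kappa>_def using \<Delta> \<delta>0 \<delta>lt \<delta>1 by (subst Min_gr_iff) auto
  \<comment> \<open>With the shift by \<open>2 * \<kappa>\<close>, the failure exponent over the net
    is \<open>- \<delta> + 2 * \<sigma> - 1 + \<sigma> * \<kappa> + 2 * \<kappa> = \<sigma> *
    \<kappa> - 2 * \<kappa>\<close>, which is at most \<open>- \<kappa>\<close> because
    \<open>\<sigma> < 1\<close>.\<close>
  define \<sigma> where "\<sigma> = (1 + \<delta>) / 2 - 2 * \<kappa>"
  define q where "q = 2 - \<kappa>"
  define v where "v = (e + \<kappa>) * (2 / q)"
  have q: "0 < q" "q < 2" using \<kappa>0 \<kappa>le by (auto simp: q_def)
  have \<sigma>: "3/8 \<le> \<sigma>" "\<sigma> < 1" using \<kappa>0 \<kappa>le(1) \<delta>0 \<delta>lt by (auto simp: \<sigma>_def field_simps)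
  \<comment> \<open>Exactly the condition \<open>v - \<sigma> \<le> 1 - \<kappa>\<close>, that is,
    \<open>s * V \<le> E\<close>. As \<open>v \<le> e + 4 * \<kappa>\<close>, it amounts to
    \<open>7 * \<kappa> \<le> \<Delta>\<close>.\<close>
  have v: "v \<le> 3/2 + \<delta>/2 - 3 * \<kappa>"
  proof -
    have "2 / q \<le> 1 + \<kappa>"
    proof -
      have "2 \<le> (1 + \<kappa>) * q"
      proof -
        have "(1 + \<kappa>) * q = 2 + \<kappa> * (1 - \<kappa>)" by (simp add: q_def algebra_simps)
        moreover have "0 \<le> \<kappa> * (1 - \<kappa>)" using \<kappa>0 \<kappa>le(1) by (intro mult_nonneg_nonneg) auto
        ultimately show ?thesis by linarith
      qed
      then show ?thesis using q by (simp add: pos_divide_le_eq)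
    qed
    then have "v \<le> (e + \<kappa>) * (1 + \<kappa>)" unfolding v_def using e \<kappa>0 by (intro mult_left_mono) auto
    also have "\<dots> = e + \<kappa> + \<kappa> * e + \<kappa> * \<kappa>" by (simp add: algebra_simps)
    also have "\<dots> \<le> e + \<kappa> + \<kappa> * 2 + \<kappa> * 1"
      using e \<kappa>0 \<kappa>le(1) by (intro add_mono mult_left_mono) auto
    also have "\<dots> \<le> 3/2 + \<delta>/2 - 3 * \<kappa>" using \<kappa>le(2) by (simp add: \<Delta>_def)
    finally show ?thesis .
  qed
  let ?P = "D.potential_bound q"
  have P0: "0 < ?P" by (rule D.potential_bound_pos[OF q(2)])
  define C1 where "C1 = 300 * 33 * 2 powr (- \<kappa>) * ?P"
  define C2 where "C2 = D.pair_bound q"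
  define C3 where "C3 = 4 * 2 powr (\<alpha> + 1) / k"
  have C: "0 \<le> C1" "0 \<le> C2" "0 \<le> C3"
    using P0 D.pair_bound_pos[OF q(2)] D.k by (auto simp: C1_def C2_def C3_def less_imp_le)
  define w where "w n = real n powr (- \<delta>)" for n
  define s where "s n = real n powr (- \<sigma>)" for n
  define t where "t n = real n powr (- (5 + \<delta>) / 6)" for n
  define E where "E n = real n powr (1 - \<kappa>)" for n
  define L where "L n = real n powr (e + \<kappa>)" for n
  let ?Q = "\<lambda>n \<omega>. root_configuration n (\<lambda>j. X j \<omega>) (w n) (s n) (t n) (E n) (L n powr (2 / q)) \<and>
      n * (k * (w n / 2) powr (\<alpha> + 1)) / 2 \<le> card {i \<in> {1..n}. 1 - w n / 2 \<le> norm (X i \<omega>)}"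
  have w_small: "\<forall>\<^sub>F n in sequentially. a * w n \<le> 1" for a
  proof -
    have "- \<delta> < 0" using \<delta>0 by simp
    from eventually_powr_le[OF this, of a] eventually_gt_at_top[of 0] show ?thesis
      by eventually_elim (simp add: w_def)
  qed
  have ev1: "\<forall>\<^sub>F n in sequentially. 8 * w n \<le> 1 \<and> 4 / \<epsilon> * w n \<le> 1 \<and> 4 * s n \<le> w n \<and> 2 * t n \<le> s n \<and>
      2 * real n powr (- 1) \<le> t n \<and> 2 * t n \<le> real n powr (- v / 2)"
  proof (intro eventually_conj)
    show "\<forall>\<^sub>F n in sequentially. 8 * w n \<le> 1" "\<forall>\<^sub>F n in sequentially. 4 / \<epsilon> * w n \<le> 1"
      by (rule w_small)+
    show "\<forall>\<^sub>F n in sequentially. 4 * s n \<le> w n"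
      unfolding s_def w_def by (rule eventually_powr_le) (use \<kappa>le(4) \<delta>lt in \<open>simp add: \<sigma>_def field_simps\<close>)
    show "\<forall>\<^sub>F n in sequentially. 2 * t n \<le> s n"
      unfolding s_def t_def by (rule eventually_powr_le) (use \<kappa>0 \<delta>lt in \<open>simp add: \<sigma>_def field_simps\<close>)
    show "\<forall>\<^sub>F n in sequentially. 2 * real n powr (- 1) \<le> t n"
      unfolding t_def by (rule eventually_powr_le) (use \<delta>lt in simp)
    \<comment> \<open>The discs fit between the roots because \<open>(5 + \<delta>) / 6 - (3 +
      \<delta>) / 4 = (1 - \<delta>) / 12\<close> is positive.\<close>
    show "\<forall>\<^sub>F n in sequentially. 2 * t n \<le> real n powr (- v / 2)"
      unfolding t_def by (rule eventually_powr_le) (use v \<kappa>0 \<delta>lt in \<open>simp add: field_simps\<close>)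
  qed
  have ev2: "\<forall>\<^sub>F n in sequentially. 2 * D.mean_bound * real n powr (1 - \<delta> / 4) \<le> real n powr (1 - \<kappa>) \<and>
      2 * 2 powr (- \<kappa>) * ?P * 2 * real n powr (1 + \<sigma> * \<kappa>) \<le> real n powr (1 - \<kappa> + \<sigma>) \<and>
      100 * real n powr (1 - \<kappa>) \<le> real n powr 1 \<and>
      160 * real n powr (1 - \<kappa>) \<le> real n powr (2 - \<sigma>) \<and>
      108 * real n powr (- \<kappa>) \<le> real n powr 0"
  proof (intro eventually_conj eventually_powr_le)
    show "1 - \<delta> / 4 < 1 - \<kappa>" using \<kappa>le(3) \<delta>0 by simp
    have "\<sigma> * \<kappa> \<le> 1 * \<kappa>" using \<sigma> \<kappa>0 by (intro mult_right_mono) auto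
    then show "1 + \<sigma> * \<kappa> < 1 - \<kappa> + \<sigma>" using \<sigma> \<kappa>le(1) by linarith
  qed (use \<kappa>0 \<sigma> in auto)
  \<comment> \<open>480 and 6 are three times the constants 160 and 2, so each summand is at most a
    third of the target and the inequality is strict. Likewise 28 exceeds the 27 of
    \<open>err0\<close>.\<close>
  have ev3: "\<forall>\<^sub>F n in sequentially. 480 * real n powr (\<sigma> - 2 - \<kappa>) \<le> real n powr (- (3 - \<delta>) / 2) \<and>
      6 * real n powr (- 2) \<le> real n powr (- (3 - \<delta>) / 2) \<and>
      28 * real n powr (- \<kappa>) \<le> real n powr (- \<kappa> / 2)"
  proof (intro eventually_conj eventually_powr_le)
    show "\<sigma> - 2 - \<kappa> < - (3 - \<delta>) / 2" using \<kappa>0 by (simp add: \<sigma>_def field_simps)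
  qed (use \<kappa>0 \<delta>0 in auto)
  \<comment> \<open>Failure probability and displacement error are both of order
    \<open>n powr (- \<kappa>)\<close>. Since \<open>c n\<close> grows slower than every power of
    \<open>n\<close>, both fall below constant multiples of \<open>1 / c n\<close>.\<close>
  have ev4: "\<forall>\<^sub>F n in sequentially. c n \<le> real n powr (\<kappa> / 2)"
    using eventually_le_powr_of_ln_smallo[OF assms(8,6)] \<kappa>0 by simp
  \<comment> \<open>The divergence of \<open>c n\<close> absorbs the constant
    \<open>k / (2 * 2 powr (\<alpha> + 1))\<close> in the count of (i).\<close>
  have ev5: "\<forall>\<^sub>F n in sequentially. 2 * 2 powr (\<alpha> + 1) / k \<le> c n"
    using assms(7) by (simp add: filterlim_at_top)
  define good where "good n B \<longleftrightarrow> B \<in> sets M \<and> measure M B \<le> (C1 + C2 + C3) * (1 / c n) \<and>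
     (\<forall>\<omega>\<in>space M - B. ?Q n \<omega>) \<and> 3 \<le> n \<and>
      160 * E n / (s n * n ^ 3) + 2 / n\<^sup>2 < 1 / real n powr ((3 - \<delta>) / 2) \<and>
      (2 * s n + 25 * E n / n) / n < 1 / (real n * c n) \<and>
      real n powr (1 - \<delta> * (\<alpha> + 1)) / (c n * ln (real n)) \<le> n * (k * (w n / 2) powr (\<alpha> + 1)) / 2"
    for n :: nat and B
  have "\<forall>\<^sub>F n in sequentially. \<exists>B. good n B"
    using ev1 ev2 ev3 ev4 ev5 eventually_ge_at_top[of "3::nat"]
  proof eventually_elim
    case (elim n)
    have n3: "3 \<le> n" and n1: "1 \<le> real n" and n0: "0 < real n" using elim by auto
    have c0: "0 < c n" using assms(6)[of n] n3 by simp
    have pos: "0 < w n" "0 < s n" "0 < t n" "0 < E n" "0 < L n"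
      using n0 by (auto simp: w_def s_def t_def E_def L_def)
    have Lq: "L n powr (2 / q) = real n powr v" "L n powr (- 1 / q) = real n powr (- v / 2)"
    proof -
      have "(e + \<kappa>) * (- 1 / q) = - v / 2" using q by (simp add: v_def field_simps)
      then show "L n powr (- 1 / q) = real n powr (- v / 2)" by (simp only: L_def powr_powr)
    qed (simp add: L_def v_def powr_powr)
    have s2: "(2 * s n) powr (q - 2) = 2 powr (- \<kappa>) * real n powr (\<sigma> * \<kappa>)"
      by (simp add: s_def q_def powr_mult powr_powr)
    have s\<kappa>: "s n \<le> real n powr (- \<kappa>)" unfolding s_def using \<sigma> \<kappa>le(1) n1 by (intro powr_mono) auto
    have En: "E n / n = real n powr (- \<kappa>)"
      using n0 by (simp add: E_def powr_diff powr_minus divide_simps)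
    have err0: "2 * s n + 25 * E n / n \<le> 27 * real n powr (- \<kappa>)" using s\<kappa> En by simp
    have "\<exists>B\<in>sets M. measure M B \<le>
      300 * w n / (s n)\<^sup>2 * (33 * real n * (2 * s n) powr (q - 2) * ?P / (E n)\<^sup>2)
      + n\<^sup>2 * (D.pair_bound q * w n powr (2 * \<alpha> + 1)) / L n + 4 / (n * (k * (w n / 2) powr (\<alpha> + 1))) \<and>
      (\<forall>\<omega>\<in>space M - B. ?Q n \<omega>)"
    proof (rule root_configuration_failure[OF S.iid_sample_axioms edge pos(1) _ _ pos(2) _ pos(3) _ q pos(4,5)])
      show "w n \<le> 1/8" "4 * w n \<le> \<epsilon>" "4 * s n \<le> w n" "2 * t n \<le> s n" "2 / n \<le> t n" "2 \<le> n"
        using elim D.\<epsilon> n0 by (auto simp: powr_minus_divide divide_le_eq mult.commute)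
      have "real n * (D.mean_bound * w n powr (1/4)) = D.mean_bound * (real n powr 1 * real n powr (- \<delta> / 4))"
        using n0 by (simp add: w_def powr_powr)
      also have "\<dots> = D.mean_bound * real n powr (1 - \<delta> / 4)" by (simp only: powr_add[symmetric]) simp
      finally have "real n * (D.mean_bound * w n powr (1/4)) = D.mean_bound * real n powr (1 - \<delta> / 4)" .
      moreover have "2 * D.mean_bound * real n powr (1 - \<delta> / 4) \<le> E n" using elim(2) unfolding E_def by blast
      ultimately show "real n * (D.mean_bound * w n powr (1/4)) \<le> E n / 2" by linarith
      have "real n * ((2 * s n) powr (q - 2) * ?P) = 2 powr (- \<kappa>) * ?P * (real n powr 1 * real n powr (\<sigma> * \<kappa>))"
        using n0 by (simp add: s2)
      also have "\<dots> = 2 powr (- \<kappa>) * ?P * real n powr (1 + \<sigma> * \<kappa>)" by (simp only: powr_add)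
      also have "\<dots> \<le> 1 / 2 * real n powr (1 - \<kappa> + \<sigma>)"
      proof -
        have "0 \<le> 2 powr (- \<kappa>) * ?P * real n powr (1 + \<sigma> * \<kappa>)" using P0 by simp
        moreover have "2 * (2 powr (- \<kappa>) * ?P * real n powr (1 + \<sigma> * \<kappa>)) * 2 \<le> real n powr (1 - \<kappa> + \<sigma>)"
          using elim by (simp add: mult_ac)
        ultimately show ?thesis by linarith
      qed
      also have "\<dots> = E n / (2 * s n)"
        using n0 by (simp add: E_def s_def powr_add powr_minus divide_simps)
      finally show "real n * ((2 * s n) powr (q - 2) * ?P) \<le> E n / (2 * s n)" .
      show "100 * E n \<le> n" using elim n0 by (simp add: E_def)
      have "s n * n\<^sup>2 = real n powr (- \<sigma>) * real n powr 2" using n0 by (simp add: s_def powr_numeral)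
      also have "\<dots> = real n powr (2 - \<sigma>)" by (simp only: powr_add[symmetric]) simp
      finally show "160 * E n \<le> s n * n\<^sup>2" using elim by (simp add: E_def)
      have "s n * L n powr (2 / q) = real n powr (v - \<sigma>)" by (simp add: s_def Lq powr_add[symmetric])
      also have "\<dots> \<le> E n"
        unfolding E_def using n1 v by (intro powr_mono) (auto simp: \<sigma>_def field_simps)
      finally show "s n * L n powr (2 / q) \<le> E n" .
      show "2 * t n \<le> L n powr (- 1 / q)" unfolding Lq using elim(1) by blast
      show "2 * s n + 25 * E n / n \<le> 1/4" using err0 elim n0 by simp
    qed
    then obtain B where B: "B \<in> sets M" "\<forall>\<omega>\<in>space M - B. ?Q n \<omega>"
      and pB: "measure M B \<le>
      300 * w n / (s n)\<^sup>2 * (33 * real n * (2 * s n) powr (q - 2) * ?P / (E n)\<^sup>2)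
      + n\<^sup>2 * (D.pair_bound q * w n powr (2 * \<alpha> + 1)) / L n + 4 / (n * (k * (w n / 2) powr (\<alpha> + 1)))"
      by blast
    have t1: "300 * w n / (s n)\<^sup>2 * (33 * real n * (2 * s n) powr (q - 2) * ?P / (E n)\<^sup>2) \<le> C1 * real n powr (- \<kappa>)"
    proof -
      have "300 * w n / (s n)\<^sup>2 * (33 * real n * (2 * s n) powr (q - 2) * ?P / (E n)\<^sup>2)
        = C1 * (w n * inverse (s n) ^ 2 * real n powr 1 * real n powr (\<sigma> * \<kappa>) * inverse (E n) ^ 2)"
        unfolding s2 using n0 by (simp add: C1_def divide_inverse power_inverse mult_ac)
      also have "w n * inverse (s n) ^ 2 * real n powr 1 * real n powr (\<sigma> * \<kappa>) * inverse (E n) ^ 2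
         = real n powr (- \<delta> + (\<sigma> + \<sigma>) + 1 + \<sigma> * \<kappa> + ((\<kappa> - 1) + (\<kappa> - 1)))"
      proof -
        have "inverse (s n) = real n powr \<sigma>" "inverse (E n) = real n powr (\<kappa> - 1)"
          by (simp_all add: s_def E_def powr_minus[symmetric])
        then show ?thesis by (simp only: w_def power2_eq_square powr_add)
      qed
      also have "\<dots> \<le> real n powr (- \<kappa>)"
      proof (rule powr_mono[OF _ n1])
        have "\<sigma> * \<kappa> \<le> 1 * \<kappa>" using \<sigma> \<kappa>0 by (intro mult_right_mono) auto
        then show "- \<delta> + (\<sigma> + \<sigma>) + 1 + \<sigma> * \<kappa> + ((\<kappa> - 1) + (\<kappa> - 1)) \<le> - \<kappa>" by (simp add: \<sigma>_def field_simps)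
      qed
      finally show ?thesis using C(1) by (simp add: mult_left_mono)
    qed
    have t2: "n\<^sup>2 * (D.pair_bound q * w n powr (2 * \<alpha> + 1)) / L n = C2 * real n powr (- \<kappa>)"
    proof -
      have "n\<^sup>2 * (D.pair_bound q * w n powr (2 * \<alpha> + 1)) / L n
        = C2 * (real n powr 2 * real n powr (- \<delta> * (2 * \<alpha> + 1)) * real n powr (- (e + \<kappa>)))"
      proof -
        have "w n powr (2 * \<alpha> + 1) = real n powr (- \<delta> * (2 * \<alpha> + 1))" unfolding w_def by (rule powr_powr)
        moreover have "inverse (L n) = real n powr (- (e + \<kappa>))" by (simp only: L_def powr_minus)
        moreover have "real (n\<^sup>2) = real n powr 2" using n0 by (simp add: powr_numeral)
        ultimately show ?thesis by (simp only: C2_def divide_inverse mult_ac)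
      qed
      also have "real n powr 2 * real n powr (- \<delta> * (2 * \<alpha> + 1)) * real n powr (- (e + \<kappa>)) = real n powr (- \<kappa>)"
        by (simp only: powr_add[symmetric]) (simp add: e_def)
      finally show ?thesis .
    qed
    have wk: "n * (k * (w n / 2) powr (\<alpha> + 1)) = k / 2 powr (\<alpha> + 1) * real n powr (1 - \<delta> * (\<alpha> + 1))"
    proof -
      have "n * (k * (w n / 2) powr (\<alpha> + 1)) = k / 2 powr (\<alpha> + 1) * (real n powr 1 * real n powr (- \<delta> * (\<alpha> + 1)))"
        using n0 by (simp add: w_def powr_divide powr_powr)
      also have "real n powr 1 * real n powr (- \<delta> * (\<alpha> + 1)) = real n powr (1 - \<delta> * (\<alpha> + 1))"
        by (simp only: powr_add[symmetric]) simp
      finally show ?thesis .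
    qed
    have t3: "4 / (n * (k * (w n / 2) powr (\<alpha> + 1))) \<le> C3 * real n powr (- \<kappa>)"
    proof -
      have "4 / (n * (k * (w n / 2) powr (\<alpha> + 1))) = C3 * real n powr (- (1 - \<delta> * (\<alpha> + 1)))"
        unfolding wk powr_minus C3_def by (simp add: divide_inverse)
      also have "\<dots> \<le> C3 * real n powr (- \<kappa>)"
        using C(3) n1 \<kappa>le(5) by (intro mult_left_mono powr_mono) auto
      finally show ?thesis .
    qed
    have cinv: "real n powr (- \<kappa> / 2) \<le> 1 / c n"
    proof -
      have "1 / real n powr (\<kappa> / 2) \<le> 1 / c n" using elim c0 by (intro divide_left_mono mult_pos_pos) (auto simp: n0)
      then show ?thesis by (simp add: powr_minus_divide)
    qed
    have "measure M B \<le> (C1 + C2 + C3) * real n powr (- \<kappa>)"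
      using pB t1 t2 t3 by (simp add: distrib_right)
    also have "\<dots> \<le> (C1 + C2 + C3) * (1 / c n)"
    proof (rule mult_left_mono)
      have "real n powr (- \<kappa>) \<le> real n powr (- \<kappa> / 2)" using n1 \<kappa>0 by (intro powr_mono) auto
      then show "real n powr (- \<kappa>) \<le> 1 / c n" using cinv by linarith
    qed (use C in simp)
    finally have prob: "measure M B \<le> (C1 + C2 + C3) * (1 / c n)" .
    have b1: "160 * E n / (s n * n ^ 3) + 2 / n\<^sup>2 < 1 / real n powr ((3 - \<delta>) / 2)"
    proof -
      have "E n / (s n * n ^ 3) = real n powr (1 - \<kappa>) * real n powr \<sigma> * real n powr (- 3)"
        using n0 by (simp add: E_def s_def powr_minus powr_numeral divide_inverse)
      also have "\<dots> = real n powr (\<sigma> - 2 - \<kappa>)" by (simp only: powr_add[symmetric]) (simp add: algebra_simps)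
      finally have "160 * E n / (s n * n ^ 3) = 160 * real n powr (\<sigma> - 2 - \<kappa>)" by simp
      moreover have "2 / n\<^sup>2 = 2 * real n powr (- 2)" using n0 by (simp add: powr_minus powr_numeral divide_inverse)
      moreover have "1 / real n powr ((3 - \<delta>) / 2) = real n powr (- (3 - \<delta>) / 2)"
        unfolding minus_divide_left[symmetric] by (simp only: powr_minus_divide)
      moreover have "0 < real n powr (- (3 - \<delta>) / 2)" using n0 by simp
      ultimately show ?thesis using elim(3) by linarith
    qed
    have b2: "(2 * s n + 25 * E n / n) / n < 1 / (real n * c n)"
    proof -
      have "0 < real n powr (- \<kappa>)" using n0 by simp
      then have "2 * s n + 25 * E n / n < 1 / c n" using err0 elim(3) cinv by linarith
      then have "(2 * s n + 25 * E n / n) / n < (1 / c n) / n" using n0 by (rule divide_strict_right_mono)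
      then show ?thesis by (simp add: mult.commute)
    qed
    have b3: "real n powr (1 - \<delta> * (\<alpha> + 1)) / (c n * ln (real n)) \<le> n * (k * (w n / 2) powr (\<alpha> + 1)) / 2"
    proof -
      \<comment> \<open>\<open>3 \<le> n\<close> gives \<open>ln n \<ge> 1\<close>, so the logarithm
        in (i) only weakens the required count.\<close>
      have "exp 1 \<le> real n" using exp_le n3 by linarith
      then have "1 \<le> ln (real n)" using n0 by (simp add: ln_ge_iff)
      then have "2 * 2 powr (\<alpha> + 1) / k * 1 \<le> c n * ln (real n)"
        using elim(5) D.k c0 by (intro mult_mono) auto
      then have "real n powr (1 - \<delta> * (\<alpha> + 1)) / (c n * ln (real n))
          \<le> real n powr (1 - \<delta> * (\<alpha> + 1)) / (2 * 2 powr (\<alpha> + 1) / k)"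
        using D.k c0 \<open>1 \<le> ln (real n)\<close> by (intro divide_left_mono mult_pos_pos divide_pos_pos) auto
      also have "\<dots> = n * (k * (w n / 2) powr (\<alpha> + 1)) / 2" unfolding wk using D.k by (simp add: field_simps)
      finally show ?thesis .
    qed
    show ?case unfolding good_def using B prob n3 b1 b2 b3 by blast
  qed
  then obtain n0 where n0: "\<And>n. n \<ge> n0 \<Longrightarrow> \<exists>B. good n B"
    unfolding eventually_sequentially by blast
  define B0 where "B0 n = (SOME B. good n B)" for n
  have "good n (B0 n)" if "n \<ge> n0" for n unfolding B0_def by (rule someI_ex[OF n0[OF that]])
  note B0 = this[unfolded good_def]
  \<comment> \<open>For the finitely many small \<open>n\<close> the whole space is the exceptional
    event, which does not affect the order of growth.\<close>
  define B where "B n = (if n \<ge> n0 then B0 n else space M)" for n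
  have Bsets: "B n \<in> sets M" for n using B0[of n] by (simp add: B_def)
  have BO: "(\<lambda>n. measure M (B n)) \<in> O(\<lambda>n. 1 / c n)"
  proof (rule bigoI[of _ "C1 + C2 + C3"])
    show "\<forall>\<^sub>F n in sequentially. norm (measure M (B n)) \<le> (C1 + C2 + C3) * norm (1 / c n)"
      using eventually_ge_at_top[of n0]
    proof eventually_elim
      case (elim n)
      have "0 < c n" using assms(6)[of n] B0[OF elim] by simp
      moreover have "measure M (B0 n) \<le> (C1 + C2 + C3) * (1 / c n)" using B0[OF elim] by blast
      ultimately show ?case using elim by (simp add: B_def)
    qed
  qed
  have \<eta>: "(\<lambda>n. 2 * (1 / (real n * c n))) \<in> o(\<lambda>n. 1 / real n)"
  proof (rule smalloI_tendsto)
    have "((\<lambda>n. 2 / c n) \<longlongrightarrow> 0) sequentially"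
      by (rule tendsto_divide_0[OF tendsto_const]) (rule filterlim_at_top_imp_at_infinity[OF assms(7)])
    moreover have "\<forall>\<^sub>F n in sequentially. 2 / c n = 2 * (1 / (real n * c n)) / (1 / real n)"
      using eventually_gt_at_top[of 0] by eventually_elim simp
    ultimately show "((\<lambda>n. 2 * (1 / (real n * c n)) / (1 / real n)) \<longlongrightarrow> 0) sequentially"
      by (rule Lim_transform_eventually)
    show "\<forall>\<^sub>F n in sequentially. 1 / real n \<noteq> 0"
      using eventually_gt_at_top[of 0] by eventually_elim simp
  qed
  have concl: "edge_pairing \<delta> n (real n powr (1 - \<delta> * (\<alpha> + 1)) / (c n * ln (real n)))
      (1 / (real n * c n)) (\<lambda>j. X j \<omega>)" if "n \<ge> n0" "\<omega> \<in> space M - B0 n" for n \<omega>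
  proof -
    have Q: "root_configuration n (\<lambda>j. X j \<omega>) (w n) (s n) (t n) (E n) (L n powr (2 / q))"
      and cnt: "n * (k * (w n / 2) powr (\<alpha> + 1)) / 2 \<le> card {i \<in> {1..n}. 1 - w n / 2 \<le> norm (X i \<omega>)}"
      using B0[OF that(1)] that(2) by blast+
    have b: "160 * E n / (s n * n ^ 3) + 2 / n\<^sup>2 < 1 / real n powr ((3 - \<delta>) / 2)"
      "(2 * s n + 25 * E n / n) / n < 1 / (real n * c n)"
      "real n powr (1 - \<delta> * (\<alpha> + 1)) / (c n * ln (real n)) \<le> n * (k * (w n / 2) powr (\<alpha> + 1)) / 2"
      using B0[OF that(1)] by blast+
    show ?thesis
      by (rule root_configuration.edge_pairing_of_configuration[OF Q _ t_def b(1,2) order_trans[OF b(3) cnt]])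
        (simp add: w_def powr_minus_divide)
  qed
  have "with_prob_1_minus_O M
      (\<lambda>n \<omega>. edge_pairing \<delta> n (real n powr (1 - \<delta> * (\<alpha> + 1)) / (c n * ln (real n)))
        (1 / (real n * c n)) (\<lambda>j. X j \<omega>)) (\<lambda>n. 1 / c n)"
    unfolding with_prob_1_minus_O_def
  proof (intro exI[of _ B] conjI allI Bsets BO subsetI)
    fix n \<omega>
    assume "\<omega> \<in> {\<omega> \<in> space M. \<not> edge_pairing \<delta> n (real n powr (1 - \<delta> * (\<alpha> + 1)) / (c n * ln (real n)))
        (1 / (real n * c n)) (\<lambda>j. X j \<omega>)}"
    then show "\<omega> \<in> B n" using concl[of n \<omega>] by (auto simp: B_def)
  qed
  with \<eta> show ?thesis
    unfolding edge_pairing_def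
    by (intro exI[of _ "1::real"] exI[of _ "\<lambda>n. 2 * (1 / (real n * c n))"] conjI) simp_all
qed

end
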